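(* Let $d\in\mathbb{N}$, $T>0$, and let $\alpha\in(1/3,1/2)$ and $p\in(1,+\infty]$ be such that $\alpha>1/p$. Then there exists a map $$L:W^\alpha_p([0,T];\mathbb{R}^d)\to W^\alpha_p([0,T];G^2(\mathbb{R}^d)),\qquad X\mapsto L(X)=:\mathbf{X},$$ such that $\mathbf{X}=L(X)$ is a Sobolev rough path lift of $X$ for every $X$, and $L$ is locally Lipschitz continuous with respect to the inhomogeneous Sobolev metric $\rho_{W^\alpha_p}$ on the target space (and the norm $\|\cdot\|_{W^\alpha_p}$ on $W^\alpha_p([0,T];\mathbb{R}^d)$).
   Context: Convention: $1/p:=0$ if $p=+\infty$. **Sobolev paths.** For $\alpha\in(0,1)$, $W^{\alpha}_p([0,T];\mathbb{R}^d)$ is the space of continuous functions $X:[0,T]\to\mathbb{R}^d$ with $\|X\|_{W^\alpha_p}<+\infty$, where for $p<+\infty$ $$\|X\|_{W^\alpha_p}:=\Big(\iint_{[0,T]^2}\frac{|X_u-X_v|^p}{|v-u|^{\alpha p+1}}\,du\,dv\Big)^{1/p}+\Big(\int_0^T|X_u|^p\,du\Big)^{1/p},$$ and for $p=+\infty$, $\|X\|_{W^\alpha_\infty}:=\sup_{u\neq v}\frac{|X_u-X_v|}{|v-u|^\alpha}+\sup_u|X_u|$ (Hölder regularity). **The group $G^2(\mathbb{R}^d)$.** Let $T^2(\mathbb{R}^d)=\mathbb{R}\oplus\mathbb{R}^d\oplus(\mathbb{R}^d)^{\otimes2}$ with (truncated) tensor multiplication $\otimes$, and let $\pi_i$ be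 the projection onto the $i$-th level, $i=0,1,2$. For a continuous path $Z:[0,1]\to\mathbb{R}^d$ of finite variation let $$S_2(Z)_{0,1}:=\Big(1,\int_{0<u<1}dZ_u,\int_{0<u_1<u_2<1}dZ_{u_1}\otimes dZ_{u_2}\Big)\in T^2(\mathbb{R}^d).$$ $G^2(\mathbb{R}^d):=\{S_2(Z)_{0,1}: Z\text{ continuous of finite variation}\}$ is the step-2 free nilpotent group with respect to $\otimes$. The Carnot–Carathéodory norm $\|g\|_{cc}$ of $g\in G^2(\mathbb{R}^d)$ is the infimum of the lengths (total variations) of continuous finite-variation paths $Z$ with $S_2(Z)_{0,1}=g$, and $d_{cc}(g,h):=\|g^{-1}\otimes h\|_{cc}$. **Sobolev rough paths.** $W^\alpha_p([0,T];G^2(\mathbb{R}^d))$ is the space of continuous paths $\mathbf{X}:[0,T]\to G^2(\mathbb{R}^d)$ with $$\|\mathbf{X}\|_{W^\alpha_p}:=\Big(\iint_{[0,T]^2}\frac{d_{cc}(\mathbf{X}_s,\mathbf{X}_t)^p}{|t-s|^{\alpha p+1}}\,ds\,dt\Big)^{1/p}<+\infty,$$ where for $p=+\infty$ this is read as $\sup_{s\neq t}d_{cc}(\mathbf{X}_s,\mathbf{X}_t)/|t-s|^\alpha$. **Rough path lift.** Write $\mathbf{X}_{s,t}:=\mathbf{X}_s^{-1}\otimes\mathbf{X}_t$. The path $\mathbf{X}\in W^\alpha_p([0,T];G^2(\mathbb{R}^d))$ is a Sobolev rough path lift of $X$ if its projection onto the path level is $X$, i.e. $\pi_1(\mathbf{X}_{s,t})=X_t-X_s$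 for all $s,t\in[0,T]$. **Inhomogeneous Sobolev metric.** For $\mathbf{X}^1,\mathbf{X}^2\in W^\alpha_p([0,T];G^2(\mathbb{R}^d))$, $$\rho_{W^\alpha_p}(\mathbf{X}^1,\mathbf{X}^2):=\sum_{k=1,2}\rho^{(k)}_{W^\alpha_p}(\mathbf{X}^1,\mathbf{X}^2),\qquad \rho^{(k)}_{W^\alpha_p}(\mathbf{X}^1,\mathbf{X}^2):=\Big(\int_0^T\int_0^T\frac{|\pi_k(\mathbf{X}^1_{s,t}-\mathbf{X}^2_{s,t})|^{p/k}}{|t-s|^{\alpha p+1}}\,ds\,dt\Big)^{k/p},$$ where for $p=+\infty$ the latter is read as $\sup_{s\neq t}|\pi_k(\mathbf{X}^1_{s,t}-\mathbf{X}^2_{s,t})|/|t-s|^{k\alpha}$. (It only depends on increments, so it identifies paths with equal increments.) **Locally Lipschitz** means that every $X\in W^\alpha_p([0,T];\mathbb{R}^d)$ has a neighbourhood $U$ and a constant $C$ with $\rho_{W^\alpha_p}(L(X^1),L(X^2))\le C\|X^1-X^2\|_{W^\alpha_p}$ for all $X^1,X^2\in U$. *)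

theory Defs
  imports "HOL-Analysis.Analysis"
begin

definition ennreal_powr :: "ennreal \<Rightarrow> real \<Rightarrow> ennreal" where
  "ennreal_powr I r = (if I = \<infinity> then \<infinity> else ennreal (enn2real I powr r))"

text \<open>For a two-parameter function \<open>D \<ge> 0\<close>, the functional
  \<open>(\<integral>\<integral> D(s,t)^(p/k) / |t-s|^(\<alpha>p+1) ds dt)^(k/p)\<close>,
  read as \<open>sup\<^bsub>s\<noteq>t\<^esub> D(s,t) / |t-s|^(k\<alpha>)\<close> if \<open>p = \<infinity>\<close>. The Sobolev norms below use \<open>k = 1\<close>;
  the inhomogeneous metric uses \<open>k = 1\<close> and \<open>k = 2\<close>.
  All applications have \<open>D(s,s) = 0\<close>, so the integrand is \<open>0\<close> on the diagonal.\<close>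

definition gagliardo :: "nat \<Rightarrow> real \<Rightarrow> ereal \<Rightarrow> real \<Rightarrow> (real \<Rightarrow> real \<Rightarrow> real) \<Rightarrow> ennreal" where
  "gagliardo k \<alpha> p T D =
     (if p = \<infinity> then
        (SUP (s, t) \<in> {(s, t). s \<in> {0..T} \<and> t \<in> {0..T} \<and> s \<noteq> t}.
           ennreal (D s t / \<bar>t - s\<bar> powr (real k * \<alpha>)))
      else
        (let q = real_of_ereal p in
         ennreal_powr
           (\<integral>\<^sup>+ t\<in>{0..T}. (\<integral>\<^sup>+ s\<in>{0..T}.
               ennreal (D s t powr (q / real k) / \<bar>t - s\<bar> powr (\<alpha> * q + 1)) \<partial>lborel) \<partial>lborel)
           (real k / q)))"

definition sobolev_norm :: "real \<Rightarrow> ereal \<Rightarrow> real \<Rightarrow> (real \<Rightarrow> real ^ 'd) \<Rightarrow> ennreal" where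
  "sobolev_norm \<alpha> p T X =
     gagliardo 1 \<alpha> p T (\<lambda>u v. norm (X u - X v)) +
     (if p = \<infinity> then (SUP u\<in>{0..T}. ennreal (norm (X u)))
      else (let q = real_of_ereal p in
              ennreal_powr (\<integral>\<^sup>+ u\<in>{0..T}. ennreal (norm (X u) powr q) \<partial>lborel) (1 / q)))"

text \<open>Functions on \<open>[0,T]\<close> are represented by functions on the reals that are \<open>undefined\<close>
  outside \<open>[0,T]\<close>, so that equality of elements is equality of functions on \<open>[0,T]\<close>.\<close>

definition sobolev_space :: "real \<Rightarrow> ereal \<Rightarrow> real \<Rightarrow> (real \<Rightarrow> real ^ 'd) set" where
  "sobolev_space \<alpha> p T =
     {X \<in> extensional {0..T}. continuous_on {0..T} X \<and> sobolev_norm \<alpha> p T X < \<infinity>}"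

text \<open>The second level \<open>(\<real>\<^sup>d)\<^sup>\<otimes>\<^sup>2\<close> is the space of \<open>d \<times> d\<close> matrices, with \<open>(x \<otimes> y)\<^bsub>ij\<^esub> = x\<^sub>i y\<^sub>j\<close>
  and its Euclidean (Hilbert--Schmidt) norm.\<close>

type_synonym 'd tensor2 = "real \<times> (real ^ 'd) \<times> (real ^ 'd ^ 'd)"

abbreviation level1 :: "'d::finite tensor2 \<Rightarrow> real ^ 'd" ("\<pi>\<^sub>1") where
  "\<pi>\<^sub>1 g \<equiv> fst (snd g)"

abbreviation level2 :: "'d::finite tensor2 \<Rightarrow> real ^ 'd ^ 'd" ("\<pi>\<^sub>2") where
  "\<pi>\<^sub>2 g \<equiv> snd (snd g)"

definition tensor_vec :: "real ^ 'd \<Rightarrow> real ^ 'd \<Rightarrow> real ^ 'd ^ 'd" where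
  "tensor_vec x y = (\<chi> i j. x $ i * y $ j)"

fun tensor_mult :: "'d::finite tensor2 \<Rightarrow> 'd tensor2 \<Rightarrow> 'd tensor2"  (infixl "\<otimes>\<^sub>2" 70) where
  "(a, x, A) \<otimes>\<^sub>2 (b, y, B) =
     (a * b, a *\<^sub>R y + b *\<^sub>R x, a *\<^sub>R B + tensor_vec x y + b *\<^sub>R A)"

definition tensor_one :: "'d::finite tensor2" where
  "tensor_one = (1, 0, 0)"

text \<open>The inverse for \<open>\<otimes>\<close>, meaningful for tensors with nonzero scalar component.\<close>

fun tensor_inv :: "'d::finite tensor2 \<Rightarrow> 'd tensor2" where
  "tensor_inv (a, x, A) =
     (1 / a, - ((1 / a\<^sup>2) *\<^sub>R x), (1 / a ^ 3) *\<^sub>R tensor_vec x x - (1 / a\<^sup>2) *\<^sub>R A)"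

lemma tensor_mult_inv:
  assumes "fst g \<noteq> 0"
  shows "g \<otimes>\<^sub>2 tensor_inv g = tensor_one" and "tensor_inv g \<otimes>\<^sub>2 g = tensor_one"
  using assms
  by (cases g; auto simp: tensor_one_def tensor_vec_def vec_eq_iff field_simps
      power2_eq_square power3_eq_cube)+

definition variation_sums :: "real \<Rightarrow> real \<Rightarrow> (real \<Rightarrow> 'a::real_normed_vector) \<Rightarrow> real set" where
  "variation_sums a b Z = {(\<Sum>K\<in>\<D>. norm (Z (Sup K) - Z (Inf K))) | \<D>. \<D> division_of {a..b}}"

definition finite_variation :: "real \<Rightarrow> real \<Rightarrow> (real \<Rightarrow> 'a::real_normed_vector) \<Rightarrow> bool" where
  "finite_variation a b Z \<longleftrightarrow> bdd_above (variation_sums a b Z)"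

definition total_variation :: "real \<Rightarrow> real \<Rightarrow> (real \<Rightarrow> 'a::real_normed_vector) \<Rightarrow> real" where
  "total_variation a b Z = Sup (variation_sums a b Z)"

text \<open>Riemann--Stieltjes integral of \<open>f\<close> against \<open>g\<close> over \<open>[a,b]\<close>, as a limit along tagged
  divisions of vanishing mesh.\<close>

definition has_rs_integral ::
    "(real \<Rightarrow> real) \<Rightarrow> (real \<Rightarrow> real) \<Rightarrow> real \<Rightarrow> real \<Rightarrow> real \<Rightarrow> bool" where
  "has_rs_integral f g a b I \<longleftrightarrow>
     (\<forall>e>0. \<exists>\<delta>>0. \<forall>\<D>. \<D> tagged_division_of {a..b} \<and> (\<forall>(x, K)\<in>\<D>. diameter K < \<delta>) \<longrightarrow>
        \<bar>(\<Sum>(x, K)\<in>\<D>. f x * (g (Sup K) - g (Inf K))) - I\<bar> < e)"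

definition rs_integral :: "real \<Rightarrow> real \<Rightarrow> (real \<Rightarrow> real) \<Rightarrow> (real \<Rightarrow> real) \<Rightarrow> real" where
  "rs_integral a b f g = (THE I. has_rs_integral f g a b I)"

lemma has_rs_integral_unique:
  assumes "has_rs_integral f g a b I" "has_rs_integral f g a b J"
  shows "I = J"
proof (rule ccontr)
  assume "I \<noteq> J"
  then have e: "\<bar>I - J\<bar> / 2 > 0" by simp
  let ?S = "\<lambda>\<D>. \<Sum>(x, K)\<in>\<D>. f x * (g (Sup K) - g (Inf K))"
  obtain d1 where d1: "d1 > 0" "\<And>\<D>. \<D> tagged_division_of {a..b} \<Longrightarrow>
      \<forall>(x, K)\<in>\<D>. diameter K < d1 \<Longrightarrow> \<bar>?S \<D> - I\<bar> < \<bar>I - J\<bar> / 2"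
    using assms(1) e unfolding has_rs_integral_def by meson
  obtain d2 where d2: "d2 > 0" "\<And>\<D>. \<D> tagged_division_of {a..b} \<Longrightarrow>
      \<forall>(x, K)\<in>\<D>. diameter K < d2 \<Longrightarrow> \<bar>?S \<D> - J\<bar> < \<bar>I - J\<bar> / 2"
    using assms(2) e unfolding has_rs_integral_def by meson
  define d where "d = min d1 d2 / 4"
  have d: "d > 0" "2 * d < d1" "2 * d < d2" using d1(1) d2(1) by (auto simp: d_def)
  obtain \<D> where D: "\<D> tagged_division_of cbox a b" "(\<lambda>x. ball x d) fine \<D>"
    using fine_division_exists[of "\<lambda>x. ball x d" a b] d(1) by (auto simp: gauge_ball)
  have "diameter K \<le> 2 * d" if "(x, K) \<in> \<D>" for x K
  proof -
    have "K \<subseteq> ball x d" using D(2) that by (auto simp: fine_def)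
    from diameter_subset[OF this] d(1) show ?thesis by simp
  qed
  then have "\<bar>?S \<D> - I\<bar> < \<bar>I - J\<bar> / 2" "\<bar>?S \<D> - J\<bar> < \<bar>I - J\<bar> / 2"
    using d d1(2)[of \<D>] d2(2)[of \<D>] D(1) by fastforce+
  then show False by (smt (verit) field_sum_of_halves)
qed

lemma rs_integral_eq: "has_rs_integral f g a b I \<Longrightarrow> rs_integral a b f g = I"
  unfolding rs_integral_def by (blast intro: has_rs_integral_unique)

lemma rs_integral_one:
  assumes "a \<le> b"
  shows "rs_integral a b (\<lambda>_. 1) g = g b - g a"
proof (rule rs_integral_eq, unfold has_rs_integral_def, intro allI impI)
  fix e :: real assume "e > 0"
  then show "\<exists>\<delta>>0. \<forall>\<D>. \<D> tagged_division_of {a..b} \<and> (\<forall>(x, K)\<in>\<D>. diameter K < \<delta>) \<longrightarrow>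
      \<bar>(\<Sum>(x, K)\<in>\<D>. 1 * (g (Sup K) - g (Inf K))) - (g b - g a)\<bar> < e"
    using additive_tagged_division_1[OF assms, of _ g] by (intro exI[of _ 1]) simp
qed

text \<open>The step-2 signature over \<open>[0,1]\<close>; the \<open>(i,j)\<close> entry of the second level is the iterated
  integral of \<open>dZ\<^sup>i(u\<^sub>1) dZ\<^sup>j(u\<^sub>2)\<close> over \<open>0 < u\<^sub>1 < u\<^sub>2 < 1\<close>.\<close>

definition signature2 :: "(real \<Rightarrow> real ^ 'd) \<Rightarrow> 'd::finite tensor2" where
  "signature2 Z =
     (1,
      \<chi> i. rs_integral 0 1 (\<lambda>_. 1) (\<lambda>u. Z u $ i),
      \<chi> i j. rs_integral 0 1 (\<lambda>u. rs_integral 0 u (\<lambda>_. 1) (\<lambda>r. Z r $ i)) (\<lambda>u. Z u $ j))"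

definition fv_paths :: "(real \<Rightarrow> real ^ 'd) set" where
  "fv_paths = {Z. continuous_on {0..1} Z \<and> finite_variation 0 1 Z}"

definition G2 :: "'d::finite tensor2 set" where
  "G2 = signature2 ` fv_paths"

definition cc_norm :: "'d::finite tensor2 \<Rightarrow> real" where
  "cc_norm g = Inf {total_variation 0 1 Z | Z. Z \<in> fv_paths \<and> signature2 Z = g}"

definition d_cc :: "'d::finite tensor2 \<Rightarrow> 'd tensor2 \<Rightarrow> real" where
  "d_cc g h = cc_norm (tensor_inv g \<otimes>\<^sub>2 h)"

definition path_increment :: "(real \<Rightarrow> 'd::finite tensor2) \<Rightarrow> real \<Rightarrow> real \<Rightarrow> 'd tensor2" where
  "path_increment \<X> s t = tensor_inv (\<X> s) \<otimes>\<^sub>2 \<X> t"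

text \<open>Continuity refers to the topology of \<open>G\<^sup>2(\<real>\<^sup>d)\<close> as a subset of the finite-dimensional space
  \<open>T\<^sup>2(\<real>\<^sup>d)\<close>, which is also the topology of \<open>d_cc\<close>.\<close>

definition sobolev_rough_paths :: "real \<Rightarrow> ereal \<Rightarrow> real \<Rightarrow> (real \<Rightarrow> 'd::finite tensor2) set" where
  "sobolev_rough_paths \<alpha> p T =
     {\<X> \<in> {0..T} \<rightarrow>\<^sub>E G2. continuous_on {0..T} \<X> \<and>
        gagliardo 1 \<alpha> p T (\<lambda>s t. d_cc (\<X> s) (\<X> t)) < \<infinity>}"

definition sobolev_rough_lift ::
    "real \<Rightarrow> ereal \<Rightarrow> real \<Rightarrow> (real \<Rightarrow> real ^ 'd) \<Rightarrow> (real \<Rightarrow> 'd::finite tensor2) \<Rightarrow> bool" where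
  "sobolev_rough_lift \<alpha> p T X \<X> \<longleftrightarrow>
     \<X> \<in> sobolev_rough_paths \<alpha> p T \<and>
     (\<forall>s\<in>{0..T}. \<forall>t\<in>{0..T}. \<pi>\<^sub>1 (path_increment \<X> s t) = X t - X s)"

definition rho_sobolev ::
    "real \<Rightarrow> ereal \<Rightarrow> real \<Rightarrow> (real \<Rightarrow> 'd::finite tensor2) \<Rightarrow> (real \<Rightarrow> 'd tensor2) \<Rightarrow> ennreal" where
  "rho_sobolev \<alpha> p T \<X> \<Y> =
     gagliardo 1 \<alpha> p T (\<lambda>s t. norm (\<pi>\<^sub>1 (path_increment \<X> s t - path_increment \<Y> s t))) +
     gagliardo 2 \<alpha> p T (\<lambda>s t. norm (\<pi>\<^sub>2 (path_increment \<X> s t - path_increment \<Y> s t)))"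

definition sobolev_neighbourhood ::
    "real \<Rightarrow> ereal \<Rightarrow> real \<Rightarrow> (real \<Rightarrow> real ^ 'd) \<Rightarrow> (real \<Rightarrow> real ^ 'd) set \<Rightarrow> bool" where
  "sobolev_neighbourhood \<alpha> p T X U \<longleftrightarrow>
     U \<subseteq> sobolev_space \<alpha> p T \<and>
     (\<exists>r>0. {Y \<in> sobolev_space \<alpha> p T. sobolev_norm \<alpha> p T (\<lambda>t. Y t - X t) < ennreal r} \<subseteq> U)"

definition locally_lipschitz_sobolev ::
    "real \<Rightarrow> ereal \<Rightarrow> real \<Rightarrow> ((real \<Rightarrow> real ^ 'd) \<Rightarrow> (real \<Rightarrow> 'd::finite tensor2)) \<Rightarrow> bool" where
  "locally_lipschitz_sobolev \<alpha> p T L \<longleftrightarrow>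
     (\<forall>X\<in>sobolev_space \<alpha> p T. \<exists>U C. sobolev_neighbourhood \<alpha> p T X U \<and>
        (\<forall>X1\<in>U. \<forall>X2\<in>U.
           rho_sobolev \<alpha> p T (L X1) (L X2)
             \<le> ennreal C * sobolev_norm \<alpha> p T (\<lambda>t. X1 t - X2 t)))"

end

theory Submission
  imports Defs
begin

text \<open>The antisymmetric part of the second level is built componentwise. For real-valued \<open>f\<close>, \<open>g\<close>
  one prescribes the Levy area on \<open>[0,T]\<close> to be zero and bisects: Chen's relation fixes the sum of
  the areas of the two halves of a dyadic interval, and both halves get the same share. Since
  \<open>2\<alpha> < 1\<close>, the halving contracts faster than the scaling \<open>2\<^sup>-\<^sup>2\<^sup>\<alpha>\<close> per level, so the areas on
  dyadic intervals inherit the summability of the squared increments. The resulting primitive is an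
  explicit Faber--Schauder series, bilinear in \<open>(f, g)\<close>, which makes the Lipschitz estimate a
  consequence of boundedness.

  Passing between dyadic intervals and the Gagliardo double integral uses that
  \<open>max (\<bar>f s - f t\<bar>, \<bar>g s - g t\<bar>, sqrt \<bar>area s t\<bar>)\<close> is a continuous pseudometric: chaining along dyadic
  points bounds the double integral by the dyadic sums for every such pseudometric, and for
  \<open>\<bar>f s - f t\<bar>\<close> averaging over shrinking intervals gives the converse. The Carnot--Caratheodory norm
  is bounded by realising a group element with finitely many line segments.\<close>

section \<open>Signatures of Lipschitz paths\<close>

text \<open>For \<alpha> < 1/2 the iterated integrals of a path against itself need not exist, so
  the second level is a choice. Membership in \<open>G2\<close> forces its symmetric part to be half
  the tensor square of the first level; only the antisymmetric part is free, and Chen's relation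
  holds for any primitive of it. The two bounds on \<alpha> act in opposite directions: \<alpha> <
  1/2 makes the recursion for the areas contract, while \<alpha> > 1/p says that the weight
  \<open>2 powr (\<alpha> * P) / 2\<close> of a dyadic level exceeds 1, so that point values are
  controlled by averages and dyadic increments decay geometrically. Sums over scales are handled
  without Hoelder, Minkowski or Jensen: every term of a weighted sum is bounded by the whole, the
  P-th root is taken termwise, and a geometric series remains. Half of the available decay is spent
  on those weights and half on summing over the levels. For p = \<infinity> the same recursion is
  run with suprema in place of sums.\<close>

lemma has_rs_integral_density:
  fixes f g g' :: "real \<Rightarrow> real"
  assumes f: "continuous_on {a..b} f"
    and fg: "((\<lambda>u. f u * g' u) has_integral I) {a..b}"
    and g: "\<And>u. u \<in> {a..b} \<Longrightarrow> (g' has_integral (g u - g a)) {a..u}"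
    and M: "\<And>u. \<bar>g' u\<bar> \<le> M" and ab: "a \<le> b"
  shows "has_rs_integral f g a b I"
  unfolding has_rs_integral_def
proof (intro allI impI)
  fix e :: real assume "e > 0"
  have M0: "M \<ge> 0" using M[of 0] by linarith
  \<comment> \<open>The summand 1 keeps the denominator positive when \<open>M * (b - a) = 0\<close>
    and makes the final inequality strict.\<close>
  define e' where "e' = e / (M * (b - a) + 1)"
  have pos: "M * (b - a) + 1 > 0" using M0 ab by (simp add: add_nonneg_pos)
  have e': "e' > 0" using \<open>e > 0\<close> pos by (simp add: e'_def)
  have "uniformly_continuous_on {a..b} f"
    using f compact_uniformly_continuous by blast
  then obtain \<delta> where \<delta>: "\<delta> > 0"
    "\<And>x y. x \<in> {a..b} \<Longrightarrow> y \<in> {a..b} \<Longrightarrow> dist y x < \<delta> \<Longrightarrow> dist (f y) (f x) < e'"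
    using e' unfolding uniformly_continuous_on_def by meson
  have g'int: "g' integrable_on {a..b}" using g[of b] ab by auto
  have fgint: "(\<lambda>u. f u * g' u) integrable_on {a..b}" using fg by auto
  show "\<exists>\<delta>>0. \<forall>\<D>. \<D> tagged_division_of {a..b} \<and> (\<forall>(x, K)\<in>\<D>. diameter K < \<delta>) \<longrightarrow>
        \<bar>(\<Sum>(x, K)\<in>\<D>. f x * (g (Sup K) - g (Inf K))) - I\<bar> < e"
  proof (intro exI[of _ \<delta>] conjI allI impI \<delta>(1))
    fix \<D> assume asm: "\<D> tagged_division_of {a..b} \<and> (\<forall>(x, K)\<in>\<D>. diameter K < \<delta>)"
    then have D: "\<D> tagged_division_of {a..b}" and diam: "\<And>x K. (x, K) \<in> \<D> \<Longrightarrow> diameter K < \<delta>"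
      by auto
    have I: "I = (\<Sum>(x, K)\<in>\<D>. integral K (\<lambda>u. f u * g' u))"
      using integral_combine_tagged_division_topdown[of "\<lambda>u. f u * g' u" a b \<D>] fg fgint D
      by (simp add: integral_unique)
    \<comment> \<open>On one cell the error is the integral of \<open>(f x - f u) * g' u\<close>,
      and uniform continuity makes the first factor smaller than \<open>e'\<close>.\<close>
    have main: "\<bar>f x * (g (Sup K) - g (Inf K)) - integral K (\<lambda>u. f u * g' u)\<bar> \<le> e' * M * measure lborel K"
      if xK: "(x, K) \<in> \<D>" for x K
    proof -
      obtain c d where K: "K = {c..d}" and xin: "x \<in> K" and sub: "K \<subseteq> {a..b}"
        using D xK by (metis box_real(2) tagged_division_ofD(2,3,4))
      have cd: "c \<le> d" "a \<le> c" "d \<le> b" using xin sub K by auto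
      have "g' integrable_on {c..d}"
        using g'int cd by (meson atLeastatMost_subset_iff integrable_on_subinterval)
      moreover have "integral {a..c} g' + integral {c..d} g' = integral {a..d} g'"
        using cd g[of d] by (intro Henstock_Kurzweil_Integration.integral_combine) auto
      moreover have "integral {a..c} g' = g c - g a" "integral {a..d} g' = g d - g a"
        using g[of c] g[of d] cd by (auto simp: integral_unique)
      ultimately have hg: "(g' has_integral (g d - g c)) {c..d}"
        by (metis add_diff_cancel_left' diff_add_cancel diff_diff_eq2 integrable_integral)
      have "(\<lambda>u. f u * g' u) integrable_on {c..d}"
        using fgint cd by (meson atLeastatMost_subset_iff integrable_on_subinterval)
      then have "((\<lambda>u. f x * g' u - f u * g' u) has_integral
          (f x * (g d - g c) - integral {c..d} (\<lambda>u. f u * g' u))) {c..d}"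
        using hg by (intro has_integral_diff has_integral_mult_right integrable_integral)
      moreover have "norm (f x * g' u - f u * g' u) \<le> e' * M" if u: "u \<in> {c..d}" for u
      proof -
        have "dist u x \<le> diameter K"
          using u xin K by (intro diameter_bounded_bound) auto
        then have "dist (f u) (f x) < e'"
          using \<delta>(2)[of x u] diam[OF xK] u xin sub K by force
        then have "\<bar>f x - f u\<bar> * \<bar>g' u\<bar> \<le> e' * M"
          using M[of u] e' by (intro mult_mono) (auto simp: dist_real_def)
        then show ?thesis by (simp add: left_diff_distrib[symmetric] abs_mult)
      qed
      moreover have "0 \<le> e' * M" using e' M0 by simp
      ultimately have "norm (f x * (g d - g c) - integral {c..d} (\<lambda>u. f u * g' u)) \<le> e' * M * measure lborel {c..d}"
        by (intro has_integral_bound_real[of _ "{}"]) auto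
      then show ?thesis using K cd by simp
    qed
    have "\<bar>(\<Sum>(x, K)\<in>\<D>. f x * (g (Sup K) - g (Inf K))) - I\<bar>
        = \<bar>\<Sum>(x, K)\<in>\<D>. f x * (g (Sup K) - g (Inf K)) - integral K (\<lambda>u. f u * g' u)\<bar>"
      unfolding I by (simp add: sum_subtractf[symmetric] case_prod_unfold)
    also have "\<dots> \<le> (\<Sum>(x, K)\<in>\<D>. e' * M * measure lborel K)"
      by (rule order_trans[OF sum_abs], rule sum_mono) (use main in auto)
    also have "\<dots> = e' * M * (\<Sum>(x, K)\<in>\<D>. measure lborel K)"
      by (simp add: sum_distrib_left case_prod_unfold)
    also have "(\<Sum>(x, K)\<in>\<D>. measure lborel K) = b - a"
      using additive_content_tagged_division[of \<D> a b] D ab by simp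
    also have "e' * M * (b - a) < e"
    proof -
      have "e * (M * (b - a)) < e * (M * (b - a) + 1)" using \<open>e > 0\<close> by simp
      then show ?thesis using pos by (simp add: e'_def divide_simps mult_ac)
    qed
    finally show "\<bar>(\<Sum>(x, K)\<in>\<D>. f x * (g (Sup K) - g (Inf K))) - I\<bar> < e" .
  qed
qed

text \<open>A Lipschitz path starting at 0, recorded through a bounded density instead of a
  derivative, so that kinks at the junctions of segments do no harm. The bound on \<open>z\<close>
  is asked for at all real arguments, which lets two densities be pasted without domain
  conditions.\<close>

definition path_with_density ::
    "real \<Rightarrow> (real \<Rightarrow> real ^ 'd) \<Rightarrow> (real \<Rightarrow> real ^ 'd) \<Rightarrow> real ^ 'd \<Rightarrow> real ^ 'd ^ 'd \<Rightarrow> bool" where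
  "path_with_density l z Z x A \<longleftrightarrow>
     (\<forall>i. \<forall>u\<in>{0..1}. ((\<lambda>r. z r $ i) has_integral Z u $ i) {0..u}) \<and>
     (\<forall>r i. \<bar>z r $ i\<bar> \<le> l) \<and> Z 1 = x \<and>
     (\<forall>i j. ((\<lambda>u. Z u $ i * z u $ j) has_integral A $ i $ j) {0..1})"

lemma path_with_densityD:
  assumes "path_with_density l z Z x A"
  shows "\<And>i u. u \<in> {0..1} \<Longrightarrow> ((\<lambda>r. z r $ i) has_integral Z u $ i) {0..u}"
    and "\<And>r i. \<bar>z r $ i\<bar> \<le> l" and "Z 1 = x"
    and "\<And>i j. ((\<lambda>u. Z u $ i * z u $ j) has_integral A $ i $ j) {0..1}"
    and "\<And>i. Z 0 $ i = 0"
proof -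
  show *: "((\<lambda>r. z r $ i) has_integral Z u $ i) {0..u}" if "u \<in> {0..1}" for i u
    using assms that unfolding path_with_density_def by simp
  \<comment> \<open>The integral over the degenerate interval forces the path to start at 0.\<close>
  show "Z 0 $ i = 0" for i
    using has_integral_unique[of "\<lambda>r. z r $ i" "Z 0 $ i" "{0}" 0] *[of 0 i] by auto
qed (use assms in \<open>simp_all add: path_with_density_def\<close>)

definition lipschitz_signature :: "real \<Rightarrow> 'd::finite tensor2 \<Rightarrow> bool" where
  "lipschitz_signature l g \<longleftrightarrow> fst g = 1 \<and> (\<exists>z Z. path_with_density l z Z (\<pi>\<^sub>1 g) (\<pi>\<^sub>2 g))"

text \<open>Supplies the lower bound 0 that the real-valued infimum in \<open>cc_norm\<close>
  needs.\<close>

lemma total_variation_nonneg: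
  assumes "finite_variation 0 1 Z"
  shows "0 \<le> total_variation 0 1 Z"
proof -
  obtain v where v: "v \<in> variation_sums 0 1 Z"
    unfolding variation_sums_def using division_of_self[of 0 "1::real"]
    by (metis (mono_tags, lifting) mem_Collect_eq cbox_interval box_ne_empty(1) zero_le_one
        division_of_self elementary_interval)
  then have "0 \<le> v" unfolding variation_sums_def by (auto intro!: sum_nonneg)
  also have "v \<le> total_variation 0 1 Z"
    using v assms unfolding total_variation_def finite_variation_def by (rule cSup_upper)
  finally show ?thesis .
qed

lemma lipschitz_path_variation:
  fixes Z :: "real \<Rightarrow> 'a::real_normed_vector"
  assumes L: "\<And>u v. u \<in> {0..1} \<Longrightarrow> v \<in> {0..1} \<Longrightarrow> u \<le> v \<Longrightarrow> norm (Z v - Z u) \<le> L * (v - u)"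
  shows "finite_variation 0 1 Z" and "total_variation 0 1 Z \<le> L"
proof -
  have bound: "x \<le> L" if "x \<in> variation_sums 0 1 Z" for x
  proof -
    obtain \<D> where D: "\<D> division_of {0..1}"
      and x: "x = (\<Sum>K\<in>\<D>. norm (Z (Sup K) - Z (Inf K)))"
      using \<open>x \<in> _\<close> unfolding variation_sums_def by auto
    have "x \<le> (\<Sum>K\<in>\<D>. L * measure lborel K)"
      unfolding x
    proof (rule sum_mono)
      fix K assume K: "K \<in> \<D>"
      obtain c d where cd: "K = {c..d}" "K \<noteq> {}" "K \<subseteq> {0..1}"
        using D K by (metis box_real(2) division_ofD(2,3,4))
      then have "c \<le> d" "c \<in> {0..1}" "d \<in> {0..1}" by auto
      with L[of c d] cd show "norm (Z (Sup K) - Z (Inf K)) \<le> L * measure lborel K" by simp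
    qed
    also have "\<dots> = L * (\<Sum>K\<in>\<D>. measure lborel K)" by (simp add: sum_distrib_left)
    also have "(\<Sum>K\<in>\<D>. measure lborel K) = 1"
      using additive_content_division[of \<D> 0 "1::real"] D by simp
    finally show ?thesis by simp
  qed
  then show "finite_variation 0 1 Z" unfolding finite_variation_def by (meson bdd_above.I)
  have "variation_sums 0 1 Z \<noteq> {}"
    unfolding variation_sums_def using division_of_self[of 0 "1::real"]
    by (metis (mono_tags, lifting) mem_Collect_eq cbox_interval box_ne_empty(1) zero_le_one
        division_of_self elementary_interval empty_iff)
  then show "total_variation 0 1 Z \<le> L"
    unfolding total_variation_def using bound by (rule cSup_least)
qed

text \<open>The inner integral of \<open>signature2\<close> collapses to \<open>Z u $ i\<close>
  because the path starts at 0, and \<open>has_rs_integral_density\<close> turns the outer one into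
  an integral against the density. The factor \<open>CARD('d)\<close> comes from bounding the norm
  by the sum of the coordinates, each of speed at most \<open>l\<close>.\<close>

lemma lipschitz_signature_path:
  fixes g :: "'d::finite tensor2"
  assumes "lipschitz_signature l g"
  obtains Z where "Z \<in> fv_paths" "signature2 Z = g" "total_variation 0 1 Z \<le> real CARD('d) * l"
proof -
  obtain z Z where g1: "fst g = 1" and "path_with_density l z Z (\<pi>\<^sub>1 g) (\<pi>\<^sub>2 g)"
    using assms unfolding lipschitz_signature_def by blast
  note Z = path_with_densityD(1)[OF this(2)] and l = path_with_densityD(2)[OF this(2)]
    and Z1 = path_with_densityD(3)[OF this(2)] and A = path_with_densityD(4)[OF this(2)]
    and Z0 = path_with_densityD(5)[OF this(2)]
  have l0: "l \<ge> 0" using l[of 0 undefined] by linarith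
  have lip_i: "\<bar>Z v $ i - Z u $ i\<bar> \<le> l * (v - u)" if "u \<in> {0..1}" "v \<in> {0..1}" "u \<le> v" for u v i
  proof -
    have iv: "(\<lambda>r. z r $ i) integrable_on {0..v}" using Z[of v i] that by auto
    have "integral {0..u} (\<lambda>r. z r $ i) + integral {u..v} (\<lambda>r. z r $ i) = integral {0..v} (\<lambda>r. z r $ i)"
      using that iv by (intro Henstock_Kurzweil_Integration.integral_combine) auto
    moreover have "integral {0..u} (\<lambda>r. z r $ i) = Z u $ i" "integral {0..v} (\<lambda>r. z r $ i) = Z v $ i"
      using Z that by (auto intro!: integral_unique)
    ultimately have "integral {u..v} (\<lambda>r. z r $ i) = Z v $ i - Z u $ i" by simp
    moreover have "(\<lambda>r. z r $ i) integrable_on {u..v}"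
      using iv that by (meson atLeastatMost_subset_iff integrable_on_subinterval atLeastAtMost_iff order_refl)
    ultimately have "((\<lambda>r. z r $ i) has_integral (Z v $ i - Z u $ i)) {u..v}"
      by (metis integrable_integral)
    then have "norm (Z v $ i - Z u $ i) \<le> l * measure lborel {u..v}"
      using l0 l by (intro has_integral_bound_real[of _ "{}"]) auto
    then show ?thesis using that by simp
  qed
  have lip: "norm (Z v - Z u) \<le> real CARD('d) * l * (v - u)" if "u \<in> {0..1}" "v \<in> {0..1}" "u \<le> v" for u v
  proof -
    have "norm (Z v - Z u) \<le> (\<Sum>i\<in>UNIV. \<bar>(Z v - Z u) $ i\<bar>)" by (rule norm_le_l1_cart)
    also have "\<dots> \<le> (\<Sum>i\<in>(UNIV::'d set). l * (v - u))"
      using lip_i[OF that] by (intro sum_mono) simp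
    finally show ?thesis by simp
  qed
  have cont_i: "continuous_on {0..1} (\<lambda>u. Z u $ i)" for i
  proof (rule continuous_on_cong[THEN iffD2, OF refl])
    show "continuous_on {0..1} (\<lambda>u. integral {0..u} (\<lambda>r. z r $ i))"
      using Z[of 1 i] by (intro indefinite_integral_continuous_1) auto
    show "Z u $ i = integral {0..u} (\<lambda>r. z r $ i)" if "u \<in> {0..1}" for u
      using Z[OF that, of i] by (simp add: integral_unique)
  qed
  have cont: "continuous_on {0..1} Z"
    using continuous_on_vec_lambda[of "{0..1}" "\<lambda>i u. Z u $ i"] cont_i by simp
  have inner: "rs_integral 0 u (\<lambda>_. 1) (\<lambda>r. Z r $ i) = Z u $ i" if "u \<in> {0..1}" for u i
    using that Z0 by (simp add: rs_integral_one)
  have "has_rs_integral (\<lambda>u. rs_integral 0 u (\<lambda>_. 1) (\<lambda>r. Z r $ i)) (\<lambda>u. Z u $ j) 0 1 (\<pi>\<^sub>2 g $ i $ j)" for i j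
  proof (rule has_rs_integral_density)
    show "continuous_on {0..1} (\<lambda>u. rs_integral 0 u (\<lambda>_. 1) (\<lambda>r. Z r $ i))"
      using cont_i[of i] inner by (subst continuous_on_cong[OF refl]) auto
    show "((\<lambda>u. rs_integral 0 u (\<lambda>_. 1) (\<lambda>r. Z r $ i) * z u $ j) has_integral \<pi>\<^sub>2 g $ i $ j) {0..1}"
      using A[of i j] inner by (subst has_integral_cong) auto
    show "((\<lambda>u. z u $ j) has_integral Z u $ j - Z 0 $ j) {0..u}" if "u \<in> {0..1}" for u
      using Z[OF that] Z0 by simp
    show "\<bar>z u $ j\<bar> \<le> l" for u by (rule l)
  qed simp
  then have "signature2 Z = g"
    using g1 Z1 Z0 unfolding signature2_def
    by (auto simp: prod_eq_iff vec_eq_iff rs_integral_eq rs_integral_one)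
  with that[of Z] lipschitz_path_variation[OF lip] cont show ?thesis
    unfolding fv_paths_def by auto
qed

lemma lipschitz_signature_G2: "lipschitz_signature l g \<Longrightarrow> g \<in> G2"
  unfolding G2_def using lipschitz_signature_path by blast

text \<open>Membership in \<open>G2\<close> makes the set of competing paths nonempty;
  \<open>Inf\<close> of an empty set of reals would carry no information.\<close>

lemma cc_norm_nonneg: "g \<in> G2 \<Longrightarrow> 0 \<le> cc_norm g"
  unfolding cc_norm_def G2_def
  by (rule cInf_greatest) (auto simp: fv_paths_def intro: total_variation_nonneg)

lemma lipschitz_signature_cc_norm:
  fixes g :: "'d::finite tensor2"
  assumes "lipschitz_signature l g"
  shows "cc_norm g \<le> real CARD('d) * l"
proof -
  obtain Z where Z: "Z \<in> fv_paths" "signature2 Z = g" "total_variation 0 1 Z \<le> real CARD('d) * l"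
    using lipschitz_signature_path[OF assms] .
  have "cc_norm g \<le> total_variation 0 1 Z"
    unfolding cc_norm_def
    by (rule cInf_lower) (use Z in \<open>auto simp: fv_paths_def bdd_below_def intro!: exI[of _ 0] total_variation_nonneg\<close>)
  with Z show ?thesis by simp
qed

lemma lipschitz_signature_mono: "lipschitz_signature l g \<Longrightarrow> l \<le> l' \<Longrightarrow> lipschitz_signature l' g"
  unfolding lipschitz_signature_def path_with_density_def by (meson order_trans)

section \<open>Segments, concatenation and commutator loops\<close>

lemma lipschitz_signature_line:
  fixes x :: "real ^ 'd::finite"
  assumes "\<And>i. \<bar>x $ i\<bar> \<le> l"
  shows "lipschitz_signature l (1, x, (1/2) *\<^sub>R tensor_vec x x)"
proof -
  have "((\<lambda>r. x $ i) has_integral (u *\<^sub>R x) $ i) {0..u}" if "u \<in> {0..1}" for i u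
    using has_integral_const_real[of "x $ i" 0 u] that by auto
  moreover have "((\<lambda>u. (u *\<^sub>R x) $ i * x $ j) has_integral ((1/2) *\<^sub>R tensor_vec x x) $ i $ j) {0..1}" for i j
  proof -
    have "((\<lambda>u::real. u) has_integral (1/2)) {0..1}"
      using ident_has_integral[of 0 "1::real"] by simp
    from has_integral_mult_right[OF this, of "x $ i * x $ j"] show ?thesis
      by (simp add: tensor_vec_def mult_ac)
  qed
  ultimately have "path_with_density l (\<lambda>_. x) (\<lambda>u. u *\<^sub>R x) x ((1/2) *\<^sub>R tensor_vec x x)"
    using assms unfolding path_with_density_def by simp
  then show ?thesis unfolding lipschitz_signature_def by auto
qed

lemma has_integral_double_speed:
  fixes f :: "real \<Rightarrow> real"
  assumes "(f has_integral I) {2 * a + c..2 * b + c}" and "a \<le> b"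
  shows "((\<lambda>x. 2 * f (2 * x + c)) has_integral I) {a..b}"
proof -
  have "((\<lambda>x. f (2 *\<^sub>R x + c)) has_integral (1/2) * I) ((\<lambda>x. (1/2) *\<^sub>R x + - ((1/2) *\<^sub>R c)) ` {2 * a + c..2 * b + c})"
    using has_integral_affinity[of f I "2 * a + c" "2 * b + c" 2 c] assms by simp
  moreover have "(\<lambda>x. (1/2) *\<^sub>R x + - ((1/2) *\<^sub>R c)) ` {2 * a + c..2 * b + c} = {a..b}"
    using assms(2) image_affinity_atLeastAtMost[of "1/2" "- c/2" "2 * a + c" "2 * b + c"]
    by (simp add: add_divide_distrib)
  ultimately have "((\<lambda>x. f (2 * x + c)) has_integral (1/2) * I) {a..b}" by simp
  from has_integral_mult_right[OF this, of 2] show ?thesis by simp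
qed

text \<open>Concatenation of the two paths, each run at double speed: Chen's identity for
  signatures. The doubled speed is the factor 2 in the bound.\<close>

lemma lipschitz_signature_mult:
  fixes g h :: "'d::finite tensor2"
  assumes "lipschitz_signature l g" and "lipschitz_signature l h"
  shows "lipschitz_signature (2 * l) (g \<otimes>\<^sub>2 h)"
proof -
  obtain z Z where g1: "fst g = 1" and zZ: "path_with_density l z Z (\<pi>\<^sub>1 g) (\<pi>\<^sub>2 g)"
    using assms(1) unfolding lipschitz_signature_def by blast
  obtain y Y where h1: "fst h = 1" and yY: "path_with_density l y Y (\<pi>\<^sub>1 h) (\<pi>\<^sub>2 h)"
    using assms(2) unfolding lipschitz_signature_def by blast
  note Z = path_with_densityD(1)[OF zZ] and l = path_with_densityD(2)[OF zZ]
    and Z1 = path_with_densityD(3)[OF zZ] and A = path_with_densityD(4)[OF zZ]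
  note Y = path_with_densityD(1)[OF yY] and l' = path_with_densityD(2)[OF yY]
    and Y1 = path_with_densityD(3)[OF yY] and B = path_with_densityD(4)[OF yY]
    and Y0 = path_with_densityD(5)[OF yY]
  \<comment> \<open>The value at the junction 1/2 is assigned to the second half, so only integrals
    over the first half have to ignore that point.\<close>
  define w where "w = (\<lambda>r. if r < 1/2 then 2 *\<^sub>R z (2 * r) else 2 *\<^sub>R y (2 * r - 1))"
  define W where "W = (\<lambda>u. if u \<le> 1/2 then Z (2 * u) else Z 1 + Y (2 * u - 1))"
  have left: "((\<lambda>r. w r $ i) has_integral Z (2 * u) $ i) {0..u}" if "u \<in> {0..1/2}" for u i
  proof (rule has_integral_spike_finite[of "{1/2}"])
    show "((\<lambda>r. 2 * z (2 * r + 0) $ i) has_integral Z (2 * u) $ i) {0..u}"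
      using that Z[of "2 * u" i] by (intro has_integral_double_speed) auto
  qed (use that in \<open>auto simp: w_def\<close>)
  have right: "((\<lambda>r. w r $ i) has_integral Y (2 * u - 1) $ i) {1/2..u}" if "u \<in> {1/2..1}" for u i
  proof (rule has_integral_eq)
    show "((\<lambda>r. 2 * y (2 * r + - 1) $ i) has_integral Y (2 * u - 1) $ i) {1/2..u}"
      using that Y[of "2 * u - 1" i] by (intro has_integral_double_speed) auto
  qed (use that in \<open>auto simp: w_def\<close>)
  have 1: "((\<lambda>r. w r $ i) has_integral W u $ i) {0..u}" if u: "u \<in> {0..1}" for u i
  proof (cases "u \<le> 1/2")
    case True then show ?thesis using left[of u i] u by (simp add: W_def)
  next
    case False
    have "((\<lambda>r. w r $ i) has_integral (Z (2 * (1/2)) $ i + Y (2 * u - 1) $ i)) {0..u}"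
      using False u left[of "1/2" i] right[of u i] by (intro has_integral_combine[of 0 "1/2" u]) auto
    then show ?thesis using False by (simp add: W_def)
  qed
  have 2: "\<bar>w r $ i\<bar> \<le> 2 * l" for r i
    using l[of "2 * r" i] l'[of "2 * r - 1" i] by (auto simp: w_def abs_mult)
  have 3: "W 1 = \<pi>\<^sub>1 (g \<otimes>\<^sub>2 h)"
    using g1 h1 by (cases g; cases h) (simp add: W_def Z1 Y1)
  have 4: "((\<lambda>u. W u $ i * w u $ j) has_integral \<pi>\<^sub>2 (g \<otimes>\<^sub>2 h) $ i $ j) {0..1}" for i j
  proof -
    have "((\<lambda>u. W u $ i * w u $ j) has_integral \<pi>\<^sub>2 g $ i $ j) {0..1/2}"
    proof (rule has_integral_spike_finite[of "{1/2}"])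
      show "((\<lambda>u. 2 * (Z (2 * u + 0) $ i * z (2 * u + 0) $ j)) has_integral \<pi>\<^sub>2 g $ i $ j) {0..1/2}"
        using A[of i j] by (intro has_integral_double_speed[of "\<lambda>u. Z u $ i * z u $ j"]) auto
    qed (auto simp: W_def w_def)
    moreover have "((\<lambda>u. W u $ i * w u $ j) has_integral (Z 1 $ i * Y 1 $ j + \<pi>\<^sub>2 h $ i $ j)) {1/2..1}"
    proof (rule has_integral_eq)
      \<comment> \<open>On the second half the path is shifted by \<open>Z 1\<close>; integrating
        this constant against \<open>y\<close> gives the cross term of the tensor product.\<close>
      have "((\<lambda>u. Z 1 $ i * y u $ j + Y u $ i * y u $ j) has_integral (Z 1 $ i * Y 1 $ j + \<pi>\<^sub>2 h $ i $ j)) {0..1}"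
        using B[of i j] Y[of 1 j] by (intro has_integral_add has_integral_mult_right) auto
      then show "((\<lambda>u. 2 * (Z 1 $ i * y (2 * u + - 1) $ j + Y (2 * u + - 1) $ i * y (2 * u + - 1) $ j)) has_integral
          (Z 1 $ i * Y 1 $ j + \<pi>\<^sub>2 h $ i $ j)) {1/2..1}"
        by (intro has_integral_double_speed[of "\<lambda>u. Z 1 $ i * y u $ j + Y u $ i * y u $ j"]) auto
      show "2 * (Z 1 $ i * y (2 * u + - 1) $ j + Y (2 * u + - 1) $ i * y (2 * u + - 1) $ j) = W u $ i * w u $ j"
        if "u \<in> {1/2..1}" for u
        using that Y0 by (cases "u = 1/2") (auto simp: W_def w_def algebra_simps)
    qed
    ultimately have "((\<lambda>u. W u $ i * w u $ j) has_integral
        (\<pi>\<^sub>2 g $ i $ j + (Z 1 $ i * Y 1 $ j + \<pi>\<^sub>2 h $ i $ j))) {0..1}"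
      by (intro has_integral_combine[of 0 "1/2" 1]) auto
    moreover have "\<pi>\<^sub>2 g $ i $ j + (Z 1 $ i * Y 1 $ j + \<pi>\<^sub>2 h $ i $ j) = \<pi>\<^sub>2 (g \<otimes>\<^sub>2 h) $ i $ j"
      using g1 h1 by (cases g; cases h) (simp add: Z1 Y1 tensor_vec_def)
    ultimately show ?thesis by simp
  qed
  have "fst (g \<otimes>\<^sub>2 h) = 1" using g1 h1 by (cases g; cases h) simp
  then show ?thesis
    unfolding lipschitz_signature_def path_with_density_def using 1 2 3 4
    by (intro conjI exI[of _ w] exI[of _ W] allI ballI) simp_all
qed

text \<open>In step 2 the group commutator of two exponentials is the Lie bracket alone: running
  along x, y, -x, -y closes the first level and leaves the area. Two nested concatenations double
  the speed twice.\<close>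

lemma lipschitz_signature_commutator:
  fixes x y :: "real ^ 'd::finite"
  assumes x: "\<And>i. \<bar>x $ i\<bar> \<le> l" and y: "\<And>i. \<bar>y $ i\<bar> \<le> l"
  shows "lipschitz_signature (4 * l) (1, 0, tensor_vec x y - tensor_vec y x)"
proof -
  let ?e = "\<lambda>x. (1, x, (1/2) *\<^sub>R tensor_vec x x) :: 'd tensor2"
  have "lipschitz_signature (2 * (2 * l)) ((?e x \<otimes>\<^sub>2 ?e y) \<otimes>\<^sub>2 (?e (- x) \<otimes>\<^sub>2 ?e (- y)))"
    using x y by (intro lipschitz_signature_mult lipschitz_signature_line) auto
  also have "(?e x \<otimes>\<^sub>2 ?e y) \<otimes>\<^sub>2 (?e (- x) \<otimes>\<^sub>2 ?e (- y)) = (1, 0, tensor_vec x y - tensor_vec y x)"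
    by (simp add: tensor_vec_def vec_eq_iff algebra_simps)
  finally show ?thesis by simp
qed

text \<open>Each index pair contributes a commutator loop, and with vanishing first levels the
  product adds the second levels. The bound \<open>l\<^sup>2\<close> on the entries goes with the
  bound \<open>l\<close> on speeds since area scales quadratically. Every further factor doubles the
  speed, hence the power of 2.\<close>

lemma lipschitz_signature_area_sum:
  fixes K :: "real ^ 'd::finite ^ 'd" and F :: "('d \<times> 'd) set"
  assumes "finite F" and "0 \<le> l" and "\<And>i j. \<bar>K $ i $ j\<bar> \<le> l\<^sup>2"
  shows "lipschitz_signature (2 ^ card F * (4 * l))
    (1, 0, \<Sum>(i, j)\<in>F. (K $ i $ j / 2) *\<^sub>R (tensor_vec (axis i 1) (axis j 1) - tensor_vec (axis j 1) (axis i 1)))"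
  using assms(1)
proof (induction F)
  case empty
  have "lipschitz_signature (4 * l) (1, 0, tensor_vec 0 0 - tensor_vec 0 (0 :: real ^ 'd))"
    using assms(2) by (intro lipschitz_signature_commutator) auto
  then show ?case by simp
next
  case (insert q F)
  obtain i j where q: "q = (i, j)" by force
  \<comment> \<open>A loop with both sides \<open>r\<close> has the required area
    \<open>\<bar>K $ i $ j\<bar> / 2\<close>; the sign of the entry is carried by one side.\<close>
  define r where "r = sqrt (\<bar>K $ i $ j\<bar> / 2)"
  have r: "0 \<le> r" "r \<le> l" "r * r = \<bar>K $ i $ j\<bar> / 2"
  proof -
    have "\<bar>K $ i $ j\<bar> / 2 \<le> l\<^sup>2" using assms(3)[of i j] by simp
    then show "r \<le> l" unfolding r_def using assms(2) real_le_lsqrt by blast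
  qed (simp_all add: r_def)
  let ?c = "(K $ i $ j / 2) *\<^sub>R (tensor_vec (axis i 1) (axis j 1) - tensor_vec (axis j 1) (axis i 1))"
  have "lipschitz_signature (4 * l) (1, 0, tensor_vec (axis i r) (axis j (sgn (K $ i $ j) * r))
      - tensor_vec (axis j (sgn (K $ i $ j) * r)) (axis i r))"
    using r by (intro lipschitz_signature_commutator) (auto simp: axis_def abs_mult abs_sgn_eq)
  also have "tensor_vec (axis i r) (axis j (sgn (K $ i $ j) * r)) - tensor_vec (axis j (sgn (K $ i $ j) * r)) (axis i r) = ?c"
  proof -
    have "r * (sgn (K $ i $ j) * r) = K $ i $ j / 2"
      using r(3) by (metis abs_mult_sgn mult.left_commute mult.commute times_divide_eq_right)
    then show ?thesis
      by (auto simp: tensor_vec_def vec_eq_iff axis_def mult_ac)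
  qed
  finally have c: "lipschitz_signature (4 * l) (1, 0, ?c)" .
  have "lipschitz_signature (2 * (2 ^ card F * (4 * l))) ((1, 0, ?c) \<otimes>\<^sub>2
     (1, 0, \<Sum>(i, j)\<in>F. (K $ i $ j / 2) *\<^sub>R (tensor_vec (axis i 1) (axis j 1) - tensor_vec (axis j 1) (axis i 1))))"
  proof (rule lipschitz_signature_mult[OF _ insert.IH])
    have "1 * (4 * l) \<le> 2 ^ card F * (4 * l)" using assms(2) by (intro mult_right_mono) auto
    with c show "lipschitz_signature (2 ^ card F * (4 * l)) (1, 0, ?c)"
      using lipschitz_signature_mono by fastforce
  qed
  moreover have "tensor_vec 0 0 = (0 :: real ^ 'd ^ 'd)" by (simp add: tensor_vec_def vec_eq_iff)
  ultimately show ?case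
    using insert.hyps by (simp add: q mult.assoc add.commute)
qed

text \<open>Summing over all ordered pairs visits each coordinate plane twice, which the halved
  entries compensate by antisymmetry. The exponent counts \<open>CARD('d)\<^sup>2\<close> doublings
  for the loops, two inside a commutator and one for attaching the segment.\<close>

lemma lipschitz_signature_exp:
  fixes x :: "real ^ 'd::finite" and K :: "real ^ 'd ^ 'd"
  assumes "\<And>i j. K $ j $ i = - K $ i $ j" and "\<And>i j. \<bar>K $ i $ j\<bar> \<le> l\<^sup>2" and "\<And>i. \<bar>x $ i\<bar> \<le> l"
  shows "lipschitz_signature (2 ^ (CARD('d)\<^sup>2 + 3) * l) (1, x, (1/2) *\<^sub>R tensor_vec x x + K)"
proof -
  have l0: "0 \<le> l" using assms(3)[of undefined] by linarith
  let ?F = "UNIV :: ('d \<times> 'd) set"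
  let ?S = "\<Sum>(i, j)\<in>?F. (K $ i $ j / 2) *\<^sub>R (tensor_vec (axis i 1) (axis j 1) - tensor_vec (axis j 1) (axis i 1))"
  have "?S $ a $ b = K $ a $ b" for a b
  proof -
    have "?S $ a $ b = (\<Sum>i\<in>UNIV. \<Sum>j\<in>UNIV. (K $ i $ j / 2) * ((axis i 1 $ a) * (axis j 1 $ b) - (axis j 1 $ a) * (axis i 1 $ b)))"
      by (simp add: UNIV_Times_UNIV[symmetric] sum.cartesian_product[symmetric] tensor_vec_def del: UNIV_Times_UNIV)
    also have "\<dots> = (\<Sum>i\<in>UNIV. \<Sum>j\<in>UNIV. if i = a then if j = b then K $ i $ j / 2 else 0 else 0)
        - (\<Sum>i\<in>UNIV. \<Sum>j\<in>UNIV. if i = b then if j = a then K $ i $ j / 2 else 0 else 0)"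
      unfolding sum_subtractf[symmetric] by (intro sum.cong refl) (auto simp: axis_def)
    also have "(\<Sum>i\<in>UNIV. \<Sum>j\<in>UNIV. if i = a then if j = b then K $ i $ j / 2 else 0 else 0)
        = (\<Sum>i\<in>UNIV. if i = a then K $ i $ b / 2 else 0)"
      by (intro sum.cong refl) (simp add: sum.delta)
    also have "(\<Sum>i\<in>UNIV. \<Sum>j\<in>UNIV. if i = b then if j = a then K $ i $ j / 2 else 0 else 0)
        = (\<Sum>i\<in>UNIV. if i = b then K $ i $ a / 2 else 0)"
      by (intro sum.cong refl) (simp add: sum.delta)
    also have "(\<Sum>i\<in>UNIV. if i = a then K $ i $ b / 2 else 0) - (\<Sum>i\<in>UNIV. if i = b then K $ i $ a / 2 else 0)
        = K $ a $ b / 2 - K $ b $ a / 2"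
      by (simp add: sum.delta)
    finally show ?thesis using assms(1)[of a b] by simp
  qed
  then have S: "?S = K" unfolding vec_eq_iff by blast
  have K: "lipschitz_signature (2 ^ card ?F * (4 * l)) (1, 0, K)"
    using lipschitz_signature_area_sum[of ?F l K] assms(2) l0 unfolding S by simp
  have card: "card ?F = CARD('d)\<^sup>2" by (simp add: power2_eq_square)
  have "lipschitz_signature (2 * (2 ^ card ?F * (4 * l))) ((1, 0, K) \<otimes>\<^sub>2 (1, x, (1/2) *\<^sub>R tensor_vec x x))"
  proof (rule lipschitz_signature_mult[OF K], rule lipschitz_signature_line)
    fix i
    have "1 * (1 * l) \<le> 2 ^ card ?F * (4 * l)" using l0 by (intro mult_mono) auto
    with assms(3)[of i] show "\<bar>x $ i\<bar> \<le> 2 ^ card ?F * (4 * l)" by simp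
  qed
  moreover have "(1, 0, K) \<otimes>\<^sub>2 (1, x, (1/2) *\<^sub>R tensor_vec x x) = (1, x, (1/2) *\<^sub>R tensor_vec x x + K)"
    by (simp add: tensor_vec_def vec_eq_iff)
  ultimately show ?thesis by (simp add: card power_add mult_ac power2_eq_square)
qed

section \<open>Dyadic chaining\<close>

lemma suminf_swap_ennreal:
  fixes f :: "nat \<Rightarrow> nat \<Rightarrow> ennreal"
  shows "(\<Sum>i. \<Sum>j. f i j) = (\<Sum>j. \<Sum>i. f i j)"
proof -
  have "(\<Sum>i. \<Sum>j. f i j) = (\<Sum>i. \<integral>\<^sup>+ j. f i j \<partial>count_space UNIV)"
    by (simp add: nn_integral_count_space_nat)
  also have "\<dots> = (\<integral>\<^sup>+ j. (\<Sum>i. f i j) \<partial>count_space UNIV)"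
    by (intro nn_integral_suminf[symmetric]) auto
  finally show ?thesis by (simp add: nn_integral_count_space_nat)
qed

lemma suminf_shift_le_ennreal:
  fixes f :: "nat \<Rightarrow> ennreal"
  shows "(\<Sum>n. f (n + k)) \<le> (\<Sum>n. f n)"
  using suminf_offset[OF summableI, of f k] by simp

text \<open>After exchanging the sums, a shift of \<open>v\<close> only loses terms. This discrete
  Young inequality absorbs the finer levels \<open>n + j\<close> met by a chain started at level
  \<open>n\<close>.\<close>

lemma suminf_convolution_le:
  fixes v :: "nat \<Rightarrow> ennreal"
  assumes "0 \<le> r" "r < 1"
  shows "(\<Sum>n. \<Sum>j. ennreal (r ^ j) * v (n + j)) \<le> ennreal (1 / (1 - r)) * (\<Sum>n. v n)"
proof -
  have "(\<Sum>n. \<Sum>j. ennreal (r ^ j) * v (n + j)) = (\<Sum>j. ennreal (r ^ j) * (\<Sum>n. v (n + j)))"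
    by (subst suminf_swap_ennreal) simp
  also have "\<dots> \<le> (\<Sum>j. ennreal (r ^ j) * (\<Sum>n. v n))"
    by (intro suminf_le mult_left_mono suminf_shift_le_ennreal) auto
  also have "\<dots> = (\<Sum>j. ennreal (r ^ j)) * (\<Sum>n. v n)" by simp
  also have "(\<Sum>j. ennreal (r ^ j)) = ennreal (1 / (1 - r))"
    using assms geometric_sums[of r] by (intro suminf_ennreal_eq) auto
  finally show ?thesis .
qed

text \<open>Reduces an inequality of extended reals to finite, strictly positive upper bounds of
  \<open>S\<close>, for which division and powers are harmless; the case \<open>S = 0\<close>
  follows by letting \<open>s\<close> tend to 0.\<close>

lemma ennreal_le_mult_of_upper:
  fixes S :: ennreal
  assumes c: "0 < c" and le: "\<And>s. 0 < s \<Longrightarrow> S \<le> ennreal s \<Longrightarrow> x \<le> ennreal (c * s)"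
  shows "x \<le> ennreal c * S"
proof (cases "S = \<infinity>")
  case True then show ?thesis using c by (simp add: ennreal_mult_top)
next
  case False
  then obtain s0 where s0: "S = ennreal s0" "0 \<le> s0" by (cases S) auto
  have *: "x \<le> ennreal (c * s0) + ennreal e" if "0 < e" for e
  proof -
    have "x \<le> ennreal (c * (s0 + e / c))"
      using s0 that c by (intro le) (auto simp: add_nonneg_pos ennreal_leI)
    also have "c * (s0 + e / c) = c * s0 + e" using c by (simp add: field_simps)
    finally show ?thesis using s0 c that by simp
  qed
  have "x \<le> ennreal (c * s0)" by (rule ennreal_le_epsilon[OF *])
  then show ?thesis using s0 c by (simp add: ennreal_mult)
qed

text \<open>Stands in for Hoelder's inequality. In the applications \<open>S\<close> is a series
  weighted by powers of \<open>1 / \<rho>\<close>, so a bound \<open>s\<close> for it bounds the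
  j-th quantity by \<open>(\<rho> ^ j * s) powr (1 / P)\<close>; these are summable with ratio
  \<open>\<rho> powr (1 / P)\<close>. The additive \<open>e\<close> and the finite \<open>N\<close>
  allow for chains that only approach their end point.\<close>

lemma powr_bound_of_geometric:
  assumes \<rho>: "0 < \<rho>" "\<rho> < 1" and P: "0 < P" and c: "0 < c" and y: "0 \<le> y"
    and bound: "\<And>s e. 0 < s \<Longrightarrow> S \<le> ennreal s \<Longrightarrow> 0 < e \<Longrightarrow>
      \<exists>N. y \<le> (\<Sum>j<N. c * (\<rho> ^ j * s) powr (1 / P)) + e"
  shows "ennreal (y powr P) \<le> ennreal ((c / (1 - \<rho> powr (1 / P))) powr P) * S"
proof (rule ennreal_le_mult_of_upper)
  define r where "r = \<rho> powr (1 / P)"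
  have r: "0 < r" "r < 1"
    using \<rho> P powr_less_mono2[of "1 / P" \<rho> 1] by (auto simp: r_def)
  then show "0 < (c / (1 - \<rho> powr (1 / P))) powr P" using c by (simp add: r_def)
  fix s :: real assume s: "0 < s" "S \<le> ennreal s"
  have pw: "(\<rho> ^ j * s) powr (1 / P) = r ^ j * s powr (1 / P)" for j
    using \<rho> s by (simp add: r_def powr_mult powr_power powr_realpow[symmetric] powr_powr mult.commute)
  have "y \<le> c * s powr (1 / P) / (1 - r) + e" if e: "0 < e" for e
  proof -
    obtain N where "y \<le> (\<Sum>j<N. c * (\<rho> ^ j * s) powr (1 / P)) + e"
      using bound[OF s e] by blast
    also have "(\<Sum>j<N. c * (\<rho> ^ j * s) powr (1 / P)) = c * s powr (1 / P) * (\<Sum>j<N. r ^ j)"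
      unfolding pw by (simp add: sum_distrib_left sum_distrib_right mult_ac)
    also have "(\<Sum>j<N. r ^ j) \<le> 1 / (1 - r)"
      using r by (simp add: sum_gp_strict divide_right_mono)
    then have "c * s powr (1 / P) * (\<Sum>j<N. r ^ j) \<le> c * s powr (1 / P) * (1 / (1 - r))"
      using c by (intro mult_left_mono) auto
    finally show ?thesis by simp
  qed
  then have "y \<le> c / (1 - r) * s powr (1 / P)"
    using field_le_epsilon[of y] by (metis times_divide_eq_left)
  then have "y powr P \<le> (c / (1 - r) * s powr (1 / P)) powr P"
    using y P by (intro powr_mono2) auto
  also have "\<dots> = (c / (1 - r)) powr P * s"
  proof -
    have "1 / P * P = 1" using P by simp
    then show ?thesis using s r c by (simp only: powr_mult powr_powr) simp
  qed
  finally show "ennreal (y powr P) \<le> ennreal ((c / (1 - \<rho> powr (1 / P))) powr P * s)"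
    unfolding r_def by (rule ennreal_leI)
qed

lemma powr_add_le:
  fixes a b :: real
  assumes "0 \<le> a" "0 \<le> b" "0 \<le> P"
  shows "(a + b) powr P \<le> 2 powr P * (a powr P + b powr P)"
proof -
  have "(a + b) powr P \<le> (2 * max a b) powr P" using assms by (intro powr_mono2) auto
  also have "\<dots> = 2 powr P * max (a powr P) (b powr P)"
    using assms by (auto simp: powr_mult max_def powr_mono2 intro: antisym)
  also have "\<dots> \<le> 2 powr P * (a powr P + b powr P)"
    by (intro mult_left_mono) auto
  finally show ?thesis .
qed

text \<open>A growing geometric sum is comparable to its last active term, which is at most
  \<open>X powr \<beta>\<close>.\<close>

lemma sum_dyadic_bounded:
  assumes \<beta>: "0 < \<beta>" and X: "0 < X"
  shows "(\<Sum>m. if 2 ^ m \<le> X then ennreal ((2 powr \<beta>) ^ m) else 0)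
    \<le> ennreal (X powr \<beta> / (1 - 2 powr (- \<beta>)))"
proof (rule suminf_le_const[OF summableI])
  fix N
  define q where "q = 2 powr \<beta>"
  have q: "1 < q" using \<beta> by (simp add: q_def)
  have q': "2 powr (- \<beta>) = 1 / q" by (simp add: q_def powr_minus_divide)
  have nn: "0 \<le> X powr \<beta> / (1 - 1 / q)" using q by simp
  show "(\<Sum>m<N. if 2 ^ m \<le> X then ennreal ((2 powr \<beta>) ^ m) else 0)
    \<le> ennreal (X powr \<beta> / (1 - 2 powr (- \<beta>)))"
    unfolding q' q_def[symmetric]
  proof (induction N)
    case (Suc N)
    show ?case
    proof (cases "2 ^ N \<le> X")
      case False with Suc show ?thesis by simp
    next
      case True
      have le: "2 ^ m \<le> X" if "m \<le> N" for m
        using power_increasing[OF that, of "2::real"] True by linarith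
      have "(\<Sum>m<Suc N. if 2 ^ m \<le> X then ennreal (q ^ m) else 0) = (\<Sum>m<Suc N. ennreal (q ^ m))"
        by (intro sum.cong refl) (simp add: le)
      also have "\<dots> = ennreal (\<Sum>m<Suc N. q ^ m)" using q by (intro sum_ennreal) auto
      also have "(\<Sum>m<Suc N. q ^ m) \<le> q ^ N / (1 - 1 / q)"
      proof -
        have "(\<Sum>m<Suc N. q ^ m) = (q ^ Suc N - 1) / (q - 1)"
          using q by (subst geometric_sum) auto
        also have "\<dots> \<le> q ^ Suc N / (q - 1)" using q by (intro divide_right_mono) auto
        also have "\<dots> = q ^ N / (1 - 1 / q)" using q by (simp add: field_simps)
        finally show ?thesis .
      qed
      also have "\<dots> \<le> X powr \<beta> / (1 - 1 / q)"
      proof (rule divide_right_mono)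
        have "q ^ N = (2 ^ N) powr \<beta>"
          by (simp add: q_def powr_power powr_realpow[symmetric] powr_powr mult.commute)
        also have "\<dots> \<le> X powr \<beta>" using True \<beta> by (intro powr_mono2) auto
        finally show "q ^ N \<le> X powr \<beta>" .
      qed (use q in simp)
      finally show ?thesis by (simp add: ennreal_leI)
    qed
  qed (use nn in simp)
qed

section \<open>Dyadic nodes and cells\<close>

definition node :: "real \<Rightarrow> nat \<Rightarrow> nat \<Rightarrow> real" where
  "node T n k = real k * T / 2 ^ n"

text \<open>The minimum assigns the right endpoint \<open>T\<close> to the last cell.\<close>

definition cell :: "real \<Rightarrow> nat \<Rightarrow> real \<Rightarrow> nat" where
  "cell T n s = min (nat \<lfloor>2 ^ n * s / T\<rfloor>) (2 ^ n - 1)"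

lemma node_0 [simp]: "node T n 0 = 0" and node_last [simp]: "node T n (2 ^ n) = T"
  by (simp_all add: node_def)

lemma node_double [simp]: "node T (Suc n) (2 * k) = node T n k"
  by (simp add: node_def field_simps)

lemma node_mid: "node T (Suc n) (Suc (2 * k)) = (node T n k + node T n (Suc k)) / 2"
  by (simp add: node_def field_simps)

lemma node_Suc: "node T n (Suc k) = node T n k + T / 2 ^ n"
  by (simp add: node_def add_divide_distrib distrib_right)

lemma node_mono: "0 < T \<Longrightarrow> j \<le> k \<Longrightarrow> node T n j \<le> node T n k"
  by (simp add: node_def divide_right_mono)

lemma node_in: "0 < T \<Longrightarrow> k \<le> 2 ^ n \<Longrightarrow> node T n k \<in> {0..T}"
  using node_mono[of T k "2 ^ n" n] by (auto simp: node_def)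

lemma cell_less: "cell T n s < 2 ^ n"
  unfolding cell_def by (metis diff_less less_numeral_extra(1) min.strict_coboundedI2 pos2 zero_less_power)

lemma cell_bounds:
  assumes "0 < T" "s \<in> {0..T}"
  shows "node T n (cell T n s) \<le> s" "s \<le> node T n (Suc (cell T n s))"
proof -
  define x where "x = 2 ^ n * s / T"
  have x: "0 \<le> x" "x \<le> 2 ^ n" "s = x * T / 2 ^ n"
    using assms by (auto simp: x_def field_simps)
  have "real (cell T n s) \<le> x"
    using x(1) unfolding cell_def x_def[symmetric] by linarith
  then show "node T n (cell T n s) \<le> s"
    using assms unfolding node_def x(3) by (intro divide_right_mono mult_right_mono) auto
  have "x \<le> real (Suc (nat \<lfloor>x\<rfloor>))" using x(1) by linarith
  moreover have "real (2 ^ n - 1) + 1 = 2 ^ n" by (simp add: of_nat_diff)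
  ultimately have "x \<le> real (Suc (cell T n s))"
    using x(2) unfolding cell_def x_def[symmetric] by linarith
  then show "s \<le> node T n (Suc (cell T n s))"
    using assms unfolding node_def x(3) by (intro divide_right_mono mult_right_mono) auto
qed

lemma cell_Suc:
  assumes "0 < T" "s \<in> {0..T}"
  shows "cell T (Suc n) s = 2 * cell T n s \<or> cell T (Suc n) s = Suc (2 * cell T n s)"
proof -
  define x where "x = 2 ^ n * s / T"
  have x: "0 \<le> x" using assms by (auto simp: x_def)
  have eq: "2 ^ Suc n * s / T = 2 * x" by (simp add: x_def)
  have "nat \<lfloor>2 * x\<rfloor> = 2 * nat \<lfloor>x\<rfloor> \<or> nat \<lfloor>2 * x\<rfloor> = Suc (2 * nat \<lfloor>x\<rfloor>)"
    using x by linarith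
  moreover have "2 ^ Suc n - 1 = Suc (2 * (2 ^ n - 1 :: nat))"
    by (induction n) auto
  ultimately show ?thesis
    unfolding cell_def eq x_def[symmetric] by (auto simp: min_def)
qed

lemma cell_adjacent:
  assumes "0 < T" "s \<in> {0..T}" "t \<in> {0..T}" "s \<le> t" "t - s \<le> T / 2 ^ n"
  shows "cell T n t = cell T n s \<or> cell T n t = Suc (cell T n s)"
proof -
  define x y where "x = 2 ^ n * s / T" and "y = 2 ^ n * t / T"
  have "y - x = 2 ^ n * (t - s) / T" by (simp add: x_def y_def diff_divide_distrib right_diff_distrib)
  also have "\<dots> \<le> 1" using assms(1,5) by (simp add: field_simps)
  finally have "0 \<le> x" "x \<le> y" "y \<le> x + 1"
    using assms by (auto simp: x_def y_def divide_right_mono)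
  then have "nat \<lfloor>y\<rfloor> = nat \<lfloor>x\<rfloor> \<or> nat \<lfloor>y\<rfloor> = Suc (nat \<lfloor>x\<rfloor>)" by linarith
  then show ?thesis unfolding cell_def x_def[symmetric] y_def[symmetric] by (auto simp: min_def)
qed

section \<open>Energies, and chaining for a pseudometric\<close>

abbreviation incr :: "(real \<Rightarrow> real) \<Rightarrow> real \<Rightarrow> real \<Rightarrow> real" where
  "incr f \<equiv> \<lambda>s t. \<bar>f s - f t\<bar>"

text \<open>The P-th power of a discrete Besov seminorm. The weight is 2 to the power n(\<alpha>P -
  1): up to constants, the area of a product of two cells of length T / 2^n divided by that length
  to the power \<alpha>P + 1.\<close>

definition dyadic_energy :: "real \<Rightarrow> real \<Rightarrow> real \<Rightarrow> (real \<Rightarrow> real \<Rightarrow> real) \<Rightarrow> ennreal" where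
  "dyadic_energy \<alpha> P T d = (\<Sum>n. ennreal ((2 powr (\<alpha> * P) / 2) ^ n) *
     (\<Sum>k<2 ^ n. ennreal (d (node T n k) (node T n (Suc k)) powr P)))"

definition gagliardo_energy :: "real \<Rightarrow> real \<Rightarrow> real \<Rightarrow> (real \<Rightarrow> real \<Rightarrow> real) \<Rightarrow> ennreal" where
  "gagliardo_energy \<alpha> P T d = (\<integral>\<^sup>+ t\<in>{0..T}. (\<integral>\<^sup>+ s\<in>{0..T}.
     ennreal (d s t powr P / \<bar>t - s\<bar> powr (\<alpha> * P + 1)) \<partial>lborel) \<partial>lborel)"

text \<open>Continuity is asked for at the diagonal, where a chain of dyadic points approaches its
  end point; the integrals are estimated through measurable majorants.\<close>

locale path_pseudometric =
  fixes T :: real and d :: "real \<Rightarrow> real \<Rightarrow> real"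
  assumes T_pos: "0 < T"
    and d_refl: "s \<in> {0..T} \<Longrightarrow> d s s = 0"
    and d_sym: "s \<in> {0..T} \<Longrightarrow> t \<in> {0..T} \<Longrightarrow> d s t = d t s"
    and d_triangle: "s \<in> {0..T} \<Longrightarrow> t \<in> {0..T} \<Longrightarrow> u \<in> {0..T} \<Longrightarrow> d s u \<le> d s t + d t u"
    and d_cont: "s \<in> {0..T} \<Longrightarrow> ((\<lambda>t. d s t) \<longlongrightarrow> 0) (at s within {0..T})"
begin

lemma d_nonneg: "s \<in> {0..T} \<Longrightarrow> t \<in> {0..T} \<Longrightarrow> 0 \<le> d s t"
  using d_triangle[of s t s] d_refl[of s] d_sym[of s t] by simp

definition step :: "nat \<Rightarrow> nat \<Rightarrow> real" where
  "step n k = d (node T n k) (node T n (Suc k))"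

text \<open>A cell is represented by its left node. Passing to the subcell one level down either
  keeps that node or moves it to the midpoint, at distance \<open>step (Suc n) (2 * k)\<close>; the
  term \<open>step n k\<close> pays for crossing to a neighbouring cell of the same level.\<close>

definition local_step :: "nat \<Rightarrow> nat \<Rightarrow> real" where
  "local_step n k = step n k + step (Suc n) (2 * k)"

lemma step_nonneg: "k < 2 ^ n \<Longrightarrow> 0 \<le> step n k"
  unfolding step_def using T_pos by (intro d_nonneg node_in) auto

lemma local_step_nonneg: "k < 2 ^ n \<Longrightarrow> 0 \<le> local_step n k"
  unfolding local_step_def by (intro add_nonneg_nonneg step_nonneg) auto

lemma node_cell_in: "node T n (cell T n s) \<in> {0..T}"
  using T_pos cell_less[of T n s] by (intro node_in) auto

lemma refine_step:
  assumes s: "s \<in> {0..T}"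
  shows "d (node T n (cell T n s)) (node T (Suc n) (cell T (Suc n) s)) \<le> local_step n (cell T n s)"
proof -
  have "0 \<le> step n (cell T n s)" "0 \<le> step (Suc n) (2 * cell T n s)"
    using cell_less[of T n s] by (auto intro!: step_nonneg)
  then show ?thesis
    using cell_Suc[OF T_pos s, of n] d_refl[OF node_cell_in[of n s]]
    unfolding local_step_def step_def by auto
qed

lemma chain_bound:
  assumes s: "s \<in> {0..T}"
  shows "d (node T n (cell T n s)) (node T (n + N) (cell T (n + N) s))
    \<le> (\<Sum>j<N. local_step (n + j) (cell T (n + j) s))"
proof (induction N)
  case 0 then show ?case using d_refl[OF node_cell_in] by simp
next
  case (Suc N)
  have "d (node T n (cell T n s)) (node T (n + Suc N) (cell T (n + Suc N) s))
    \<le> d (node T n (cell T n s)) (node T (n + N) (cell T (n + N) s))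
     + d (node T (n + N) (cell T (n + N) s)) (node T (n + Suc N) (cell T (n + Suc N) s))"
    by (intro d_triangle node_cell_in)
  with Suc refine_step[OF s, of "n + N"] show ?case by simp
qed

lemma node_cell_tendsto:
  assumes s: "s \<in> {0..T}"
  shows "(\<lambda>N. d s (node T (n + N) (cell T (n + N) s))) \<longlonglongrightarrow> 0"
proof -
  have lim: "(\<lambda>N. node T (n + N) (cell T (n + N) s)) \<longlonglongrightarrow> s"
  proof (rule tendsto_sandwich[of "\<lambda>N. s - T / 2 ^ (n + N)" _ _ "\<lambda>_. s"])
    have "(\<lambda>N. T / 2 ^ n * (1 / 2) ^ N) \<longlonglongrightarrow> T / 2 ^ n * 0"
      by (intro tendsto_mult_left LIMSEQ_power_zero) auto
    then have "(\<lambda>N. T / 2 ^ (n + N)) \<longlonglongrightarrow> 0" by (simp add: power_add power_one_over field_simps)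
    from tendsto_diff[OF tendsto_const this, of s] show "(\<lambda>N. s - T / 2 ^ (n + N)) \<longlonglongrightarrow> s" by simp
    have "s - T / 2 ^ m \<le> node T m (cell T m s)" "node T m (cell T m s) \<le> s" for m
      using cell_bounds[OF T_pos s, of m] by (auto simp: node_Suc)
    then show "\<forall>\<^sub>F N in sequentially. s - T / 2 ^ (n + N) \<le> node T (n + N) (cell T (n + N) s)"
      and "\<forall>\<^sub>F N in sequentially. node T (n + N) (cell T (n + N) s) \<le> s"
      by (intro always_eventually allI; blast)+
  qed simp
  have "((\<lambda>t. d s t) \<longlongrightarrow> d s s) (at s within {0..T})"
    using d_cont[OF s] d_refl[OF s] by simp
  then have "continuous (at s within {0..T}) (\<lambda>t. d s t)" by (simp add: continuous_within)
  then show ?thesis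
    using continuous_within_tendsto_compose'[where f = "d s", OF _ node_cell_in lim] d_refl[OF s] by simp
qed

text \<open>Close points lie in equal or adjacent cells of level \<open>n\<close>, and from there
  both are approached by refining the cells. The sum is kept finite, with \<open>e\<close> for the
  remaining distance, so that the argument stays in the reals without summability
  conditions.\<close>

lemma pointwise_bound:
  assumes st: "s \<in> {0..T}" "t \<in> {0..T}" and close: "\<bar>t - s\<bar> \<le> T / 2 ^ n" and e: "0 < e"
  shows "\<exists>N. d s t \<le> (\<Sum>j<N. 2 * (local_step (n + j) (cell T (n + j) s) + local_step (n + j) (cell T (n + j) t))) + e"
proof -
  let ?s = "\<lambda>m. node T m (cell T m s)" and ?t = "\<lambda>m. node T m (cell T m t)"
  let ?l = "\<lambda>m s. local_step m (cell T m s)"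
  have l0: "0 \<le> ?l m s" for m s using local_step_nonneg cell_less by blast
  have mid: "d (?s n) (?t n) \<le> ?l n s + ?l n t"
  proof -
    have le: "step n (cell T n s) \<le> ?l n s" for s
      using step_nonneg[of "2 * cell T n s" "Suc n"] cell_less[of T n s] by (simp add: local_step_def)
    consider "cell T n t = cell T n s" | "cell T n t = Suc (cell T n s)" | "cell T n s = Suc (cell T n t)"
      using cell_adjacent[OF T_pos st(1,2), of n] cell_adjacent[OF T_pos st(2,1), of n] close
      by (metis abs_le_iff abs_minus_commute linear minus_diff_eq)
    then show ?thesis
    proof cases
      case 1 then show ?thesis using l0[of n s] l0[of n t] d_refl[OF node_cell_in[of n s]] by simp
    next
      case 2 then show ?thesis using l0[of n t] le[of s] by (simp add: step_def)
    next
      case 3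
      then have "d (?s n) (?t n) = step n (cell T n t)"
        using d_sym[OF node_cell_in[of n s] node_cell_in[of n t]] by (simp add: step_def)
      then show ?thesis using l0[of n s] le[of t] by simp
    qed
  qed
  have "(\<lambda>N. d s (?s (n + N)) + d t (?t (n + N))) \<longlonglongrightarrow> 0 + 0"
    using st by (intro tendsto_add node_cell_tendsto)
  then have "\<forall>\<^sub>F N in sequentially. d s (?s (n + N)) + d t (?t (n + N)) < e"
    using e by (intro order_tendstoD) auto
  then obtain N0 where N0: "\<And>N. N \<ge> N0 \<Longrightarrow> d s (?s (n + N)) + d t (?t (n + N)) < e"
    unfolding eventually_sequentially by blast
  \<comment> \<open>At least one term puts the summands \<open>j = 0\<close> into both sums; they
    absorb the crossing between the two starting cells, which accounts for the factor 2.\<close>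
  define N where "N = Suc N0"
  have N: "d s (?s (n + N)) + d t (?t (n + N)) < e" using N0[of N] by (simp add: N_def)
  have in_: "?s m \<in> {0..T}" "?t m \<in> {0..T}" for m by (rule node_cell_in)+
  have "d s t \<le> d s (?s (n + N)) + d (?s (n + N)) (?s n) + d (?s n) (?t n) + d (?t n) (?t (n + N)) + d (?t (n + N)) t"
    using d_triangle[OF st(1) in_(1) st(2), of "n + N"] d_triangle[OF in_(1) in_(1) st(2), of "n + N" n]
      d_triangle[OF in_(1) in_(2) st(2), of n n] d_triangle[OF in_(2) in_(2) st(2), of n "n + N"]
    by linarith
  also have "\<dots> \<le> (\<Sum>j<N. ?l (n + j) s) + (\<Sum>j<N. ?l (n + j) t) + (?l n s + ?l n t) + e"
    using chain_bound[OF st(1), of n N] chain_bound[OF st(2), of n N] mid N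
      d_sym[OF in_(1)[of "n + N"] in_(1)[of n]] d_sym[OF st(2) in_(2)[of "n + N"]] by linarith
  also have "?l n s + ?l n t \<le> (\<Sum>j<N. ?l (n + j) s) + (\<Sum>j<N. ?l (n + j) t)"
    using member_le_sum[of 0 "{..<N}" "\<lambda>j. ?l (n + j) s"] member_le_sum[of 0 "{..<N}" "\<lambda>j. ?l (n + j) t"] l0
    by (intro add_mono) (auto simp: N_def)
  finally have "d s t \<le> 2 * (\<Sum>j<N. ?l (n + j) s) + 2 * (\<Sum>j<N. ?l (n + j) t) + e" by simp
  then show ?thesis by (auto simp: sum.distrib sum_distrib_left[symmetric] intro!: exI[of _ N])
qed

end

section \<open>Integration of the chaining bound\<close>

definition near :: "real \<Rightarrow> real \<Rightarrow> real \<Rightarrow> ennreal" where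
  "near h s t = (if \<bar>t - s\<bar> \<le> h then 1 else 0)"

lemma near_measurable [measurable (raw)]:
  assumes [measurable]: "f \<in> borel_measurable M" "g \<in> borel_measurable M"
  shows "(\<lambda>x. near h (f x) (g x)) \<in> borel_measurable M"
  unfolding near_def by measurable

lemma nn_integral_near:
  assumes "0 \<le> h"
  shows "(\<integral>\<^sup>+ s. near h s t \<partial>lborel) = ennreal (2 * h)"
proof -
  have "(\<integral>\<^sup>+ s. near h s t \<partial>lborel) = (\<integral>\<^sup>+ s. indicator {t - h..t + h} s \<partial>lborel)"
    by (intro nn_integral_cong) (auto simp: near_def indicator_def abs_le_iff)
  also have "\<dots> = ennreal (2 * h)" using assms by simp
  finally show ?thesis .
qed

lemma near_sym: "near h s t = near h t s"
  by (simp add: near_def abs_minus_commute)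

text \<open>For a fixed value of either variable the strip has length 2h in the other; Fubini brings
  the term in \<open>s\<close> to the form of the term in \<open>t\<close>.\<close>

lemma nn_integral_near_sum:
  assumes h: "0 \<le> h" and [measurable]: "\<phi> \<in> borel_measurable borel"
  shows "(\<integral>\<^sup>+ t. \<integral>\<^sup>+ s. near h s t * (\<phi> s + \<phi> t) \<partial>lborel \<partial>lborel) = ennreal (4 * h) * (\<integral>\<^sup>+ s. \<phi> s \<partial>lborel)"
proof -
  have 1: "(\<integral>\<^sup>+ t. \<integral>\<^sup>+ s. near h s t * \<phi> t \<partial>lborel \<partial>lborel) = ennreal (2 * h) * (\<integral>\<^sup>+ s. \<phi> s \<partial>lborel)"
    using h by (simp add: nn_integral_multc nn_integral_near nn_integral_cmult)
  have "(\<integral>\<^sup>+ t. \<integral>\<^sup>+ s. near h s t * \<phi> s \<partial>lborel \<partial>lborel) = (\<integral>\<^sup>+ s. \<integral>\<^sup>+ t. near h s t * \<phi> s \<partial>lborel \<partial>lborel)"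
    by (intro lborel_pair.Fubini') measurable
  also have "\<dots> = (\<integral>\<^sup>+ t. \<integral>\<^sup>+ s. near h s t * \<phi> t \<partial>lborel \<partial>lborel)"
    by (simp add: near_sym)
  finally have 2: "(\<integral>\<^sup>+ t. \<integral>\<^sup>+ s. near h s t * \<phi> s \<partial>lborel \<partial>lborel) = ennreal (2 * h) * (\<integral>\<^sup>+ s. \<phi> s \<partial>lborel)"
    using 1 by simp
  have "(\<integral>\<^sup>+ t. \<integral>\<^sup>+ s. near h s t * (\<phi> s + \<phi> t) \<partial>lborel \<partial>lborel)
      = (\<integral>\<^sup>+ t. (\<integral>\<^sup>+ s. near h s t * \<phi> s \<partial>lborel) + (\<integral>\<^sup>+ s. near h s t * \<phi> t \<partial>lborel) \<partial>lborel)"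
    by (intro nn_integral_cong) (subst nn_integral_add[symmetric], auto simp: distrib_left)
  also have "\<dots> = ennreal (2 * h) * (\<integral>\<^sup>+ s. \<phi> s \<partial>lborel) + ennreal (2 * h) * (\<integral>\<^sup>+ s. \<phi> s \<partial>lborel)"
    by (subst nn_integral_add) (use 1 2 in auto)
  also have "\<dots> = ennreal (4 * h) * (\<integral>\<^sup>+ s. \<phi> s \<partial>lborel)"
    using h by (simp add: distrib_right[symmetric] flip: ennreal_plus)
  finally show ?thesis .
qed

lemma dyadic_scale:
  fixes T x :: real
  assumes "0 < T" "0 < x" "x \<le> T"
  obtains n where "T / 2 ^ Suc n < x" "x \<le> T / 2 ^ n"
proof -
  have "(\<lambda>n. T * (1 / 2) ^ n) \<longlonglongrightarrow> T * 0"
    by (intro tendsto_mult_left LIMSEQ_power_zero) auto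
  then have "\<forall>\<^sub>F n in sequentially. T * (1 / 2) ^ n < x" using assms by (intro order_tendstoD) auto
  then obtain m where m: "T / 2 ^ m < x" by (auto simp: eventually_sequentially power_one_over)
  have "\<exists>n. T / 2 ^ Suc n < x \<and> x \<le> T / 2 ^ n"
  proof (rule ccontr)
    assume *: "\<not> ?thesis"
    have "x \<le> T / 2 ^ n" for n
      by (induction n) (use assms(3) * in \<open>auto simp: not_less\<close>)
    with m show False using not_less by blast
  qed
  with that show ?thesis by blast
qed

context path_pseudometric begin

text \<open>A measurable replacement for the local step of the cell containing \<open>s\<close>. The
  closed cells overlap at nodes, which is harmless for an upper bound, and they keep the end point
  \<open>T\<close> covered.\<close>

definition cell_majorant :: "real \<Rightarrow> nat \<Rightarrow> real \<Rightarrow> ennreal" where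
  "cell_majorant P m s = (\<Sum>k<2 ^ m. ennreal (local_step m k powr P) * indicator {node T m k..node T m (Suc k)} s)"

lemma cell_majorant_measurable [measurable]: "cell_majorant P m \<in> borel_measurable borel"
  unfolding cell_majorant_def by measurable

lemma cell_majorant_ge:
  assumes "s \<in> {0..T}"
  shows "ennreal (local_step m (cell T m s) powr P) \<le> cell_majorant P m s"
proof -
  have "ennreal (local_step m (cell T m s) powr P) =
      ennreal (local_step m (cell T m s) powr P) * indicator {node T m (cell T m s)..node T m (Suc (cell T m s))} s"
    using cell_bounds[OF T_pos assms] by simp
  also have "\<dots> \<le> cell_majorant P m s"
    unfolding cell_majorant_def using cell_less by (intro member_le_sum) auto
  finally show ?thesis .
qed

lemma nn_integral_cell_majorant:
  "(\<integral>\<^sup>+ s. cell_majorant P m s \<partial>lborel) = ennreal (T / 2 ^ m) * (\<Sum>k<2 ^ m. ennreal (local_step m k powr P))"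
proof -
  have "(\<integral>\<^sup>+ s. cell_majorant P m s \<partial>lborel) =
      (\<Sum>k<2 ^ m. ennreal (local_step m k powr P) * emeasure lborel {node T m k..node T m (Suc k)})"
    unfolding cell_majorant_def by (subst nn_integral_sum) (auto simp: nn_integral_cmult)
  also have "\<dots> = (\<Sum>k<2 ^ m. ennreal (local_step m k powr P) * ennreal (T / 2 ^ m))"
    using T_pos by (simp add: node_Suc)
  finally show ?thesis by (simp add: sum_distrib_left mult.commute del: sum_ennreal)
qed

abbreviation majorant2 :: "real \<Rightarrow> nat \<Rightarrow> real \<Rightarrow> real \<Rightarrow> ennreal" where
  "majorant2 P m s t \<equiv> cell_majorant P m s + cell_majorant P m t"

text \<open>Any finite bound of the weighted series bounds each local step along both chains of
  \<open>pointwise_bound\<close>; two chains with their factor 2 give the 4 in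
  \<open>powr_bound_of_geometric\<close>.\<close>

lemma powr_bound:
  assumes \<rho>: "0 < \<rho>" "\<rho> < 1" and P: "0 < P"
    and st: "s \<in> {0..T}" "t \<in> {0..T}" and close: "\<bar>t - s\<bar> \<le> T / 2 ^ n"
  shows "ennreal (d s t powr P) \<le> ennreal ((4 / (1 - \<rho> powr (1 / P))) powr P) *
    (\<Sum>j. ennreal ((1 / \<rho>) ^ j) * (majorant2 P (n + j) s t))"
proof (rule powr_bound_of_geometric[OF \<rho> P])
  fix S e :: real
  assume S: "0 < S" and le: "(\<Sum>j. ennreal ((1 / \<rho>) ^ j) * (majorant2 P (n + j) s t)) \<le> ennreal S"
    and e: "0 < e"
  have bound: "local_step (n + j) (cell T (n + j) u) \<le> (\<rho> ^ j * S) powr (1 / P)" if u: "u = s \<or> u = t" for j u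
  proof -
    let ?x = "local_step (n + j) (cell T (n + j) u)"
    have x0: "0 \<le> ?x" using local_step_nonneg cell_less by blast
    have "ennreal ((1 / \<rho>) ^ j * ?x powr P) = ennreal ((1 / \<rho>) ^ j) * ennreal (?x powr P)"
      using \<rho> by (intro ennreal_mult) auto
    also have "\<dots> \<le> ennreal ((1 / \<rho>) ^ j) * (majorant2 P (n + j) s t)"
      using cell_majorant_ge[of u "n + j" P] u st by (intro mult_left_mono) (auto intro: add_increasing add_increasing2)
    also have "\<dots> \<le> (\<Sum>j. ennreal ((1 / \<rho>) ^ j) * (majorant2 P (n + j) s t))"
      using sum_le_suminf[OF summableI, of "{j}" "\<lambda>j. ennreal ((1 / \<rho>) ^ j) * (majorant2 P (n + j) s t)"] by simp
    also note le
    finally have "(1 / \<rho>) ^ j * ?x powr P \<le> S" using S by (simp add: ennreal_le_iff)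
    then have "?x powr P \<le> \<rho> ^ j * S" using \<rho> by (simp add: power_one_over field_simps)
    then have "(?x powr P) powr (1 / P) \<le> (\<rho> ^ j * S) powr (1 / P)" using P by (intro powr_mono2) auto
    then show ?thesis using x0 P by (simp add: powr_powr)
  qed
  obtain N where N: "d s t \<le> (\<Sum>j<N. 2 * (local_step (n + j) (cell T (n + j) s) + local_step (n + j) (cell T (n + j) t))) + e"
    using pointwise_bound[OF st close e] by blast
  also have "(\<Sum>j<N. 2 * (local_step (n + j) (cell T (n + j) s) + local_step (n + j) (cell T (n + j) t)))
     \<le> (\<Sum>j<N. 4 * (\<rho> ^ j * S) powr (1 / P))"
  proof (rule sum_mono)
    fix j
    show "2 * (local_step (n + j) (cell T (n + j) s) + local_step (n + j) (cell T (n + j) t)) \<le> 4 * (\<rho> ^ j * S) powr (1 / P)"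
      using bound[of s j] bound[of t j] by simp
  qed
  finally show "\<exists>N. d s t \<le> (\<Sum>j<N. 4 * (\<rho> ^ j * S) powr (1 / P)) + e" by auto
qed (use st d_nonneg in auto)

text \<open>The dyadic scale \<open>n\<close> of \<open>\<bar>t - s\<bar>\<close> turns the singular
  weight into \<open>(2 * 2 powr (\<alpha> * P)) ^ n\<close>, up to
  \<open>(2 / T) powr (\<alpha> * P + 1)\<close>. Summing over all \<open>n\<close> replaces this
  choice, which depends on the pair, by an expression that can be integrated term by term.\<close>

lemma integrand_bound:
  assumes \<alpha>: "0 < \<alpha>" and P: "0 < P" and \<rho>: "0 < \<rho>" "\<rho> < 1" and st: "s \<in> {0..T}" "t \<in> {0..T}"
  shows "ennreal (d s t powr P / \<bar>t - s\<bar> powr (\<alpha> * P + 1)) \<le>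
    ennreal ((4 / (1 - \<rho> powr (1 / P))) powr P * (2 / T) powr (\<alpha> * P + 1)) *
    (\<Sum>n. \<Sum>j. ennreal ((2 * 2 powr (\<alpha> * P)) ^ n * (1 / \<rho>) ^ j) *
      (near (T / 2 ^ n) s t * (majorant2 P (n + j) s t)))"
    (is "_ \<le> ennreal (?c * ?b) * (\<Sum>n. ?S n)")
proof (cases "s = t")
  case True then show ?thesis using d_refl[OF st(1)] by simp
next
  case False
  then have "0 < \<bar>t - s\<bar>" "\<bar>t - s\<bar> \<le> T" using st by auto
  with T_pos obtain n where n: "T / 2 ^ Suc n < \<bar>t - s\<bar>" "\<bar>t - s\<bar> \<le> T / 2 ^ n"
    using dyadic_scale by blast
  let ?A = "2 * 2 powr (\<alpha> * P)"
  have "(T / 2 ^ Suc n) powr (\<alpha> * P + 1) \<le> \<bar>t - s\<bar> powr (\<alpha> * P + 1)"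
    using n T_pos \<alpha> P by (intro powr_mono2) auto
  moreover have "(2 / T) powr (\<alpha> * P + 1) * ?A ^ n = 1 / (T / 2 ^ Suc n) powr (\<alpha> * P + 1)"
  proof -
    have "?A ^ n = (2 ^ n) powr (\<alpha> * P + 1)"
      by (simp add: powr_add power_mult_distrib powr_power powr_realpow[symmetric] powr_powr mult.commute add_mult_distrib2 distrib_right)
    then have "(2 / T) powr (\<alpha> * P + 1) * ?A ^ n = (2 / T * 2 ^ n) powr (\<alpha> * P + 1)"
      using T_pos by (simp add: powr_mult del: times_divide_eq_left)
    also have "2 / T * 2 ^ n = 1 / (T / 2 ^ Suc n)" using T_pos by simp
    also have "\<dots> powr (\<alpha> * P + 1) = 1 / (T / 2 ^ Suc n) powr (\<alpha> * P + 1)"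
      using T_pos by (subst powr_divide) auto
    finally show ?thesis .
  qed
  moreover have "0 < (T / 2 ^ Suc n) powr (\<alpha> * P + 1)" using T_pos by simp
  ultimately have weight: "1 / \<bar>t - s\<bar> powr (\<alpha> * P + 1) \<le> ?b * ?A ^ n"
    using frac_le[of 1 1 "(T / 2 ^ Suc n) powr (\<alpha> * P + 1)" "\<bar>t - s\<bar> powr (\<alpha> * P + 1)"] by simp
  have "ennreal (d s t powr P / \<bar>t - s\<bar> powr (\<alpha> * P + 1)) \<le> ennreal (d s t powr P * (?b * ?A ^ n))"
    using mult_left_mono[OF weight, of "d s t powr P"] by (intro ennreal_leI) simp
  also have "\<dots> = ennreal (?b * ?A ^ n) * ennreal (d s t powr P)"
    by (simp add: ennreal_mult mult.commute)
  also have "\<dots> \<le> ennreal (?b * ?A ^ n) * (ennreal ?c *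
      (\<Sum>j. ennreal ((1 / \<rho>) ^ j) * (majorant2 P (n + j) s t)))"
    by (intro mult_left_mono powr_bound[OF \<rho> P st n(2)]) auto
  also have "\<dots> = ennreal (?c * ?b) * (ennreal (?A ^ n) *
      (\<Sum>j. ennreal ((1 / \<rho>) ^ j) * (majorant2 P (n + j) s t)))"
    by (simp add: ennreal_mult mult_ac)
  also have "ennreal (?A ^ n) * (\<Sum>j. ennreal ((1 / \<rho>) ^ j) * (majorant2 P (n + j) s t)) = ?S n"
    using n(2) \<rho> by (simp add: near_def ennreal_mult mult.assoc)
  also have "?S n \<le> (\<Sum>n. ?S n)"
    using sum_le_suminf[OF summableI, of "{n}" ?S] by simp
  finally show ?thesis by (simp add: mult_left_mono)
qed

lemma gagliardo_le_local:
  assumes \<alpha>: "0 < \<alpha>" and P: "0 < P" and \<rho>: "0 < \<rho>" "\<rho> < 1"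
  shows "gagliardo_energy \<alpha> P T d \<le>
    ennreal ((4 / (1 - \<rho> powr (1 / P))) powr P * (2 / T) powr (\<alpha> * P + 1)) *
    (\<Sum>n. \<Sum>j. ennreal ((2 * 2 powr (\<alpha> * P)) ^ n * (1 / \<rho>) ^ j) *
      (ennreal (4 * (T / 2 ^ n)) * (ennreal (T / 2 ^ (n + j)) * (\<Sum>k<2 ^ (n + j). ennreal (local_step (n + j) k powr P)))))"
    (is "_ \<le> ennreal ?C * _")
proof -
  let ?c = "\<lambda>n j. ennreal ((2 * 2 powr (\<alpha> * P)) ^ n * (1 / \<rho>) ^ j)"
  let ?f = "\<lambda>n j s t. near (T / 2 ^ n) s t * (majorant2 P (n + j) s t)"
  have "gagliardo_energy \<alpha> P T d \<le> (\<integral>\<^sup>+ t. \<integral>\<^sup>+ s. ennreal ?C * (\<Sum>n. \<Sum>j. ?c n j * ?f n j s t) \<partial>lborel \<partial>lborel)"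
    unfolding gagliardo_energy_def
  proof (intro nn_integral_mono)
    fix t
    have "(\<integral>\<^sup>+ s\<in>{0..T}. ennreal (d s t powr P / \<bar>t - s\<bar> powr (\<alpha> * P + 1)) \<partial>lborel)
      \<le> (\<integral>\<^sup>+ s. ennreal ?C * (\<Sum>n. \<Sum>j. ?c n j * ?f n j s t) \<partial>lborel)" if "t \<in> {0..T}"
      using integrand_bound[OF \<alpha> P \<rho> _ that] by (intro nn_integral_mono) (auto split: split_indicator)
    then show "(\<integral>\<^sup>+ s\<in>{0..T}. ennreal (d s t powr P / \<bar>t - s\<bar> powr (\<alpha> * P + 1)) \<partial>lborel) * indicator {0..T} t
      \<le> (\<integral>\<^sup>+ s. ennreal ?C * (\<Sum>n. \<Sum>j. ?c n j * ?f n j s t) \<partial>lborel)"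
      by (auto split: split_indicator)
  qed
  also have "\<dots> = ennreal ?C * (\<Sum>n. \<Sum>j. ?c n j * (\<integral>\<^sup>+ t. \<integral>\<^sup>+ s. ?f n j s t \<partial>lborel \<partial>lborel))"
    by (simp add: nn_integral_cmult nn_integral_suminf)
  also have "\<dots> = ennreal ?C * (\<Sum>n. \<Sum>j. ?c n j *
      (ennreal (4 * (T / 2 ^ n)) * (ennreal (T / 2 ^ (n + j)) * (\<Sum>k<2 ^ (n + j). ennreal (local_step (n + j) k powr P)))))"
    using T_pos by (subst nn_integral_near_sum) (auto simp: nn_integral_cell_majorant)
  finally show ?thesis .
qed

text \<open>The midpoint steps in \<open>local_step\<close> are among the steps of the next level;
  shifting the weight by one level costs the factor
  \<open>2 / 2 powr (\<alpha> * P)\<close>.\<close>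

lemma local_energy_le:
  assumes P: "0 < P"
  shows "(\<Sum>m. ennreal ((2 powr (\<alpha> * P) / 2) ^ m) * (\<Sum>k<2 ^ m. ennreal (local_step m k powr P)))
    \<le> ennreal (2 powr P * (1 + 2 / 2 powr (\<alpha> * P))) * dyadic_energy \<alpha> P T d"
proof -
  let ?a = "2 powr (\<alpha> * P) / 2" and ?E = "\<lambda>m. \<Sum>k<2 ^ m. ennreal (step m k powr P)"
  have a: "0 < ?a" by simp
  have "(\<Sum>k<2 ^ m. ennreal (local_step m k powr P)) \<le> ennreal (2 powr P) * (?E m + ?E (Suc m))" for m
  proof -
    have "(\<Sum>k<2 ^ m. ennreal (local_step m k powr P))
      \<le> (\<Sum>k<2 ^ m. ennreal (2 powr P) * (ennreal (step m k powr P) + ennreal (step (Suc m) (2 * k) powr P)))"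
    proof (rule sum_mono)
      fix k :: nat assume "k \<in> {..<2 ^ m}"
      then have "local_step m k powr P \<le> 2 powr P * (step m k powr P + step (Suc m) (2 * k) powr P)"
        unfolding local_step_def using P by (intro powr_add_le step_nonneg) auto
      then show "ennreal (local_step m k powr P) \<le> ennreal (2 powr P) * (ennreal (step m k powr P) + ennreal (step (Suc m) (2 * k) powr P))"
        by (simp add: ennreal_leI flip: ennreal_plus ennreal_mult)
    qed
    also have "\<dots> = ennreal (2 powr P) * (?E m + (\<Sum>k<2 ^ m. ennreal (step (Suc m) (2 * k) powr P)))"
      by (simp add: sum_distrib_left sum.distrib distrib_left del: sum_ennreal)
    also have "(\<Sum>k<2 ^ m. ennreal (step (Suc m) (2 * k) powr P)) = (\<Sum>i\<in>(\<lambda>k. 2 * k) ` {..<2 ^ m}. ennreal (step (Suc m) i powr P))"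
      by (subst sum.reindex) (auto simp: inj_on_def)
    also have "\<dots> \<le> ?E (Suc m)" by (intro sum_mono2) auto
    finally show ?thesis by (simp add: mult_left_mono add_left_mono)
  qed
  then have "(\<Sum>m. ennreal (?a ^ m) * (\<Sum>k<2 ^ m. ennreal (local_step m k powr P)))
    \<le> (\<Sum>m. ennreal (?a ^ m) * (ennreal (2 powr P) * (?E m + ?E (Suc m))))"
    by (intro suminf_le mult_left_mono) auto
  also have "\<dots> = (\<Sum>m. ennreal (2 powr P) * (ennreal (?a ^ m) * ?E m + ennreal (1 / ?a) * (ennreal (?a ^ Suc m) * ?E (Suc m))))"
  proof (intro suminf_cong)
    fix m
    have "ennreal (1 / ?a) * ennreal (?a ^ Suc m) = ennreal (?a ^ m)"
      using a by (simp flip: ennreal_mult)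
    then show "ennreal (?a ^ m) * (ennreal (2 powr P) * (?E m + ?E (Suc m))) =
      ennreal (2 powr P) * (ennreal (?a ^ m) * ?E m + ennreal (1 / ?a) * (ennreal (?a ^ Suc m) * ?E (Suc m)))"
      by (simp only: mult.assoc[symmetric]) (simp add: distrib_left mult_ac)
  qed
  also have "\<dots> = ennreal (2 powr P) * ((\<Sum>m. ennreal (?a ^ m) * ?E m) + ennreal (1 / ?a) * (\<Sum>m. ennreal (?a ^ Suc m) * ?E (Suc m)))"
    by (simp only: ennreal_suminf_cmult suminf_add[OF summableI summableI, symmetric])
  also have "\<dots> \<le> ennreal (2 powr P) * (dyadic_energy \<alpha> P T d + ennreal (1 / ?a) * dyadic_energy \<alpha> P T d)"
    using suminf_shift_le_ennreal[of "\<lambda>m. ennreal (?a ^ m) * ?E m" 1]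
    unfolding dyadic_energy_def step_def by (intro mult_left_mono add_mono) auto
  also have "\<dots> = ennreal (2 powr P * (1 + 2 / 2 powr (\<alpha> * P))) * dyadic_energy \<alpha> P T d"
  proof -
    have "ennreal (2 powr P * (1 + 2 / 2 powr (\<alpha> * P))) = ennreal (2 powr P) * (1 + ennreal (1 / ?a))"
      by (subst ennreal_mult) auto
    then show ?thesis by (simp only: distrib_right mult.assoc mult_1)
  qed
  finally show ?thesis .
qed

end

lemma ennreal_mult4:
  "0 \<le> a \<Longrightarrow> 0 \<le> b \<Longrightarrow> 0 \<le> c \<Longrightarrow> 0 \<le> e \<Longrightarrow>
    ennreal (a * (b * c * e)) = ennreal a * (ennreal b * (ennreal c * ennreal e))"
  by (simp add: ennreal_mult mult.assoc)

text \<open>The constant is fixed before \<open>d\<close>, because the pseudometric of the area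
  varies with the path.\<close>

theorem gagliardo_le_dyadic:
  assumes \<alpha>: "0 < \<alpha>" and P: "0 < P" and T: "0 < T"
  shows "\<exists>C>0. \<forall>d. path_pseudometric T d \<longrightarrow> gagliardo_energy \<alpha> P T d \<le> ennreal C * dyadic_energy \<alpha> P T d"
proof -
  define A where "A = 2 powr (\<alpha> * P)"
  \<comment> \<open>With this choice \<open>A * \<rho> = 1 / \<rho>\<close>: the level weight pays
    for the inverse weights of the termwise P-th root and still leaves the factor
    \<open>\<rho> ^ j\<close> that makes the sum over finer levels converge.\<close>
  define \<rho> where "\<rho> = 1 / sqrt A"
  have A: "1 < A" using \<alpha> P by (simp add: A_def)
  have \<rho>: "0 < \<rho>" "\<rho> < 1" using A by (auto simp: \<rho>_def)
  define C0 where "C0 = (4 / (1 - \<rho> powr (1 / P))) powr P * (2 / T) powr (\<alpha> * P + 1)"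
  define C1 where "C1 = 4 * T\<^sup>2 * (1 / (1 - \<rho>)) * (2 powr P * (1 + 2 / A))"
  have r1: "\<rho> powr (1 / P) < 1" using powr_less_mono2[of "1 / P" \<rho> 1] P \<rho> by simp
  have "0 < 4 / (1 - \<rho> powr (1 / P))" using r1 by simp
  then have pos: "0 < C0" "0 < C1"
    using T A \<rho> by (auto simp: C0_def C1_def intro!: mult_pos_pos divide_pos_pos add_pos_pos)
  show ?thesis
  proof (intro exI[of _ "C0 * C1"] conjI allI impI)
    fix d assume "path_pseudometric T d"
    then interpret path_pseudometric T d .
    let ?V = "\<lambda>m. \<Sum>k<2 ^ m. ennreal (local_step m k powr P)"
    have term_eq: "ennreal ((2 * A) ^ n * (1 / \<rho>) ^ j) * (ennreal (4 * (T / 2 ^ n)) * (ennreal (T / 2 ^ (n + j)) * ?V (n + j)))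
      = ennreal (4 * T\<^sup>2) * (ennreal (\<rho> ^ j) * (ennreal ((A / 2) ^ (n + j)) * ?V (n + j)))" for n j
    proof -
      have "A * \<rho> = 1 / \<rho>"
        using A by (simp add: \<rho>_def real_div_sqrt)
      then have "(1 / \<rho>) ^ j = A ^ j * \<rho> ^ j" by (simp add: power_mult_distrib[symmetric])
      then have "(2 * A) ^ n * (1 / \<rho>) ^ j * (4 * (T / 2 ^ n) * (T / 2 ^ (n + j))) = 4 * T\<^sup>2 * (\<rho> ^ j * (A / 2) ^ (n + j))"
        by (simp add: power_add power_mult_distrib power_divide power2_eq_square field_simps)
      then have "ennreal ((2 * A) ^ n * (1 / \<rho>) ^ j) * (ennreal (4 * (T / 2 ^ n)) * ennreal (T / 2 ^ (n + j)))
        = ennreal (4 * T\<^sup>2) * (ennreal (\<rho> ^ j) * ennreal ((A / 2) ^ (n + j)))"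
        using A \<rho> T by (simp add: mult.assoc flip: ennreal_mult)
      then show ?thesis by (simp only: mult.assoc[symmetric])
    qed
    have "gagliardo_energy \<alpha> P T d \<le> ennreal C0 *
      (\<Sum>n. \<Sum>j. ennreal (4 * T\<^sup>2) * (ennreal (\<rho> ^ j) * (ennreal ((A / 2) ^ (n + j)) * ?V (n + j))))"
      using gagliardo_le_local[OF \<alpha> P \<rho>] unfolding A_def[symmetric] C0_def[symmetric] term_eq .
    also have "\<dots> = ennreal C0 * (ennreal (4 * T\<^sup>2) * (\<Sum>n. \<Sum>j. ennreal (\<rho> ^ j) * (ennreal ((A / 2) ^ (n + j)) * ?V (n + j))))"
      by (simp only: ennreal_suminf_cmult)
    also have "\<dots> \<le> ennreal C0 * (ennreal (4 * T\<^sup>2) * (ennreal (1 / (1 - \<rho>)) * (\<Sum>m. ennreal ((A / 2) ^ m) * ?V m)))"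
      using \<rho> suminf_convolution_le[of \<rho> "\<lambda>m. ennreal ((A / 2) ^ m) * ?V m"] by (intro mult_left_mono) auto
    also have "\<dots> \<le> ennreal C0 * (ennreal (4 * T\<^sup>2) * (ennreal (1 / (1 - \<rho>)) * (ennreal (2 powr P * (1 + 2 / A)) * dyadic_energy \<alpha> P T d)))"
      using local_energy_le[OF P, of \<alpha>] unfolding A_def[symmetric] by (intro mult_left_mono) auto
    also have "\<dots> = ennreal (C0 * C1) * dyadic_energy \<alpha> P T d"
    proof -
      have "ennreal (C0 * C1) = ennreal C0 * (ennreal (4 * T\<^sup>2) *
          (ennreal (1 / (1 - \<rho>)) * ennreal (2 powr P * (1 + 2 / A))))"
        unfolding C1_def using pos \<rho> A by (intro ennreal_mult4) auto
      then show ?thesis by (simp only: mult.assoc)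
    qed
    finally show "gagliardo_energy \<alpha> P T d \<le> ennreal (C0 * C1) * dyadic_energy \<alpha> P T d" .
  qed (use pos in simp)
qed

section \<open>Averaging over shrinking intervals\<close>

lemma set_nn_integral_mono2:
  assumes "\<And>s t. s \<in> A \<Longrightarrow> t \<in> A \<Longrightarrow> F s t \<le> G s t"
  shows "(\<integral>\<^sup>+t\<in>A. (\<integral>\<^sup>+s\<in>A. F s t \<partial>M) \<partial>M) \<le> (\<integral>\<^sup>+t\<in>A. (\<integral>\<^sup>+s\<in>A. G s t \<partial>M) \<partial>M)"
proof (intro nn_integral_mono)
  fix t
  have "(\<integral>\<^sup>+s\<in>A. F s t \<partial>M) \<le> (\<integral>\<^sup>+s\<in>A. G s t \<partial>M)" if "t \<in> A"
    using assms[OF _ that] by (intro nn_integral_mono) (auto split: split_indicator)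
  then show "(\<integral>\<^sup>+s\<in>A. F s t \<partial>M) * indicator A t \<le> (\<integral>\<^sup>+s\<in>A. G s t \<partial>M) * indicator A t"
    by (auto split: split_indicator)
qed

text \<open>The number \<open>h\<close> stands for the length of \<open>I\<close>; passing it
  separately avoids dividing by a measure in \<open>ennreal\<close>.\<close>

definition average :: "real \<Rightarrow> real set \<Rightarrow> (real \<Rightarrow> ennreal) \<Rightarrow> ennreal" where
  "average h I g = ennreal (1 / h) * (\<integral>\<^sup>+u\<in>I. g u \<partial>lborel)"

lemma average_const:
  assumes "I \<in> sets borel" "emeasure lborel I = ennreal h" "0 < h"
  shows "average h I (\<lambda>_. c) = c"
proof -
  have "ennreal (1 / h) * ennreal h = 1" using assms(3) by (simp flip: ennreal_mult)
  then show ?thesis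
    using assms unfolding average_def by (simp add: nn_integral_cmult_indicator mult.left_commute)
qed

lemma average_mono:
  "(\<And>u. u \<in> I \<Longrightarrow> g u \<le> g' u) \<Longrightarrow> average h I g \<le> average h I g'"
  unfolding average_def by (intro mult_left_mono nn_integral_mono) (auto split: split_indicator)

lemma average_add:
  assumes [measurable]: "I \<in> sets borel" "g \<in> borel_measurable borel" "g' \<in> borel_measurable borel"
  shows "average h I (\<lambda>u. g u + g' u) = average h I g + average h I g'"
  unfolding average_def by (simp add: distrib_right nn_integral_add distrib_left)

lemma average_cmult:
  assumes [measurable]: "I \<in> sets borel" "g \<in> borel_measurable borel"
  shows "average h I (\<lambda>u. c * g u) = c * average h I g"
  unfolding average_def by (simp add: mult.assoc nn_integral_cmult mult.left_commute)

lemma average_measurable: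
  assumes [measurable]: "I \<in> sets borel" "(\<lambda>(u, v). F u v) \<in> borel_measurable (borel \<Otimes>\<^sub>M borel)"
  shows "(\<lambda>v. average h I (\<lambda>u. F u v)) \<in> borel_measurable borel"
  unfolding average_def by measurable

text \<open>Plays the role of Jensen's inequality: if the mean of \<open>x powr P\<close> is at most
  \<open>c powr P\<close>, averaging this inequality bounds the mean of \<open>x\<close> by
  2c.\<close>

lemma young_crude:
  fixes x c P :: real
  assumes "0 \<le> x" "0 < c" "1 \<le> P"
  shows "x \<le> c + c powr (1 - P) * x powr P"
proof (cases "x \<le> c")
  case True
  moreover have "0 \<le> c powr (1 - P) * x powr P" by simp
  ultimately show ?thesis by linarith
next
  case False
  then have "x = x powr (1 - P) * x powr P" using assms by (simp flip: powr_add)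
  also have "\<dots> \<le> c powr (1 - P) * x powr P"
    using False assms by (intro mult_right_mono powr_mono2') auto
  finally show ?thesis using assms by simp
qed

text \<open>The singular weight of the Gagliardo integral is replaced by a cutoff to a strip;
  weighted sums over dyadic \<open>h\<close> are compared with that weight later.\<close>

definition block_energy :: "real \<Rightarrow> (real \<Rightarrow> real) \<Rightarrow> real set \<Rightarrow> real \<Rightarrow> ennreal" where
  "block_energy P f J h = (\<integral>\<^sup>+v\<in>J. (\<integral>\<^sup>+u\<in>J. ennreal (\<bar>f u - f v\<bar> powr P) * near h u v \<partial>lborel) \<partial>lborel)"

text \<open>Telescopes over the averages on \<open>I j\<close>, which shrink to \<open>x\<close>.
  Passing from one average to the next costs a mean of \<open>\<bar>f u - f v\<bar>\<close> over the
  product of \<open>I j\<close> and \<open>I (Suc j)\<close>, which the block energy on a strip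
  controls; continuity at \<open>x\<close> disposes of the last average.\<close>

lemma shrinking_averages:
  fixes f :: "real \<Rightarrow> real" and I :: "nat \<Rightarrow> real set"
  assumes f: "continuous_on UNIV f" and P: "1 \<le> P" and \<rho>: "0 < \<rho>" and h: "0 < h"
    and J [measurable]: "J \<in> sets borel" and I: "\<And>j. I j \<in> sets borel" "\<And>j. emeasure lborel (I j) = ennreal (h / 2 ^ j)"
    and sub: "\<And>j. I j \<subseteq> J" "\<And>j y. y \<in> I j \<Longrightarrow> \<bar>x - y\<bar> \<le> h / 2 ^ j"
    and close: "\<And>j u v. u \<in> I j \<Longrightarrow> v \<in> I (Suc j) \<Longrightarrow> \<bar>v - u\<bar> \<le> h / 2 ^ j"
    and s: "0 < s" and S: "(\<Sum>j. ennreal ((1 / \<rho>) ^ j * (2 * 4 ^ j / h\<^sup>2)) * block_energy P f J (h / 2 ^ j)) \<le> ennreal s"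
    and e: "0 < e"
  shows "\<exists>N0. \<forall>N\<ge>N0. average h (I 0) (\<lambda>u. ennreal \<bar>f x - f u\<bar>) \<le> ennreal ((\<Sum>j<N. 2 * (\<rho> ^ j * s) powr (1 / P)) + e)"
proof -
  note I(1)[measurable]
  have fm [measurable]: "f \<in> borel_measurable borel"
    using f by (intro borel_measurable_continuous_onI) auto
  let ?av = "\<lambda>j. average (h / 2 ^ j) (I j)"
  let ?m = "\<lambda>j. ?av j (\<lambda>u. ennreal \<bar>f x - f u\<bar>)"
  let ?A = "\<lambda>j. ?av (Suc j) (\<lambda>v. ?av j (\<lambda>u. ennreal \<bar>f u - f v\<bar>))"
  let ?B = "\<lambda>j. ?av (Suc j) (\<lambda>v. ?av j (\<lambda>u. ennreal (\<bar>f u - f v\<bar> powr P)))"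
  let ?F = "\<lambda>u v. ennreal (\<bar>f u - f v\<bar> powr P)" and ?D = "\<lambda>u v. ennreal \<bar>f u - f v\<bar>"
  let ?Q = "\<lambda>j v. \<integral>\<^sup>+u\<in>J. ?F u v * near (h / 2 ^ j) u v \<partial>lborel"
  have hj: "0 < h / 2 ^ j" for j :: nat using h by simp
  have mA [measurable]: "(\<lambda>v. ?av j (\<lambda>u. ?D u v)) \<in> borel_measurable borel" for j
    by (rule average_measurable) measurable
  have mB [measurable]: "(\<lambda>v. ?av j (\<lambda>u. ?F u v)) \<in> borel_measurable borel" for j
    by (rule average_measurable) measurable
  have step: "?m j \<le> ?m (Suc j) + ?A j" for j
  proof -
    have "?m j = ?av (Suc j) (\<lambda>_. ?m j)"
      by (rule average_const[symmetric, OF I hj])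
    also have "\<dots> \<le> ?av (Suc j) (\<lambda>v. ennreal \<bar>f x - f v\<bar> + ?av j (\<lambda>u. ?D u v))"
    proof (rule average_mono)
      fix v
      have "?m j \<le> ?av j (\<lambda>u. ennreal \<bar>f x - f v\<bar> + ?D u v)"
        by (intro average_mono) (auto simp flip: ennreal_plus intro!: ennreal_leI)
      also have "\<dots> = ?av j (\<lambda>u. ennreal \<bar>f x - f v\<bar>) + ?av j (\<lambda>u. ?D u v)"
        by (rule average_add) measurable
      also have "?av j (\<lambda>u. ennreal \<bar>f x - f v\<bar>) = ennreal \<bar>f x - f v\<bar>"
        by (rule average_const[OF I hj])
      finally show "?m j \<le> ennreal \<bar>f x - f v\<bar> + ?av j (\<lambda>u. ?D u v)" .
    qed
    also have "\<dots> = ?m (Suc j) + ?A j"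
      by (rule average_add) measurable
    finally show ?thesis .
  qed
  \<comment> \<open>The factor \<open>2 * 4 ^ j / h\<^sup>2\<close> is the reciprocal of the product
    of the lengths \<open>h / 2 ^ j\<close> and \<open>h / 2 ^ Suc j\<close>.\<close>
  have B: "?B j \<le> ennreal (2 * 4 ^ j / h\<^sup>2) * block_energy P f J (h / 2 ^ j)" for j
  proof -
    have "?B j \<le> ?av (Suc j) (\<lambda>v. ennreal (1 / (h / 2 ^ j)) *
        ?Q j v)"
    proof (rule average_mono)
      fix v assume v: "v \<in> I (Suc j)"
      have "?F u v * indicator (I j) u
          \<le> ?F u v * near (h / 2 ^ j) u v * indicator J u" for u
        using close[OF _ v] sub(1)[of j] by (auto simp: near_def split: split_indicator)
      then show "?av j (\<lambda>u. ?F u v) \<le> ennreal (1 / (h / 2 ^ j)) *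
        ?Q j v"
        unfolding average_def by (intro mult_left_mono nn_integral_mono) auto
    qed
    also have "\<dots> \<le> ennreal (1 / (h / 2 ^ Suc j)) * (ennreal (1 / (h / 2 ^ j)) * block_energy P f J (h / 2 ^ j))"
      unfolding average_def
    proof (rule mult_left_mono)
      have "(\<integral>\<^sup>+v\<in>I (Suc j). ennreal (1 / (h / 2 ^ j)) * ?Q j v \<partial>lborel)
        \<le> (\<integral>\<^sup>+v. ennreal (1 / (h / 2 ^ j)) * (?Q j v * indicator J v) \<partial>lborel)"
        using sub(1)[of "Suc j"] by (intro nn_integral_mono) (auto split: split_indicator)
      also have "\<dots> \<le> ennreal (1 / (h / 2 ^ j)) * block_energy P f J (h / 2 ^ j)"
        unfolding block_energy_def by (simp add: nn_integral_cmult)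
      finally show "(\<integral>\<^sup>+v\<in>I (Suc j). ennreal (1 / (h / 2 ^ j)) * ?Q j v \<partial>lborel)
        \<le> ennreal (1 / (h / 2 ^ j)) * block_energy P f J (h / 2 ^ j)" .
    qed simp
    also have "\<dots> = ennreal (2 * 4 ^ j / h\<^sup>2) * block_energy P f J (h / 2 ^ j)"
    proof -
      have "(4::real) ^ j = 2 ^ j * 2 ^ j" by (simp flip: power_mult_distrib)
      then have "1 / (h / 2 ^ Suc j) * (1 / (h / 2 ^ j)) = 2 * 4 ^ j / h\<^sup>2"
        by (simp add: power2_eq_square)
      then have "ennreal (1 / (h / 2 ^ Suc j)) * ennreal (1 / (h / 2 ^ j)) = ennreal (2 * 4 ^ j / h\<^sup>2)"
        using h ennreal_mult[of "1 / (h / 2 ^ Suc j)" "1 / (h / 2 ^ j)"] by simp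
      then show ?thesis by (simp only: mult.assoc[symmetric])
    qed
    finally show ?thesis .
  qed
  have A: "?A j \<le> ennreal (2 * (\<rho> ^ j * s) powr (1 / P))" for j
  proof -
    \<comment> \<open>By the hypothesis on the weighted series \<open>c powr P\<close> bounds the
      mean \<open>?B j\<close>, which makes both terms of \<open>young_crude\<close> equal to
      \<open>c\<close>.\<close>
    define c where "c = (\<rho> ^ j * s) powr (1 / P)"
    have c: "0 < c" using \<rho> s by (simp add: c_def)
    have cP: "c powr P = \<rho> ^ j * s" using \<rho> s P by (simp add: c_def powr_powr)
    have "ennreal ((1 / \<rho>) ^ j) * ?B j \<le> ennreal ((1 / \<rho>) ^ j) * (ennreal (2 * 4 ^ j / h\<^sup>2) * block_energy P f J (h / 2 ^ j))"
      by (intro mult_left_mono B) simp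
    also have "\<dots> = ennreal ((1 / \<rho>) ^ j * (2 * 4 ^ j / h\<^sup>2)) * block_energy P f J (h / 2 ^ j)"
      using \<rho> by (subst ennreal_mult) (auto simp: mult.assoc)
    also have "\<dots> \<le> ennreal s"
      using sum_le_suminf[OF summableI, of "{j}" "\<lambda>j. ennreal ((1 / \<rho>) ^ j * (2 * 4 ^ j / h\<^sup>2)) * block_energy P f J (h / 2 ^ j)"] S
      by simp
    finally have "ennreal (\<rho> ^ j) * (ennreal ((1 / \<rho>) ^ j) * ?B j) \<le> ennreal (\<rho> ^ j) * ennreal s"
      by (rule mult_left_mono) simp
    moreover have "ennreal (\<rho> ^ j) * ennreal ((1 / \<rho>) ^ j) = 1"
      using \<rho> by (simp flip: ennreal_mult power_mult_distrib)
    ultimately have Bc: "?B j \<le> ennreal (c powr P)"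
      using \<rho> s by (simp add: cP ennreal_mult mult.assoc[symmetric])
    have young: "ennreal y \<le> ennreal c + ennreal (c powr (1 - P)) * ennreal (y powr P)" if "0 \<le> y" for y
      using young_crude[OF that c P] c by (simp flip: ennreal_plus ennreal_mult add: ennreal_leI)
    have "?A j \<le> ?av (Suc j) (\<lambda>v. ?av j
        (\<lambda>u. ennreal c + ennreal (c powr (1 - P)) * ?F u v))"
      by (intro average_mono young) auto
    also have "\<dots> = ?av (Suc j) (\<lambda>v. ennreal c + ennreal (c powr (1 - P)) *
        ?av j (\<lambda>u. ?F u v))"
      using average_const[OF I hj] by (subst average_add; (subst average_cmult)?; measurable?; simp?)
    also have "\<dots> = ennreal c + ennreal (c powr (1 - P)) * ?B j"
      using average_const[OF I(1) I(2) hj, of "Suc j" "ennreal c"]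
      by (subst average_add; (subst average_cmult)?; measurable?; simp?)
    also have "\<dots> \<le> ennreal c + ennreal (c powr (1 - P)) * ennreal (c powr P)"
      by (intro add_left_mono mult_left_mono Bc) simp
    also have "\<dots> = ennreal (2 * c)"
      using c by (simp flip: ennreal_mult ennreal_plus powr_add)
    finally show ?thesis unfolding c_def .
  qed
  have chain: "?m 0 \<le> ennreal (\<Sum>j<N. 2 * (\<rho> ^ j * s) powr (1 / P)) + ?m N" for N
  proof (induction N)
    case (Suc N)
    note Suc
    also have "ennreal (\<Sum>j<N. 2 * (\<rho> ^ j * s) powr (1 / P)) + ?m N
      \<le> ennreal (\<Sum>j<N. 2 * (\<rho> ^ j * s) powr (1 / P)) + (?m (Suc N) + ennreal (2 * (\<rho> ^ N * s) powr (1 / P)))"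
      using add_left_mono[OF A[of N], of "?m (Suc N)"] step[of N] by (intro add_left_mono) (rule order_trans)
    also have "\<dots> = ennreal (\<Sum>j<Suc N. 2 * (\<rho> ^ j * s) powr (1 / P)) + ?m (Suc N)"
      by (simp add: ennreal_plus sum_nonneg add_ac del: sum_ennreal)
    finally show ?case .
  qed simp
  have "isCont f x" using f by (simp add: continuous_on_eq_continuous_at)
  then obtain \<delta> where \<delta>: "0 < \<delta>" "\<And>y. \<bar>y - x\<bar> < \<delta> \<Longrightarrow> \<bar>f y - f x\<bar> < e"
    using e unfolding continuous_at_eps_delta dist_real_def by blast
  have "(\<lambda>n. h * (1 / 2) ^ n) \<longlonglongrightarrow> h * 0"
    by (intro tendsto_mult_left LIMSEQ_power_zero) auto
  then have "\<forall>\<^sub>F n in sequentially. h * (1 / 2) ^ n < \<delta>" using \<delta>(1) by (intro order_tendstoD) auto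
  then obtain N0 where N0: "\<And>N. N \<ge> N0 \<Longrightarrow> h / 2 ^ N < \<delta>"
    by (auto simp: eventually_sequentially power_one_over)
  have "?m N \<le> ennreal e" if "N \<ge> N0" for N
  proof -
    have "?m N \<le> ?av N (\<lambda>_. ennreal e)"
    proof (intro average_mono ennreal_leI)
      fix u assume "u \<in> I N"
      then have "\<bar>u - x\<bar> < \<delta>" using sub(2)[of u N] N0[OF that] by linarith
      then show "\<bar>f x - f u\<bar> \<le> e" using \<delta>(2)[of u] by linarith
    qed
    then show ?thesis by (simp add: average_const[OF I hj])
  qed
  then have "?m 0 \<le> ennreal ((\<Sum>j<N. 2 * (\<rho> ^ j * s) powr (1 / P)) + e)" if "N \<ge> N0" for N
    using order_trans[OF chain[of N] add_left_mono] that e by (simp add: ennreal_plus sum_nonneg del: sum_ennreal)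
  then show ?thesis by auto
qed

text \<open>Intervals shrinking to \<open>a\<close> and intervals shrinking to \<open>b\<close> both
  start with all of \<open>{a..<b}\<close>, so both end values are compared with the same mean; each
  side contributes 2 to the 4.\<close>

lemma increment_le_block_energies:
  fixes f :: "real \<Rightarrow> real"
  assumes f: "continuous_on UNIV f" and P: "1 \<le> P" and \<rho>: "0 < \<rho>" "\<rho> < 1" and ab: "a < b"
  shows "ennreal (\<bar>f a - f b\<bar> powr P) \<le> ennreal ((4 / (1 - \<rho> powr (1 / P))) powr P) *
    (\<Sum>j. ennreal ((1 / \<rho>) ^ j * (2 * 4 ^ j / (b - a)\<^sup>2)) * block_energy P f {a..<b} ((b - a) / 2 ^ j))"
proof (rule powr_bound_of_geometric[OF \<rho>])
  fix s e :: real
  assume s: "0 < s" and S: "(\<Sum>j. ennreal ((1 / \<rho>) ^ j * (2 * 4 ^ j / (b - a)\<^sup>2)) * block_energy P f {a..<b} ((b - a) / 2 ^ j)) \<le> ennreal s"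
    and e: "0 < e"
  define h where "h = b - a"
  have h: "0 < h" "b = a + h" using ab by (auto simp: h_def)
  have hj: "h / 2 ^ j \<le> h" "h / 2 ^ Suc j \<le> h / 2 ^ j" "0 < h / 2 ^ j" for j :: nat
    using h by (auto simp: field_simps)
  have fm [measurable]: "f \<in> borel_measurable borel"
    using f by (intro borel_measurable_continuous_onI) auto
  let ?R = "\<lambda>N. (\<Sum>j<N. 2 * (\<rho> ^ j * s) powr (1 / P))"
  have "\<exists>N0. \<forall>N\<ge>N0. average h {a..<a + h / 2 ^ 0} (\<lambda>u. ennreal \<bar>f a - f u\<bar>) \<le> ennreal (?R N + e / 2)"
  proof (rule shrinking_averages[where J = "{a..<b}" and x = a, OF f P \<rho>(1) h(1) _ _ _ _ _ _ s S[folded h_def]])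
    show "emeasure lborel {a..<a + h / 2 ^ j} = ennreal (h / 2 ^ j)" for j
      using hj(3)[of j] by (subst emeasure_lborel_Ico) auto
    show "{a..<a + h / 2 ^ j} \<subseteq> {a..<b}" for j using hj(1)[of j] h(2) by auto
    show "\<bar>v - u\<bar> \<le> h / 2 ^ j" if "u \<in> {a..<a + h / 2 ^ j}" "v \<in> {a..<a + h / 2 ^ Suc j}" for j u v
      using that hj(2)[of j] by auto
  qed (use e hj less_imp_le in auto)
  moreover have "\<exists>N0. \<forall>N\<ge>N0. average h {b - h / 2 ^ 0..<b} (\<lambda>u. ennreal \<bar>f b - f u\<bar>) \<le> ennreal (?R N + e / 2)"
  proof (rule shrinking_averages[where J = "{a..<b}" and x = b, OF f P \<rho>(1) h(1) _ _ _ _ _ _ s S[folded h_def]])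
    show "emeasure lborel {b - h / 2 ^ j..<b} = ennreal (h / 2 ^ j)" for j
      using hj(3)[of j] by (subst emeasure_lborel_Ico) auto
    show "{b - h / 2 ^ j..<b} \<subseteq> {a..<b}" for j using hj(1)[of j] h(2) by auto
    show "\<bar>v - u\<bar> \<le> h / 2 ^ j" if "u \<in> {b - h / 2 ^ j..<b}" "v \<in> {b - h / 2 ^ Suc j..<b}" for j u v
      using that hj(2)[of j] by auto
  qed (use e hj less_imp_le in auto)
  ultimately obtain N1 N2 where
    "\<And>N. N \<ge> N1 \<Longrightarrow> average h {a..<b} (\<lambda>u. ennreal \<bar>f a - f u\<bar>) \<le> ennreal (?R N + e / 2)"
    "\<And>N. N \<ge> N2 \<Longrightarrow> average h {a..<b} (\<lambda>u. ennreal \<bar>f b - f u\<bar>) \<le> ennreal (?R N + e / 2)"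
    by (auto simp: h_def)
  then have N: "average h {a..<b} (\<lambda>u. ennreal \<bar>f a - f u\<bar>) \<le> ennreal (?R (max N1 N2) + e / 2)"
    "average h {a..<b} (\<lambda>u. ennreal \<bar>f b - f u\<bar>) \<le> ennreal (?R (max N1 N2) + e / 2)"
    by auto
  have R0: "0 \<le> ?R N" for N by (intro sum_nonneg) auto
  have "ennreal \<bar>f a - f b\<bar> = average h {a..<b} (\<lambda>_. ennreal \<bar>f a - f b\<bar>)"
    using h by (intro average_const[symmetric]) auto
  also have "\<dots> \<le> average h {a..<b} (\<lambda>u. ennreal \<bar>f a - f u\<bar> + ennreal \<bar>f b - f u\<bar>)"
    by (intro average_mono) (auto simp flip: ennreal_plus intro!: ennreal_leI)
  also have "\<dots> = average h {a..<b} (\<lambda>u. ennreal \<bar>f a - f u\<bar>) + average h {a..<b} (\<lambda>u. ennreal \<bar>f b - f u\<bar>)"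
    by (rule average_add) measurable
  also have "\<dots> \<le> ennreal (?R (max N1 N2) + e / 2) + ennreal (?R (max N1 N2) + e / 2)"
    by (intro add_mono N)
  also have "\<dots> = ennreal ((\<Sum>j<max N1 N2. 4 * (\<rho> ^ j * s) powr (1 / P)) + e)"
    using R0[of "max N1 N2"] e by (simp flip: ennreal_plus sum_distrib_left)
  finally have "\<bar>f a - f b\<bar> \<le> (\<Sum>j<max N1 N2. 4 * (\<rho> ^ j * s) powr (1 / P)) + e"
    using e by (subst (asm) ennreal_le_iff) (auto intro!: add_nonneg_nonneg sum_nonneg)
  then show "\<exists>N. \<bar>f a - f b\<bar> \<le> (\<Sum>j<N. 4 * (\<rho> ^ j * s) powr (1 / P)) + e" by blast
qed (use P in auto)

section \<open>From single cells to the double integral\<close>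

lemma sum_cell_indicator:
  assumes "0 < T"
  shows "(\<Sum>k<N. indicator {node T n k..<node T n (Suc k)} v) = (indicator {0..<node T n N} v :: ennreal)"
proof (induction N)
  case (Suc N)
  have "node T n 0 \<le> node T n N" "node T n N \<le> node T n (Suc N)"
    by (rule node_mono[OF assms], simp)+
  with Suc show ?case by (auto split: split_indicator)
qed simp

text \<open>Half-open cells are disjoint, so each outer point is counted at most once; the inner
  integral is simply enlarged to \<open>{0..T}\<close>.\<close>

lemma sum_block_energy_le:
  fixes f :: "real \<Rightarrow> real"
  assumes T: "0 < T" and f: "continuous_on UNIV f"
  shows "(\<Sum>k<2 ^ n. block_energy P f {node T n k..<node T n (Suc k)} h) \<le> block_energy P f {0..T} h"
proof -
  have fm [measurable]: "f \<in> borel_measurable borel"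
    using f by (intro borel_measurable_continuous_onI) auto
  let ?g = "\<lambda>J v. \<integral>\<^sup>+u\<in>J. ennreal (\<bar>f u - f v\<bar> powr P) * near h u v \<partial>lborel"
  have "(\<Sum>k<2 ^ n. block_energy P f {node T n k..<node T n (Suc k)} h) =
     (\<integral>\<^sup>+v. (\<Sum>k<2 ^ n. ?g {node T n k..<node T n (Suc k)} v * indicator {node T n k..<node T n (Suc k)} v) \<partial>lborel)"
    unfolding block_energy_def by (subst nn_integral_sum) measurable
  also have "\<dots> \<le> (\<integral>\<^sup>+v. (\<Sum>k<2 ^ n. ?g {0..T} v * indicator {node T n k..<node T n (Suc k)} v) \<partial>lborel)"
  proof (intro nn_integral_mono sum_mono mult_right_mono)
    fix k :: nat and v u assume "k \<in> {..<2 ^ n}"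
    then have "node T n k \<in> {0..T}" "node T n (Suc k) \<in> {0..T}"
      using node_in[OF T, of k n] node_in[OF T, of "Suc k" n] by auto
    then show "ennreal (\<bar>f u - f v\<bar> powr P) * near h u v * indicator {node T n k..<node T n (Suc k)} u
      \<le> ennreal (\<bar>f u - f v\<bar> powr P) * near h u v * indicator {0..T} u"
      by (auto split: split_indicator)
  qed simp
  also have "\<dots> \<le> block_energy P f {0..T} h"
    unfolding block_energy_def sum_distrib_left[symmetric] sum_cell_indicator[OF T] node_last
    by (intro nn_integral_mono mult_left_mono) (auto split: split_indicator)
  finally show ?thesis .
qed

text \<open>The weights of all strips that contain a pair add up to at most a multiple of its
  singular weight, by \<open>sum_dyadic_bounded\<close> with
  \<open>X = T / \<bar>v - u\<bar>\<close>.\<close>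

lemma suminf_block_energy_le:
  fixes f :: "real \<Rightarrow> real"
  assumes T: "0 < T" and f: "continuous_on UNIV f" and \<beta>: "0 < \<alpha> * P + 1"
  shows "(\<Sum>m. ennreal ((2 * 2 powr (\<alpha> * P)) ^ m) * block_energy P f {0..T} (T / 2 ^ m))
    \<le> ennreal (T powr (\<alpha> * P + 1) / (1 - 2 powr (- (\<alpha> * P + 1)))) * gagliardo_energy \<alpha> P T (incr f)"
proof -
  have fm [measurable]: "f \<in> borel_measurable borel"
    using f by (intro borel_measurable_continuous_onI) auto
  let ?\<beta> = "\<alpha> * P + 1" and ?F = "\<lambda>u v. ennreal (\<bar>f u - f v\<bar> powr P)"
  let ?c = "\<lambda>m::nat. ennreal ((2 * 2 powr (\<alpha> * P)) ^ m)"
  let ?C = "T powr ?\<beta> / (1 - 2 powr (- ?\<beta>))"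
  have C: "0 < 1 - 2 powr (- ?\<beta>)" using powr_less_mono[of "- ?\<beta>" 0 2] \<beta> by simp
  have c: "?c m = ennreal ((2 powr ?\<beta>) ^ m)" for m by (simp add: powr_add mult.commute)
  have pt: "(\<Sum>m. ?c m * (?F u v * near (T / 2 ^ m) u v)) \<le> ennreal ?C * ennreal (\<bar>f u - f v\<bar> powr P / \<bar>v - u\<bar> powr ?\<beta>)" for u v
  proof (cases "u = v")
    case False
    then have x: "0 < \<bar>v - u\<bar>" by simp
    have eq: "?c m * (?F u v * near (T / 2 ^ m) u v) = ?F u v * (if 2 ^ m \<le> T / \<bar>v - u\<bar> then ennreal ((2 powr ?\<beta>) ^ m) else 0)" for m
    proof -
      have "\<bar>v - u\<bar> \<le> T / 2 ^ m \<longleftrightarrow> 2 ^ m \<le> T / \<bar>v - u\<bar>" using x by (simp add: field_simps)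
      then show ?thesis unfolding near_def c by (simp add: mult.commute)
    qed
    have "(\<Sum>m. ?c m * (?F u v * near (T / 2 ^ m) u v)) = ?F u v * (\<Sum>m. if 2 ^ m \<le> T / \<bar>v - u\<bar> then ennreal ((2 powr ?\<beta>) ^ m) else 0)"
      unfolding eq by simp
    also have "\<dots> \<le> ?F u v * ennreal ((T / \<bar>v - u\<bar>) powr ?\<beta> / (1 - 2 powr (- ?\<beta>)))"
      using T x by (intro mult_left_mono sum_dyadic_bounded \<beta>) auto
    also have "\<dots> = ennreal ?C * ennreal (\<bar>f u - f v\<bar> powr P / \<bar>v - u\<bar> powr ?\<beta>)"
      using T x C by (simp add: powr_divide mult_ac flip: ennreal_mult)
    finally show ?thesis .
  qed simp
  have "?c m * block_energy P f {0..T} (T / 2 ^ m) =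
     (\<integral>\<^sup>+v. \<integral>\<^sup>+u. ?c m * (?F u v * near (T / 2 ^ m) u v) * indicator {0..T} u * indicator {0..T} v \<partial>lborel \<partial>lborel)" for m
    unfolding block_energy_def
    by (simp add: nn_integral_cmult[symmetric] nn_integral_multc[symmetric] mult.assoc)
  then have "(\<Sum>m. ?c m * block_energy P f {0..T} (T / 2 ^ m)) =
     (\<integral>\<^sup>+v. \<integral>\<^sup>+u. (\<Sum>m. ?c m * (?F u v * near (T / 2 ^ m) u v) * indicator {0..T} u * indicator {0..T} v) \<partial>lborel \<partial>lborel)"
    by (simp add: nn_integral_suminf del: ennreal_suminf_multc ennreal_suminf_cmult)
  also have "\<dots> =
     (\<integral>\<^sup>+v. \<integral>\<^sup>+u. (\<Sum>m. ?c m * (?F u v * near (T / 2 ^ m) u v)) * indicator {0..T} u * indicator {0..T} v \<partial>lborel \<partial>lborel)"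
    by simp
  also have "\<dots> \<le> (\<integral>\<^sup>+v. \<integral>\<^sup>+u. ennreal ?C * ennreal (\<bar>f u - f v\<bar> powr P / \<bar>v - u\<bar> powr ?\<beta>) * indicator {0..T} u * indicator {0..T} v \<partial>lborel \<partial>lborel)"
    by (intro nn_integral_mono mult_right_mono pt) auto
  also have "\<dots> = ennreal ?C * gagliardo_energy \<alpha> P T (incr f)"
    unfolding gagliardo_energy_def 
    by (simp add: mult.assoc nn_integral_cmult, simp add: mult.assoc[symmetric] nn_integral_multc)
  finally show ?thesis .
qed

lemma dyadic_le_gagliardo_continuous:
  assumes \<alpha>P: "1 < \<alpha> * P" and P: "1 \<le> P" and T: "0 < T"
  shows "\<exists>C>0. \<forall>f :: real \<Rightarrow> real. continuous_on UNIV f \<longrightarrow>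
    dyadic_energy \<alpha> P T (incr f) \<le> ennreal C * gagliardo_energy \<alpha> P T (incr f)"
proof -
  define A where "A = 2 powr (\<alpha> * P)"
  \<comment> \<open>Here \<open>A / 2 * \<rho> = 1 / \<rho>\<close>, and
    \<open>\<alpha> * P > 1\<close> gives \<open>A > 2\<close>, hence \<rho> < 1. The decay is again
    shared between the P-th roots and the convolution.\<close>
  define \<rho> where "\<rho> = 1 / sqrt (A / 2)"
  have A: "2 < A" using powr_less_mono[of 1 "\<alpha> * P" 2] \<alpha>P by (simp add: A_def)
  have \<rho>: "0 < \<rho>" "\<rho> < 1" using A by (auto simp: \<rho>_def)
  define C0 where "C0 = (4 / (1 - \<rho> powr (1 / P))) powr P"
  define C1 where "C1 = T powr (\<alpha> * P + 1) / (1 - 2 powr (- (\<alpha> * P + 1)))"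
  have r1: "\<rho> powr (1 / P) < 1" using powr_less_mono2[of "1 / P" \<rho> 1] P \<rho> by simp
  then have "0 < 4 / (1 - \<rho> powr (1 / P))" by simp
  then have C0: "0 < C0" by (simp add: C0_def)
  have "0 < 1 - 2 powr (- (\<alpha> * P + 1))" using powr_less_mono[of "- (\<alpha> * P + 1)" 0 2] \<alpha>P by simp
  then have C1: "0 < C1" using T by (simp add: C1_def)
  show ?thesis
  proof (intro exI[of _ "C0 * (2 / T\<^sup>2 * (1 / (1 - \<rho>)) * C1)"] conjI allI impI)
    fix f :: "real \<Rightarrow> real" assume f: "continuous_on UNIV f"
    let ?\<Gamma> = "\<lambda>m. block_energy P f {0..T} (T / 2 ^ m)"
    let ?G = "gagliardo_energy \<alpha> P T (incr f)"
    have level: "(\<Sum>k<2 ^ n. ennreal (\<bar>f (node T n k) - f (node T n (Suc k))\<bar> powr P))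
      \<le> ennreal C0 * (\<Sum>j. ennreal ((1 / \<rho>) ^ j * (2 * 4 ^ j / (T / 2 ^ n)\<^sup>2)) * ?\<Gamma> (n + j))" for n
    proof -
      have "(\<Sum>k<2 ^ n. ennreal (\<bar>f (node T n k) - f (node T n (Suc k))\<bar> powr P))
        \<le> (\<Sum>k<2 ^ n. ennreal C0 * (\<Sum>j. ennreal ((1 / \<rho>) ^ j * (2 * 4 ^ j / (T / 2 ^ n)\<^sup>2)) *
            block_energy P f {node T n k..<node T n (Suc k)} (T / 2 ^ (n + j))))"
      proof (rule sum_mono)
        fix k
        show "ennreal (\<bar>f (node T n k) - f (node T n (Suc k))\<bar> powr P) \<le> ennreal C0 * (\<Sum>j. ennreal ((1 / \<rho>) ^ j * (2 * 4 ^ j / (T / 2 ^ n)\<^sup>2)) *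
            block_energy P f {node T n k..<node T n (Suc k)} (T / 2 ^ (n + j)))"
          using increment_le_block_energies[OF f P \<rho>, of "node T n k" "node T n (Suc k)"] T
          by (simp add: node_Suc C0_def power_add)
      qed
      also have "\<dots> = ennreal C0 * (\<Sum>j. ennreal ((1 / \<rho>) ^ j * (2 * 4 ^ j / (T / 2 ^ n)\<^sup>2)) *
            (\<Sum>k<2 ^ n. block_energy P f {node T n k..<node T n (Suc k)} (T / 2 ^ (n + j))))"
        by (simp only: sum_distrib_left[symmetric] suminf_sum[OF summableI, symmetric])
      also have "\<dots> \<le> ennreal C0 * (\<Sum>j. ennreal ((1 / \<rho>) ^ j * (2 * 4 ^ j / (T / 2 ^ n)\<^sup>2)) * ?\<Gamma> (n + j))"
        by (intro mult_left_mono suminf_le sum_block_energy_le T f) auto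
      finally show ?thesis .
    qed
    have term_eq: "ennreal ((A / 2) ^ n) * (ennreal ((1 / \<rho>) ^ j * (2 * 4 ^ j / (T / 2 ^ n)\<^sup>2)) * g)
      = ennreal (2 / T\<^sup>2) * (ennreal (\<rho> ^ j) * (ennreal ((2 * A) ^ (n + j)) * g))" for n j g
    proof -
      have "A / 2 / sqrt (A / 2) = sqrt (A / 2)"
        using A by (intro real_div_sqrt) simp
      then have "A / 2 * \<rho> = 1 / \<rho>" by (simp add: \<rho>_def)
      then have inv: "(1 / \<rho>) ^ j = (A / 2) ^ j * \<rho> ^ j" by (simp only: power_mult_distrib[symmetric])
      have "A / 2 * 4 = 2 * A" by simp
      then have pow: "(A / 2) ^ i * 4 ^ i = (2 * A) ^ i" for i by (simp only: power_mult_distrib[symmetric])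
      have "(4::real) ^ n = 2 ^ n * 2 ^ n" by (simp flip: power_mult_distrib)
      then have four: "2 * 4 ^ j / (T / 2 ^ n)\<^sup>2 = 2 / T\<^sup>2 * (4 ^ n * 4 ^ j)"
        using T by (simp add: power2_eq_square)
      have "(A / 2) ^ n * ((1 / \<rho>) ^ j * (2 * 4 ^ j / (T / 2 ^ n)\<^sup>2))
          = 2 / T\<^sup>2 * (\<rho> ^ j * (((A / 2) ^ n * 4 ^ n) * ((A / 2) ^ j * 4 ^ j)))"
        unfolding inv four by (simp only: mult_ac)
      then have "(A / 2) ^ n * ((1 / \<rho>) ^ j * (2 * 4 ^ j / (T / 2 ^ n)\<^sup>2)) = 2 / T\<^sup>2 * (\<rho> ^ j * (2 * A) ^ (n + j))"
        by (simp only: pow power_add)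
      then have "ennreal ((A / 2) ^ n) * ennreal ((1 / \<rho>) ^ j * (2 * 4 ^ j / (T / 2 ^ n)\<^sup>2))
        = ennreal (2 / T\<^sup>2) * (ennreal (\<rho> ^ j) * ennreal ((2 * A) ^ (n + j)))"
        using A \<rho> T by (simp flip: ennreal_mult)
      then show ?thesis by (simp only: mult.assoc[symmetric])
    qed
    have "dyadic_energy \<alpha> P T (incr f) \<le> (\<Sum>n. ennreal ((A / 2) ^ n) * (ennreal C0 *
       (\<Sum>j. ennreal ((1 / \<rho>) ^ j * (2 * 4 ^ j / (T / 2 ^ n)\<^sup>2)) * ?\<Gamma> (n + j))))"
      unfolding dyadic_energy_def A_def[symmetric] by (intro suminf_le mult_left_mono level) auto
    also have "\<dots> = ennreal C0 * (\<Sum>n. \<Sum>j. ennreal ((A / 2) ^ n) * (ennreal ((1 / \<rho>) ^ j * (2 * 4 ^ j / (T / 2 ^ n)\<^sup>2)) * ?\<Gamma> (n + j)))"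
      by (simp only: ennreal_suminf_cmult mult.left_commute[of _ "ennreal C0"])
    also have "\<dots> = ennreal C0 * (ennreal (2 / T\<^sup>2) * (\<Sum>n. \<Sum>j. ennreal (\<rho> ^ j) * (ennreal ((2 * A) ^ (n + j)) * ?\<Gamma> (n + j))))"
      unfolding term_eq by (simp only: ennreal_suminf_cmult)
    also have "\<dots> \<le> ennreal C0 * (ennreal (2 / T\<^sup>2) * (ennreal (1 / (1 - \<rho>)) * (\<Sum>m. ennreal ((2 * A) ^ m) * ?\<Gamma> m)))"
      using \<rho> suminf_convolution_le[of \<rho> "\<lambda>m. ennreal ((2 * A) ^ m) * ?\<Gamma> m"] by (intro mult_left_mono) auto
    also have "\<dots> \<le> ennreal C0 * (ennreal (2 / T\<^sup>2) * (ennreal (1 / (1 - \<rho>)) * (ennreal C1 * ?G)))"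
      using suminf_block_energy_le[OF T f, of \<alpha> P] \<alpha>P unfolding A_def[symmetric] C1_def[symmetric]
      by (intro mult_left_mono) auto
    also have "\<dots> = ennreal (C0 * (2 / T\<^sup>2 * (1 / (1 - \<rho>)) * C1)) * ?G"
      using C0 C1 \<rho> T by (subst ennreal_mult4) (auto simp: mult.assoc)
    finally show "dyadic_energy \<alpha> P T (incr f) \<le> ennreal (C0 * (2 / T\<^sup>2 * (1 / (1 - \<rho>)) * C1)) * ?G" .
  next
    show "0 < C0 * (2 / T\<^sup>2 * (1 / (1 - \<rho>)) * C1)"
      using C0 C1 \<rho> T by (intro mult_pos_pos divide_pos_pos) auto
  qed
qed

lemma gagliardo_energy_cong:
  "(\<And>s t. s \<in> {0..T} \<Longrightarrow> t \<in> {0..T} \<Longrightarrow> d s t = d' s t) \<Longrightarrow> gagliardo_energy \<alpha> P T d = gagliardo_energy \<alpha> P T d'"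
  unfolding gagliardo_energy_def by (intro nn_integral_cong set_nn_integral_cong) auto

lemma dyadic_energy_cong:
  assumes "0 < T" and "\<And>s t. s \<in> {0..T} \<Longrightarrow> t \<in> {0..T} \<Longrightarrow> d s t = d' s t"
  shows "dyadic_energy \<alpha> P T d = dyadic_energy \<alpha> P T d'"
  unfolding dyadic_energy_def using assms node_in[OF assms(1)]
  by (intro suminf_cong arg_cong2[where f = "(*)"] refl sum.cong) (auto simp: Suc_le_eq)

theorem dyadic_le_gagliardo:
  assumes \<alpha>P: "1 < \<alpha> * P" and P: "1 \<le> P" and T: "0 < T"
  shows "\<exists>C>0. \<forall>f :: real \<Rightarrow> real. continuous_on {0..T} f \<longrightarrow>
    dyadic_energy \<alpha> P T (incr f) \<le> ennreal C * gagliardo_energy \<alpha> P T (incr f)"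
proof -
  obtain C where C: "0 < C" "\<And>f :: real \<Rightarrow> real. continuous_on UNIV f \<Longrightarrow>
    dyadic_energy \<alpha> P T (incr f) \<le> ennreal C * gagliardo_energy \<alpha> P T (incr f)"
    using dyadic_le_gagliardo_continuous[OF \<alpha>P P T] by blast
  show ?thesis
  proof (intro exI[of _ C] conjI allI impI C(1))
    fix f :: "real \<Rightarrow> real" assume f: "continuous_on {0..T} f"
    \<comment> \<open>Freezing the path outside \<open>[0,T]\<close> gives continuity on the whole
      line, hence Borel measurability, without changing either energy.\<close>
    define g where "g = (\<lambda>t. f (max 0 (min T t)))"
    have "continuous_on UNIV g"
      unfolding g_def using T by (intro continuous_on_compose2[OF f] continuous_intros) auto
    moreover have g: "g t = f t" if "t \<in> {0..T}" for t using that by (simp add: g_def min_absorb2 max_absorb2)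
    ultimately show "dyadic_energy \<alpha> P T (incr f) \<le> ennreal C * gagliardo_energy \<alpha> P T (incr f)"
      using C(2)[of g] dyadic_energy_cong[OF T, of "incr g" "incr f"]
        gagliardo_energy_cong[of T "incr g" "incr f"] by simp
  qed
qed

section \<open>The dyadic area\<close>

text \<open>The deviation of the primitive at the midpoint from the mean of its values at the endpoints that
  gives both halves of the cell the same area.\<close>

definition kink :: "real \<Rightarrow> (real \<Rightarrow> real) \<Rightarrow> (real \<Rightarrow> real) \<Rightarrow> nat \<Rightarrow> nat \<Rightarrow> real" where
  "kink T f g n k =
     (g (node T (Suc n) (Suc (2 * k))) * (f (node T n k) + f (node T n (Suc k)))
      - f (node T (Suc n) (Suc (2 * k))) * (g (node T n k) + g (node T n (Suc k)))) / 4"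

text \<open>The Schauder tent of height 1 over one cell: in the variable
  \<open>2 ^ Suc n * t / T\<close> the midpoints of the cells of level \<open>n\<close> are odd
  integers and the nodes even ones.\<close>

definition hat :: "real \<Rightarrow> nat \<Rightarrow> nat \<Rightarrow> real \<Rightarrow> real" where
  "hat T n k t = max 0 (1 - \<bar>2 ^ Suc n * t / T - real (2 * k + 1)\<bar>)"

definition faber_layer :: "real \<Rightarrow> (real \<Rightarrow> real) \<Rightarrow> (real \<Rightarrow> real) \<Rightarrow> nat \<Rightarrow> real \<Rightarrow> real" where
  "faber_layer T f g n t = (\<Sum>k<2 ^ n. kink T f g n k * hat T n k t)"

text \<open>The layers vanish at 0 and \<open>T\<close>; the linear term normalises the area over
  the whole interval to zero.\<close>

definition area_primitive :: "real \<Rightarrow> (real \<Rightarrow> real) \<Rightarrow> (real \<Rightarrow> real) \<Rightarrow> real \<Rightarrow> real" where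
  "area_primitive T f g t = (f 0 * g T - g 0 * f T) / 2 * (t / T) + (\<Sum>n. faber_layer T f g n t)"

text \<open>If the primitive is the antisymmetric part of the second level of a path in the group,
  this is the antisymmetric part for its increment; the subtracted term comes from multiplication by
  the inverse.\<close>

definition area :: "real \<Rightarrow> (real \<Rightarrow> real) \<Rightarrow> (real \<Rightarrow> real) \<Rightarrow> real \<Rightarrow> real \<Rightarrow> real" where
  "area T f g s t = area_primitive T f g t - area_primitive T f g s - (f s * g t - g s * f t) / 2"

text \<open>A qualitative condition ensuring uniform convergence of the Faber-Schauder series; the
  quantitative bounds come from the energies or, for p = \<infinity>, from the Hoelder
  constants.\<close>

definition dyadic_regular :: "real \<Rightarrow> (real \<Rightarrow> real) \<Rightarrow> bool" where
  "dyadic_regular T f \<longleftrightarrow> continuous_on {0..T} f \<and>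
     (\<exists>M r. 0 \<le> M \<and> 0 \<le> r \<and> r < 1 \<and> (\<forall>n. \<forall>k<2 ^ n. incr f (node T n k) (node T n (Suc k)) \<le> M * r ^ n))"

section \<open>Convergence of the Faber-Schauder series\<close>

lemma sum_tents_le_one:
  "(\<Sum>k<N. max 0 (1 - \<bar>x - real (2 * k + 1)\<bar>)) \<le> (1 :: real)"
proof (induction N)
  case (Suc N)
  show ?case
  proof (cases "x \<le> 2 * real N")
    case True with Suc show ?thesis by simp
  next
    \<comment> \<open>Beyond \<open>2 * real N\<close> all earlier tents have ended, so only the new
      one can be nonzero.\<close>
    case False
    have "(\<Sum>k<N. max 0 (1 - \<bar>x - real (2 * k + 1)\<bar>)) = 0"
    proof (intro sum.neutral ballI)
      fix k assume "k \<in> {..<N}"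
      then have "real k + 1 \<le> real N" by simp
      with False show "max 0 (1 - \<bar>x - real (2 * k + 1)\<bar>) = 0" by simp
    qed
    then show ?thesis by simp
  qed
qed simp

lemma faber_layer_bound:
  assumes "\<And>k. k < 2 ^ n \<Longrightarrow> \<bar>kink T f g n k\<bar> \<le> B" and "0 \<le> B"
  shows "\<bar>faber_layer T f g n t\<bar> \<le> B"
proof -
  have "\<bar>faber_layer T f g n t\<bar> \<le> (\<Sum>k<2 ^ n. \<bar>kink T f g n k * hat T n k t\<bar>)"
    unfolding faber_layer_def by (rule sum_abs)
  also have "\<dots> \<le> (\<Sum>k<2 ^ n. B * hat T n k t)"
    using assms by (intro sum_mono) (auto simp: abs_mult hat_def intro!: mult_right_mono)
  also have "\<dots> = B * (\<Sum>k<2 ^ n. hat T n k t)" by (simp add: sum_distrib_left)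
  also have "\<dots> \<le> B * 1"
    using assms(2) sum_tents_le_one unfolding hat_def by (intro mult_left_mono) auto
  finally show ?thesis by simp
qed

lemma dyadic_regular_bounded:
  assumes T: "0 < T" and "dyadic_regular T f" "dyadic_regular T g"
  obtains M r B where "0 \<le> M" "0 \<le> r" "r < 1" "0 \<le> B"
    "\<And>n k. k < 2 ^ n \<Longrightarrow> incr f (node T n k) (node T n (Suc k)) \<le> M * r ^ n"
    "\<And>n k. k < 2 ^ n \<Longrightarrow> incr g (node T n k) (node T n (Suc k)) \<le> M * r ^ n"
    "\<And>t. t \<in> {0..T} \<Longrightarrow> \<bar>f t\<bar> \<le> B" "\<And>t. t \<in> {0..T} \<Longrightarrow> \<bar>g t\<bar> \<le> B"
proof -
  obtain M1 r1 where 1: "0 \<le> M1" "0 \<le> r1" "r1 < 1" "\<And>n k. k < 2 ^ n \<Longrightarrow> incr f (node T n k) (node T n (Suc k)) \<le> M1 * r1 ^ n"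
    using assms(2) unfolding dyadic_regular_def by blast
  obtain M2 r2 where 2: "0 \<le> M2" "0 \<le> r2" "r2 < 1" "\<And>n k. k < 2 ^ n \<Longrightarrow> incr g (node T n k) (node T n (Suc k)) \<le> M2 * r2 ^ n"
    using assms(3) unfolding dyadic_regular_def by blast
  have "bounded (f ` {0..T})" "bounded (g ` {0..T})"
    using assms(2,3) unfolding dyadic_regular_def
    by (auto intro!: compact_imp_bounded compact_continuous_image)
  then obtain B1 B2 where B: "\<And>t. t \<in> {0..T} \<Longrightarrow> \<bar>f t\<bar> \<le> B1" "\<And>t. t \<in> {0..T} \<Longrightarrow> \<bar>g t\<bar> \<le> B2"
    unfolding bounded_iff by (metis imageI real_norm_def)
  have le: "M1 * r1 ^ n \<le> max M1 M2 * (max r1 r2) ^ n" "M2 * r2 ^ n \<le> max M1 M2 * (max r1 r2) ^ n" for n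
    using 1 2 by (auto intro!: mult_mono power_mono)
  show ?thesis
  proof (rule that[of "max M1 M2" "max r1 r2" "max B1 B2"])
    show "0 \<le> max B1 B2" using B(1)[of 0] T by auto
    show "incr f (node T n k) (node T n (Suc k)) \<le> max M1 M2 * max r1 r2 ^ n"
      "incr g (node T n k) (node T n (Suc k)) \<le> max M1 M2 * max r1 r2 ^ n" if "k < 2 ^ n" for n k
      using 1(4)[OF that] 2(4)[OF that] le[of n] by linarith+
    show "\<bar>f t\<bar> \<le> max B1 B2" "\<bar>g t\<bar> \<le> max B1 B2" if "t \<in> {0..T}" for t
      using B[OF that] by auto
  qed (use 1 2 in auto)
qed

text \<open>Subtracting the means of the end point values exhibits a kink as linear in the midpoint
  deviations of \<open>f\<close> and \<open>g\<close>, with bounded coefficients; the deviations are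
  controlled by the increments of the next level.\<close>

lemma kink_bound:
  assumes T: "0 < T" and "dyadic_regular T f" "dyadic_regular T g"
  obtains M r where "0 \<le> M" "0 \<le> r" "r < 1" "\<And>n k. k < 2 ^ n \<Longrightarrow> \<bar>kink T f g n k\<bar> \<le> M * r ^ n"
proof -
  obtain M r B where *: "0 \<le> M" "0 \<le> r" "r < 1" "0 \<le> B"
    and f: "\<And>n k. k < 2 ^ n \<Longrightarrow> incr f (node T n k) (node T n (Suc k)) \<le> M * r ^ n"
    and g: "\<And>n k. k < 2 ^ n \<Longrightarrow> incr g (node T n k) (node T n (Suc k)) \<le> M * r ^ n"
    and B: "\<And>t. t \<in> {0..T} \<Longrightarrow> \<bar>f t\<bar> \<le> B" "\<And>t. t \<in> {0..T} \<Longrightarrow> \<bar>g t\<bar> \<le> B"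
    using dyadic_regular_bounded[OF assms] by metis
  show ?thesis
  proof (rule that[of "M * B" r])
    fix n k :: nat assume k: "k < 2 ^ n"
    define s m t where "s = node T n k" and "m = node T (Suc n) (Suc (2 * k))" and "t = node T n (Suc k)"
    have t: "node T (Suc n) (Suc (Suc (2 * k))) = t" using node_double[of T n "Suc k"] by (simp add: t_def)
    have in_: "s \<in> {0..T}" "t \<in> {0..T}" using k node_in[OF T, of k n] node_in[OF T, of "Suc k" n] by (auto simp: s_def t_def)
    have r: "r ^ Suc n \<le> r ^ n" using * by (intro power_decreasing) auto
    have half: "\<bar>u m - (u s + u t) / 2\<bar> \<le> M * r ^ n"
      if u: "\<And>n k. k < 2 ^ n \<Longrightarrow> incr u (node T n k) (node T n (Suc k)) \<le> M * r ^ n" for u :: "real \<Rightarrow> real"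
    proof -
      have "\<bar>u s - u m\<bar> \<le> M * r ^ Suc n" "\<bar>u m - u t\<bar> \<le> M * r ^ Suc n"
        using u[of "2 * k" "Suc n"] u[of "Suc (2 * k)" "Suc n"] k by (auto simp: s_def m_def t[symmetric])
      moreover have "M * r ^ Suc n \<le> M * r ^ n" using * r by (intro mult_left_mono)
      moreover have "\<bar>u m - (u s + u t) / 2\<bar> = \<bar>(u m - u s) + (u m - u t)\<bar> / 2" by (simp add: field_simps)
      ultimately show ?thesis
        using abs_triangle_ineq[of "u m - u s" "u m - u t"] abs_minus_commute[of "u m" "u s"] by linarith
    qed
    have "kink T f g n k = ((g m - (g s + g t) / 2) * (f s + f t) - (f m - (f s + f t) / 2) * (g s + g t)) / 4"
      unfolding kink_def s_def[symmetric] m_def[symmetric] t_def[symmetric] by (simp add: field_simps)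
    also have "\<bar>\<dots>\<bar> \<le> (\<bar>(g m - (g s + g t) / 2) * (f s + f t)\<bar> + \<bar>(f m - (f s + f t) / 2) * (g s + g t)\<bar>) / 4"
      by (simp add: abs_triangle_ineq4)
    also have "\<dots> \<le> ((M * r ^ n) * (2 * B) + (M * r ^ n) * (2 * B)) / 4"
    proof -
      have "\<bar>f s + f t\<bar> \<le> 2 * B" "\<bar>g s + g t\<bar> \<le> 2 * B"
        using B(1)[OF in_(1)] B(1)[OF in_(2)] B(2)[OF in_(1)] B(2)[OF in_(2)] by linarith+
      then show ?thesis
        using half[OF f] half[OF g] * unfolding abs_mult
        by (intro divide_right_mono add_mono mult_mono) auto
    qed
    finally show "\<bar>kink T f g n k\<bar> \<le> M * B * r ^ n" by (simp add: mult_ac)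
  qed (use * in auto)
qed

lemma faber_layers:
  assumes T: "0 < T" and "dyadic_regular T f" "dyadic_regular T g"
  shows "summable (\<lambda>n. faber_layer T f g n t)"
    and "continuous_on UNIV (area_primitive T f g)"
proof -
  obtain M r where *: "0 \<le> M" "0 \<le> r" "r < 1" and kink: "\<And>n k. k < 2 ^ n \<Longrightarrow> \<bar>kink T f g n k\<bar> \<le> M * r ^ n"
    using kink_bound[OF assms] by metis
  have bound: "norm (faber_layer T f g n t) \<le> M * r ^ n" for n t
    unfolding real_norm_def using * kink by (intro faber_layer_bound) auto
  have sm: "summable (\<lambda>n. M * r ^ n)" using * by (intro summable_mult summable_geometric) auto
  show "summable (\<lambda>n. faber_layer T f g n t)"
    using bound by (intro summable_comparison_test[OF _ sm]) auto
  have lim: "uniform_limit UNIV (\<lambda>n t. \<Sum>i<n. faber_layer T f g i t) (\<lambda>t. \<Sum>i. faber_layer T f g i t) sequentially"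
    by (rule Weierstrass_m_test[OF bound sm])
  have "continuous_on UNIV (faber_layer T f g i)" for i
    unfolding faber_layer_def hat_def using T by (intro continuous_intros) auto
  then have "\<forall>\<^sub>F n in sequentially. continuous_on UNIV (\<lambda>t. \<Sum>i<n. faber_layer T f g i t)"
    by (simp add: continuous_on_sum)
  from uniform_limit_theorem[OF this lim sequentially_bot]
  have "continuous_on UNIV (\<lambda>t. \<Sum>i. faber_layer T f g i t)" .
  then show "continuous_on UNIV (area_primitive T f g)"
    unfolding area_primitive_def using T by (intro continuous_intros) auto
qed

section \<open>Values of the series at dyadic points\<close>

lemma hat_node:
  assumes T: "0 < T" and "m \<le> n"
  shows "hat T n k (node T m i) = 0"
proof -
  obtain j where n: "n = m + j" using assms(2) le_Suc_ex by blast
  define a where "a = int (2 ^ Suc j * i) - int (2 * k + 1)"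
  have "2 ^ Suc n * node T m i / T - real (2 * k + 1) = of_int a"
    using T by (simp add: node_def n power_add a_def)
  \<comment> \<open>At nodes of level at most \<open>n\<close> the scaled variable is an even
    integer, so its distance to the odd centre is at least 1.\<close>
  moreover have "odd a" by (simp add: a_def)
  then have "a \<noteq> 0" by auto
  then have "1 \<le> \<bar>real_of_int a\<bar>" by linarith
  ultimately show ?thesis by (simp add: hat_def)
qed

lemma hat_mid:
  assumes T: "0 < T"
  shows "hat T n k (node T (Suc n) (Suc (2 * i))) = (if k = i then 1 else 0)"
proof -
  have eq: "2 ^ Suc n * node T (Suc n) (Suc (2 * i)) / T = real (2 * i + 1)"
    using T by (simp add: node_def)
  show ?thesis
  proof (cases "k = i")
    case False
    then have "real k + 1 \<le> real i \<or> real i + 1 \<le> real k" by linarith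
    then show ?thesis unfolding hat_def eq using False by auto
  qed (simp only: hat_def eq, simp)
qed

lemma tent_affine:
  fixes u v :: real
  assumes "u \<le> v" and "v \<le> -1 \<or> -1 \<le> u \<and> v \<le> 0 \<or> 0 \<le> u \<and> v \<le> 1 \<or> 1 \<le> u"
  shows "max 0 (1 - \<bar>(u + v) / 2\<bar>) = (max 0 (1 - \<bar>u\<bar>) + max 0 (1 - \<bar>v\<bar>)) / 2"
  using assms by (elim disjE) (auto simp: max_def abs_if field_simps)

text \<open>A hat of a coarser layer has its kinks at nodes of level at most \<open>n\<close>, so it is affine on the
  cells of level \<open>n\<close>.\<close>

lemma hat_affine:
  assumes T: "0 < T" and "j < n"
  shows "hat T j k (node T (Suc n) (Suc (2 * i))) = (hat T j k (node T n i) + hat T j k (node T n (Suc i))) / 2"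
proof -
  obtain l where n: "n = Suc j + l" using assms(2) less_iff_Suc_add[of j n] by auto
  define c where "c = (2::int) ^ l * int (2 * k + 1)"
  have x: "2 ^ Suc j * node T n m / T - real (2 * k + 1) = of_int (int m - c) / 2 ^ l" for m
    using T by (simp add: node_def n power_add c_def field_simps)
  have y: "2 ^ Suc j * node T (Suc n) (Suc (2 * i)) / T - real (2 * k + 1)
      = (of_int (int i - c) / 2 ^ l + of_int (int (Suc i) - c) / 2 ^ l) / 2"
    unfolding x[symmetric] node_mid[of T n i] using T by (simp add: field_simps)
  define p where "p = (2::int) ^ l"
  define u where "u = int i - c"
  have p: "(2::real) ^ l = of_int p" "1 \<le> p" by (auto simp: p_def)
  have tent: "max 0 (1 - \<bar>(of_int u / of_int p + of_int (u + 1) / of_int p) / 2\<bar>)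
      = (max 0 (1 - \<bar>of_int u / of_int p\<bar>) + max 0 (1 - \<bar>of_int (u + 1) / of_int p\<bar>)) / (2 :: real)"
  proof (rule tent_affine)
    show "of_int u / of_int p \<le> (of_int (u + 1) / of_int p :: real)"
      using p(2) by (intro divide_right_mono) auto
    have "u + 1 \<le> - p \<or> - p \<le> u \<and> u + 1 \<le> 0 \<or> 0 \<le> u \<and> u + 1 \<le> p \<or> p \<le> u" by linarith
    then have "real_of_int (u + 1) \<le> - of_int p \<or> - of_int p \<le> real_of_int u \<and> real_of_int (u + 1) \<le> 0
        \<or> 0 \<le> real_of_int u \<and> real_of_int (u + 1) \<le> of_int p \<or> of_int p \<le> real_of_int u" by linarith
    then show "of_int (u + 1) / of_int p \<le> (-1 :: real) \<or> -1 \<le> (of_int u / of_int p :: real) \<and> of_int (u + 1) / of_int p \<le> (0 :: real)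
        \<or> 0 \<le> (of_int u / of_int p :: real) \<and> of_int (u + 1) / of_int p \<le> (1 :: real) \<or> 1 \<le> (of_int u / of_int p :: real)"
      using p(2) by (simp add: pos_divide_le_eq pos_le_divide_eq)
  qed
  have "int (Suc i) - c = u + 1" by (simp add: u_def)
  then show ?thesis
    unfolding hat_def x y u_def[symmetric] p(1) by (simp only: tent)
qed

context
  fixes T :: real and f g :: "real \<Rightarrow> real"
  assumes T: "0 < T" and f: "dyadic_regular T f" and g: "dyadic_regular T g"
begin

text \<open>In the second difference over a cell of level \<open>n\<close> the coarser layers
  cancel, being affine there, and the finer ones vanish at all three points; only the tent centred
  at the midpoint survives.\<close>

lemma area_primitive_mid:
  assumes k: "k < 2 ^ n"
  shows "area_primitive T f g (node T (Suc n) (Suc (2 * k))) =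
    (area_primitive T f g (node T n k) + area_primitive T f g (node T n (Suc k))) / 2 + kink T f g n k"
proof -
  let ?s = "node T n k" and ?m = "node T (Suc n) (Suc (2 * k))" and ?t = "node T n (Suc k)"
  let ?F = "faber_layer T f g"
  have layer: "?F j ?m - (?F j ?s + ?F j ?t) / 2 = (if j = n then kink T f g n k else 0)" for j
  proof -
    consider "j < n" | "j = n" | "n < j" by linarith
    then show ?thesis
    proof cases
      case 1
      then have "?F j ?m = (\<Sum>i<2 ^ j. (kink T f g j i * hat T j i ?s + kink T f g j i * hat T j i ?t) / 2)"
        unfolding faber_layer_def by (simp only: hat_affine[OF T 1] times_divide_eq_right distrib_left)
      also have "\<dots> = (?F j ?s + ?F j ?t) / 2"
        unfolding faber_layer_def by (simp only: sum.distrib sum_divide_distrib[symmetric])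
      finally show ?thesis using 1 by simp
    next
      case 2
      have "?F n ?m = (\<Sum>i<2 ^ n. if i = k then kink T f g n i else 0)"
        unfolding faber_layer_def using hat_mid[OF T] by (intro sum.cong refl) simp
      also have "\<dots> = kink T f g n k" using k by simp
      finally show ?thesis using 2 by (simp add: faber_layer_def hat_node[OF T])
    next
      case 3
      then have "?F j ?s = 0" "?F j ?m = 0" "?F j ?t = 0"
        by (simp_all add: faber_layer_def hat_node[OF T])
      then show ?thesis using 3 by simp
    qed
  qed
  have sums: "(\<lambda>j. ?F j x) sums (\<Sum>j. ?F j x)" for x
    using faber_layers(1)[OF T f g] by (rule summable_sums)
  have "(\<lambda>j. ?F j ?m - (?F j ?s + ?F j ?t) / 2) sums ((\<Sum>j. ?F j ?m) - ((\<Sum>j. ?F j ?s) + (\<Sum>j. ?F j ?t)) / 2)"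
    by (intro sums_diff sums_divide sums_add sums)
  moreover have "(\<lambda>j. if j = n then kink T f g n k else 0) sums kink T f g n k"
    using sums_single[of n "\<lambda>_. kink T f g n k"] by simp
  ultimately have "(\<Sum>j. ?F j ?m) - ((\<Sum>j. ?F j ?s) + (\<Sum>j. ?F j ?t)) / 2 = kink T f g n k"
    unfolding layer by (rule sums_unique2)
  then have eq: "(\<Sum>j. ?F j ?m) = ((\<Sum>j. ?F j ?s) + (\<Sum>j. ?F j ?t)) / 2 + kink T f g n k" by simp
  show ?thesis
    unfolding area_primitive_def eq unfolding node_mid[of T n k] using T by (simp add: field_simps)
qed

text \<open>The identity for which \<open>kink\<close> was designed: Chen's relation fixes the sum
  of the two areas, and the midpoint value of the primitive makes them equal.\<close>

lemma area_children:
  assumes k: "k < 2 ^ n"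
  defines "s \<equiv> node T n k" and "m \<equiv> node T (Suc n) (Suc (2 * k))" and "t \<equiv> node T n (Suc k)"
  shows "area T f g s m = (area T f g s t - ((f m - f s) * (g t - g m) - (g m - g s) * (f t - f m)) / 2) / 2"
    and "area T f g m t = area T f g s m"
  using area_primitive_mid[OF k]
  unfolding area_def kink_def s_def[symmetric] m_def[symmetric] t_def[symmetric]
  by (simp_all add: field_simps)

lemma area_total: "area T f g 0 T = 0"
proof -
  have "faber_layer T f g n 0 = 0" "faber_layer T f g n T = 0" for n
    using hat_node[OF T, of 0 n _ 0] hat_node[OF T, of 0 n _ 1] by (simp_all add: faber_layer_def node_def)
  then show ?thesis using T by (simp add: area_def area_primitive_def)
qed

lemma area_continuous:
  assumes "s \<in> {0..T}"
  shows "continuous_on {0..T} (area T f g s)"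
proof -
  have "continuous_on {0..T} f" "continuous_on {0..T} g" using f g by (auto simp: dyadic_regular_def)
  then show ?thesis unfolding area_def
    using continuous_on_subset[OF faber_layers(2)[OF T f g]] by (intro continuous_intros) auto
qed

end

section \<open>Algebra of the area\<close>

lemma area_refl [simp]: "area T f g s s = 0"
  by (simp add: area_def)

lemma area_flip: "area T f g t s = - area T f g s t"
  by (simp add: area_def diff_divide_distrib mult.commute)

text \<open>The primitive telescopes, so its values are irrelevant here; what remains is the
  determinant of the two successive increments.\<close>

lemma area_chen:
  "area T f g s u = area T f g s t + area T f g t u
    + ((f t - f s) * (g u - g t) - (g t - g s) * (f u - f t)) / 2"
  by (simp add: area_def field_simps)

lemma faber_layer_swap: "faber_layer T g f n t = - faber_layer T f g n t"
  by (simp add: faber_layer_def kink_def sum_negf[symmetric] minus_divide_left flip: mult_minus_left)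

lemma area_primitive_swap:
  assumes "0 < T" "dyadic_regular T f" "dyadic_regular T g"
  shows "area_primitive T g f t = - area_primitive T f g t"
  using suminf_minus[OF faber_layers(1)[OF assms, of t]]
  by (simp add: area_primitive_def faber_layer_swap[of T g f] minus_divide_left flip: mult_minus_left)

lemma area_swap:
  assumes "0 < T" "dyadic_regular T f" "dyadic_regular T g"
  shows "area T g f s t = - area T f g s t"
  by (simp add: area_def area_primitive_swap[OF assms] field_simps)

lemma faber_layer_linear:
  "faber_layer T (\<lambda>t. a * f t + b * f' t) g n t = a * faber_layer T f g n t + b * faber_layer T f' g n t"
  unfolding faber_layer_def sum_distrib_left sum.distrib[symmetric]
  by (intro sum.cong refl) (simp add: kink_def field_simps)

text \<open>Linearity in the first argument suffices, since \<open>area_swap\<close> transfers it to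
  the second. Regularity serves to add the infinite series termwise.\<close>

lemma area_linear:
  assumes T: "0 < T" and "dyadic_regular T f" "dyadic_regular T f'" "dyadic_regular T g"
  shows "area T (\<lambda>t. a * f t + b * f' t) g s t = a * area T f g s t + b * area T f' g s t"
proof -
  note sm = faber_layers(1)[OF T assms(2,4)] faber_layers(1)[OF T assms(3,4)]
  have "area_primitive T (\<lambda>t. a * f t + b * f' t) g u = a * area_primitive T f g u + b * area_primitive T f' g u" for u
    unfolding area_primitive_def faber_layer_linear
      suminf_add[OF summable_mult[OF sm(1)] summable_mult[OF sm(2)], symmetric]
      suminf_mult[OF sm(1)] suminf_mult[OF sm(2)]
    by (simp add: add_divide_distrib diff_divide_distrib ring_distribs mult_ac)
  then show ?thesis by (simp add: area_def field_simps)
qed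

text \<open>The homogeneous distance of the lifted paths: by Chen's relation it satisfies the
  triangle inequality.\<close>

definition area_dist :: "real \<Rightarrow> (real \<Rightarrow> real) \<Rightarrow> (real \<Rightarrow> real) \<Rightarrow> real \<Rightarrow> real \<Rightarrow> real" where
  "area_dist T f g s t = max \<bar>f s - f t\<bar> (max \<bar>g s - g t\<bar> (sqrt \<bar>area T f g s t\<bar>))"

lemma area_dist_ge:
  "\<bar>f s - f t\<bar> \<le> area_dist T f g s t" "\<bar>g s - g t\<bar> \<le> area_dist T f g s t"
  "sqrt \<bar>area T f g s t\<bar> \<le> area_dist T f g s t" "0 \<le> area_dist T f g s t"
  by (auto simp: area_dist_def)

lemma area_le_dist: "\<bar>area T f g s t\<bar> \<le> (area_dist T f g s t)\<^sup>2"
  using area_dist_ge(3)[of T f g s t] by (metis abs_ge_zero real_sqrt_le_iff real_sqrt_ge_zero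
      power_mono real_sqrt_pow2)

text \<open>The increments of \<open>f\<close> and \<open>g\<close> belong to the maximum so that
  the determinant term in Chen's relation is at most \<open>?a * ?b\<close>; then
  \<open>?a\<^sup>2 + ?b\<^sup>2 + ?a * ?b\<close> stays below the square of the sum.\<close>

lemma area_dist_triangle: "area_dist T f g s u \<le> area_dist T f g s t + area_dist T f g t u"
proof -
  let ?a = "area_dist T f g s t" and ?b = "area_dist T f g t u"
  have nn: "0 \<le> ?a" "0 \<le> ?b" by (rule area_dist_ge(4))+
  have "\<bar>area T f g s u\<bar> \<le> \<bar>area T f g s t\<bar> + \<bar>area T f g t u\<bar>
      + (\<bar>f t - f s\<bar> * \<bar>g u - g t\<bar> + \<bar>g t - g s\<bar> * \<bar>f u - f t\<bar>) / 2"
  proof -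
    have "\<bar>a + b + (x - y) / 2\<bar> \<le> \<bar>a\<bar> + \<bar>b\<bar> + (\<bar>x\<bar> + \<bar>y\<bar>) / 2" for a b x y :: real
    proof -
      have "\<bar>(x - y) / 2\<bar> \<le> (\<bar>x\<bar> + \<bar>y\<bar>) / 2" by (simp add: abs_triangle_ineq4)
      then show ?thesis
        by (intro order_trans[OF abs_triangle_ineq] add_mono abs_triangle_ineq)
    qed
    then show ?thesis unfolding area_chen[of T f g s u t] abs_mult[symmetric] .
  qed
  also have "\<dots> \<le> ?a\<^sup>2 + ?b\<^sup>2 + (?a * ?b + ?a * ?b) / 2"
    using area_dist_ge(1)[of f s t T g] area_dist_ge(2)[of g s t T f] nn
      area_dist_ge(1)[of f t u T g] area_dist_ge(2)[of g t u T f]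
    by (intro add_mono area_le_dist divide_right_mono mult_mono) (auto simp: abs_minus_commute)
  also have "\<dots> \<le> (?a + ?b)\<^sup>2" using nn by (simp add: power2_sum)
  finally have "sqrt \<bar>area T f g s u\<bar> \<le> ?a + ?b" using nn by (intro real_le_lsqrt) auto
  moreover have "\<bar>f s - f u\<bar> \<le> ?a + ?b" "\<bar>g s - g u\<bar> \<le> ?a + ?b"
    using abs_triangle_ineq[of "f s - f t" "f t - f u"] abs_triangle_ineq[of "g s - g t" "g t - g u"]
      add_mono[OF area_dist_ge(1)[of f s t T g] area_dist_ge(1)[of f t u T g]]
      add_mono[OF area_dist_ge(2)[of g s t T f] area_dist_ge(2)[of g t u T f]] by simp_all
  ultimately show ?thesis unfolding area_dist_def[of T f g s u] by (intro max.boundedI)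
qed

lemma area_dist_pseudometric:
  assumes T: "0 < T" and f: "dyadic_regular T f" and g: "dyadic_regular T g"
  shows "path_pseudometric T (area_dist T f g)"
proof
  show "0 < T" by (rule T)
  show "area_dist T f g s s = 0" for s by (simp add: area_dist_def)
  show "area_dist T f g s t = area_dist T f g t s" for s t
    by (simp add: area_dist_def area_flip[of T f g t s] abs_minus_commute)
  show "area_dist T f g s u \<le> area_dist T f g s t + area_dist T f g t u" for s t u
    by (rule area_dist_triangle)
  fix s assume s: "s \<in> {0..T}"
  have "continuous_on {0..T} f" "continuous_on {0..T} g" using f g by (auto simp: dyadic_regular_def)
  then have "continuous_on {0..T} (area_dist T f g s)"
    unfolding area_dist_def using area_continuous[OF T f g s] by (intro continuous_intros)
  with s have "(area_dist T f g s \<longlongrightarrow> area_dist T f g s s) (at s within {0..T})"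
    by (simp add: continuous_on_def)
  then show "(area_dist T f g s \<longlongrightarrow> 0) (at s within {0..T})" by (simp add: area_dist_def)
qed

lemma area_dist_continuous:
  assumes T: "0 < T" and f: "dyadic_regular T f" and g: "dyadic_regular T g"
  shows "continuous_on ({0..T} \<times> {0..T}) (\<lambda>(s, t). area_dist T f g s t)"
proof -
  have c: "continuous_on {0..T} f" "continuous_on {0..T} g" using f g by (auto simp: dyadic_regular_def)
  have k: "continuous_on {0..T} (area_primitive T f g)"
    using continuous_on_subset[OF faber_layers(2)[OF T f g]] by auto
  note comp = continuous_on_compose2[OF c(1)] continuous_on_compose2[OF c(2)] continuous_on_compose2[OF k]
  show ?thesis
    unfolding area_dist_def area_def split_def by (intro continuous_intros comp) auto
qed

section \<open>Energy of the area along the bisection\<close>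

lemma weighted_powr_add_le:
  fixes u v e q :: real
  assumes "0 \<le> u" "0 \<le> v" "0 < e" "0 \<le> q"
  shows "(u + v) powr q \<le> (1 + e) powr q * u powr q + (1 + 1 / e) powr q * v powr q"
\<comment> \<open>Splitting at \<open>v = e * u\<close> keeps the factor of \<open>u powr q\<close>
  as close to 1 as desired, which the crude \<open>powr_add_le\<close> does not; the contraction of
  the areas survives only with such a factor.\<close>
proof (cases "v \<le> e * u")
  case True
  then have "(u + v) powr q \<le> ((1 + e) * u) powr q"
    using assms by (intro powr_mono2) (auto simp: algebra_simps)
  then show ?thesis using assms by (simp add: powr_mult add_increasing2)
next
  case False
  then have "u \<le> 1 / e * v" using assms by (simp add: field_simps)
  then have "(u + v) powr q \<le> ((1 + 1 / e) * v) powr q"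
    using assms by (intro powr_mono2) (auto simp: algebra_simps)
  also have "\<dots> = (1 + 1 / e) powr q * v powr q" using assms by (intro powr_mult)
  finally show ?thesis by (simp add: add_increasing)
qed

lemma sum_double:
  fixes \<phi> :: "nat \<Rightarrow> real"
  shows "(\<Sum>i<2 * N. \<phi> i) = (\<Sum>k<N. \<phi> (2 * k) + \<phi> (Suc (2 * k)))"
  by (induction N) (auto simp: algebra_simps)

context
  fixes T :: real and f g :: "real \<Rightarrow> real"
  assumes T: "0 < T" and f: "dyadic_regular T f" and g: "dyadic_regular T g"
begin

abbreviation (input) "df n k \<equiv> incr f (node T n k) (node T n (Suc k))"
abbreviation (input) "dg n k \<equiv> incr g (node T n k) (node T n (Suc k))"
abbreviation (input) "da n k \<equiv> \<bar>area T f g (node T n k) (node T n (Suc k))\<bar>"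

lemma area_child_bound:
  assumes k: "k < 2 ^ n" and i: "i = 2 * k \<or> i = Suc (2 * k)"
  shows "da (Suc n) i \<le> da n k / 2
    + (df (Suc n) (2 * k) * dg (Suc n) (Suc (2 * k)) + dg (Suc n) (2 * k) * df (Suc n) (Suc (2 * k))) / 4"
proof -
  define s m t where "s = node T n k" and "m = node T (Suc n) (Suc (2 * k))" and "t = node T n (Suc k)"
  have nodes: "node T (Suc n) (2 * k) = s" "node T (Suc n) (Suc (Suc (2 * k))) = t"
    using node_double[of T n k] node_double[of T n "Suc k"] by (simp_all add: s_def t_def)
  let ?c = "(f m - f s) * (g t - g m)" and ?d = "(g m - g s) * (f t - f m)"
  have child: "area T f g s m = (area T f g s t - (?c - ?d) / 2) / 2" "area T f g m t = area T f g s m"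
    unfolding s_def m_def t_def using area_children[OF T f g k] by auto
  have "\<bar>area T f g s m\<bar> \<le> \<bar>area T f g s t\<bar> / 2 + (\<bar>?c\<bar> + \<bar>?d\<bar>) / 4"
  proof -
    have "\<bar>area T f g s t - (?c - ?d) / 2\<bar> \<le> \<bar>area T f g s t\<bar> + \<bar>(?c - ?d) / 2\<bar>" by (rule abs_triangle_ineq4)
    also have "\<bar>(?c - ?d) / 2\<bar> \<le> (\<bar>?c\<bar> + \<bar>?d\<bar>) / 2" by (simp add: abs_triangle_ineq4)
    finally show ?thesis unfolding child(1) by (simp add: add_divide_distrib)
  qed
  moreover have "\<bar>?c\<bar> = \<bar>f s - f m\<bar> * \<bar>g m - g t\<bar>" "\<bar>?d\<bar> = \<bar>g s - g m\<bar> * \<bar>f m - f t\<bar>"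
    unfolding abs_mult by (simp_all only: abs_minus_commute)
  ultimately have "\<bar>area T f g s m\<bar> \<le> \<bar>area T f g s t\<bar> / 2 + (\<bar>f s - f m\<bar> * \<bar>g m - g t\<bar> + \<bar>g s - g m\<bar> * \<bar>f m - f t\<bar>) / 4"
    by (simp only:)
  with i child(2) show ?thesis
    by (elim disjE) (simp_all only: nodes s_def[symmetric] m_def[symmetric] t_def[symmetric])
qed

text \<open>Areas carry half the exponent of increments: the cross terms are products of two
  increments, bounded by the square of the largest of the four.\<close>

lemma area_child_powr:
  assumes k: "k < 2 ^ n" and i: "i = 2 * k \<or> i = Suc (2 * k)" and e: "0 < e" and P: "0 < P"
  shows "da (Suc n) i powr (P / 2) \<le> (1 + e) powr (P / 2) * (1 / 2) powr (P / 2) * da n k powr (P / 2)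
    + (1 + 1 / e) powr (P / 2) * (df (Suc n) (2 * k) powr P + df (Suc n) (Suc (2 * k)) powr P
       + dg (Suc n) (2 * k) powr P + dg (Suc n) (Suc (2 * k)) powr P)"
proof -
  let ?y = "(df (Suc n) (2 * k) * dg (Suc n) (Suc (2 * k)) + dg (Suc n) (2 * k) * df (Suc n) (Suc (2 * k))) / 4"
  define M where "M = Max {df (Suc n) (2 * k), df (Suc n) (Suc (2 * k)), dg (Suc n) (2 * k), dg (Suc n) (Suc (2 * k))}"
  have M: "df (Suc n) (2 * k) \<le> M" "df (Suc n) (Suc (2 * k)) \<le> M" "dg (Suc n) (2 * k) \<le> M" "dg (Suc n) (Suc (2 * k)) \<le> M"
    unfolding M_def by (rule Max_ge; simp)+
  have M0: "0 \<le> M" using M(1) by (rule order_trans[rotated]) simp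
  have "M \<in> {df (Suc n) (2 * k), df (Suc n) (Suc (2 * k)), dg (Suc n) (2 * k), dg (Suc n) (Suc (2 * k))}"
    unfolding M_def by (rule Max_in) auto
  then have MP: "M powr P \<le> df (Suc n) (2 * k) powr P + df (Suc n) (Suc (2 * k)) powr P
       + dg (Suc n) (2 * k) powr P + dg (Suc n) (Suc (2 * k)) powr P"
    by (auto intro: add_increasing add_increasing2)
  have "?y \<le> (M * M + M * M) / 4"
    using M M0 by (intro divide_right_mono add_mono mult_mono) auto
  also have "\<dots> \<le> M\<^sup>2" by (simp add: power2_eq_square)
  finally have y: "?y \<le> M\<^sup>2" .
  have y0: "0 \<le> ?y" by simp
  have "da (Suc n) i powr (P / 2) \<le> (da n k / 2 + ?y) powr (P / 2)"
    using area_child_bound[OF k i] P by (intro powr_mono2) auto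
  also have "\<dots> \<le> (1 + e) powr (P / 2) * (da n k / 2) powr (P / 2) + (1 + 1 / e) powr (P / 2) * ?y powr (P / 2)"
    using e P y0 by (intro weighted_powr_add_le) auto
  also have "(da n k / 2) powr (P / 2) = (1 / 2) powr (P / 2) * da n k powr (P / 2)"
    using powr_mult[of "1 / 2" "da n k" "P / 2"] by simp
  also have "?y powr (P / 2) \<le> (M\<^sup>2) powr (P / 2)" using y y0 P by (intro powr_mono2) auto
  also have "(M\<^sup>2) powr (P / 2) = M powr P"
    using M0 by (cases "M = 0") (simp_all add: powr_powr flip: powr_numeral)
  also note MP
  finally show ?thesis by (simp add: mult.assoc mult_left_mono)
qed

text \<open>Both children of a cell obey the same bound, whence the factor 2; in the recursion it
  cancels against the 2 in the level weight \<open>2 powr (\<alpha> * P) / 2\<close>.\<close>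

lemma area_energy_step:
  assumes e: "0 < e" and P: "0 < P"
  shows "(\<Sum>k<2 ^ Suc n. da (Suc n) k powr (P / 2)) \<le>
    2 * ((1 + e) powr (P / 2) * (1 / 2) powr (P / 2)) * (\<Sum>k<2 ^ n. da n k powr (P / 2))
    + 2 * (1 + 1 / e) powr (P / 2) * ((\<Sum>k<2 ^ Suc n. df (Suc n) k powr P) + (\<Sum>k<2 ^ Suc n. dg (Suc n) k powr P))"
proof -
  let ?c = "(1 + e) powr (P / 2) * (1 / 2) powr (P / 2)" and ?b = "(1 + 1 / e) powr (P / 2)"
  let ?z = "\<lambda>k. df (Suc n) (2 * k) powr P + df (Suc n) (Suc (2 * k)) powr P
       + dg (Suc n) (2 * k) powr P + dg (Suc n) (Suc (2 * k)) powr P"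
  have "(\<Sum>k<2 ^ Suc n. da (Suc n) k powr (P / 2))
      = (\<Sum>k<2 ^ n. da (Suc n) (2 * k) powr (P / 2) + da (Suc n) (Suc (2 * k)) powr (P / 2))"
    unfolding power_Suc by (rule sum_double)
  also have "\<dots> \<le> (\<Sum>k<2 ^ n. (?c * da n k powr (P / 2) + ?b * ?z k) + (?c * da n k powr (P / 2) + ?b * ?z k))"
    using e P by (intro sum_mono add_mono area_child_powr) auto
  also have "\<dots> = 2 * ?c * (\<Sum>k<2 ^ n. da n k powr (P / 2)) + 2 * ?b * (\<Sum>k<2 ^ n. ?z k)"
    by (simp add: sum_distrib_left sum.distrib algebra_simps)
  also have "(\<Sum>k<2 ^ n. ?z k) = (\<Sum>k<2 ^ Suc n. df (Suc n) k powr P) + (\<Sum>k<2 ^ Suc n. dg (Suc n) k powr P)"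
    unfolding power_Suc sum_double by (simp add: sum.distrib algebra_simps)
  finally show ?thesis .
qed

end

text \<open>Moves to real partial sums, where the recursion for the areas can be rearranged by
  subtraction.\<close>

lemma dyadic_energy_partial_sums:
  assumes "\<And>n k. k < 2 ^ n \<Longrightarrow> 0 \<le> d (node T n k) (node T n (Suc k))" and "0 \<le> R"
  shows "dyadic_energy \<alpha> P T d \<le> ennreal R \<longleftrightarrow>
    (\<forall>N. (\<Sum>n<N. (2 powr (\<alpha> * P) / 2) ^ n * (\<Sum>k<2 ^ n. d (node T n k) (node T n (Suc k)) powr P)) \<le> R)"
proof -
  let ?r = "\<lambda>n. (2 powr (\<alpha> * P) / 2) ^ n * (\<Sum>k<2 ^ n. d (node T n k) (node T n (Suc k)) powr P)"
  let ?e = "\<lambda>n. ennreal ((2 powr (\<alpha> * P) / 2) ^ n) * (\<Sum>k<2 ^ n. ennreal (d (node T n k) (node T n (Suc k)) powr P))"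
  have r0: "0 \<le> ?r n" for n by (intro mult_nonneg_nonneg sum_nonneg) auto
  have "?e n = ennreal (?r n)" for n
    by (subst ennreal_mult) (auto intro!: sum_nonneg)
  then have part: "(\<Sum>n<N. ?e n) = ennreal (\<Sum>n<N. ?r n)" for N
    using r0 by (simp only: sum_ennreal)
  show ?thesis
  proof
    assume le: "dyadic_energy \<alpha> P T d \<le> ennreal R"
    show "\<forall>N. (\<Sum>n<N. ?r n) \<le> R"
    proof
      fix N
      have "(\<Sum>n<N. ?e n) \<le> dyadic_energy \<alpha> P T d"
        unfolding dyadic_energy_def by (intro sum_le_suminf summableI) auto
      with le have "ennreal (\<Sum>n<N. ?r n) \<le> ennreal R" unfolding part by (rule order_trans[rotated])
      then show "(\<Sum>n<N. ?r n) \<le> R" using assms(2) by (simp add: ennreal_le_iff)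
    qed
  next
    assume "\<forall>N. (\<Sum>n<N. ?r n) \<le> R"
    then have "(\<Sum>n<N. ?e n) \<le> ennreal R" for N unfolding part by (simp add: ennreal_leI)
    then show "dyadic_energy \<alpha> P T d \<le> ennreal R"
      unfolding dyadic_energy_def by (intro suminf_le_const summableI)
  qed
qed

lemma area_dist_energy:
  assumes T: "0 < T" and \<alpha>: "\<alpha> < 1 / 2" and P: "0 < P"
  shows "\<exists>C\<ge>0. \<forall>R\<ge>0. \<forall>f g. dyadic_regular T f \<longrightarrow> dyadic_regular T g \<longrightarrow>
    dyadic_energy \<alpha> P T (incr f) \<le> ennreal R \<longrightarrow> dyadic_energy \<alpha> P T (incr g) \<le> ennreal R \<longrightarrow>
    dyadic_energy \<alpha> P T (area_dist T f g) \<le> ennreal (C * R)"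
proof -
  define A where "A = 2 powr (\<alpha> * P)"
  \<comment> \<open>Half of the gap in the exponent is given to \<open>1 + e\<close>. The
    contraction factor \<theta> of the weighted areas per level then equals 2 to the power -P(1 -
    2\<alpha>)/4.\<close>
  define e where "e = 2 powr ((1 - 2 * \<alpha>) / 2) - 1"
  have e: "0 < e" using \<alpha> by (simp add: e_def)
  define \<theta> where "\<theta> = A * ((1 + e) powr (P / 2) * (1 / 2) powr (P / 2))"
  have "\<theta> = 2 powr (- (P * (1 - 2 * \<alpha>) / 4))"
  proof -
    have "(1 / 2) powr (P / 2) = 2 powr (- (P / 2))" by (simp add: powr_minus powr_divide inverse_eq_divide)
    then have "\<theta> = 2 powr (\<alpha> * P + ((1 - 2 * \<alpha>) / 2 * (P / 2) + - (P / 2)))"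
      by (simp only: powr_add \<theta>_def A_def e_def) (simp add: powr_powr)
    also have "\<alpha> * P + ((1 - 2 * \<alpha>) / 2 * (P / 2) + - (P / 2)) = - (P * (1 - 2 * \<alpha>) / 4)" by (simp add: field_simps)
    finally show ?thesis .
  qed
  then have \<theta>: "0 \<le> \<theta>" "\<theta> < 1" using P \<alpha> by (auto simp: mult_pos_pos powr_less_one)
  define b where "b = 2 * (1 + 1 / e) powr (P / 2)"
  have b: "0 \<le> b" by (simp add: b_def)
  \<comment> \<open>One \<open>R\<close> each for \<open>f\<close> and \<open>g\<close>, and
    \<open>2 * b / (1 - \<theta>)\<close> from summing the recursion for the areas.\<close>
  define C where "C = 2 + 2 * b / (1 - \<theta>)"
  have C: "0 \<le> C" using b \<theta> by (simp add: C_def)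
  show ?thesis
  proof (intro exI[of _ C] conjI allI impI C)
    fix R :: real and f g assume R: "0 \<le> R" and fg: "dyadic_regular T f" "dyadic_regular T g"
      and Rf: "dyadic_energy \<alpha> P T (incr f) \<le> ennreal R"
      and Rg: "dyadic_energy \<alpha> P T (incr g) \<le> ennreal R"
    define F where "F = (\<lambda>n. (A / 2) ^ n * (\<Sum>k<2 ^ n. incr f (node T n k) (node T n (Suc k)) powr P))"
    define G where "G = (\<lambda>n. (A / 2) ^ n * (\<Sum>k<2 ^ n. incr g (node T n k) (node T n (Suc k)) powr P))"
    define S where "S = (\<lambda>n. (A / 2) ^ n * (\<Sum>k<2 ^ n. \<bar>area T f g (node T n k) (node T n (Suc k))\<bar> powr (P / 2)))"
    have A: "0 < A" by (simp add: A_def)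
    have nn: "0 \<le> F n" "0 \<le> G n" "0 \<le> S n" for n
      using A by (auto simp: F_def G_def S_def intro!: mult_nonneg_nonneg sum_nonneg)
    have FR: "(\<Sum>n<N. F n) \<le> R" and GR: "(\<Sum>n<N. G n) \<le> R" for N
      using Rf Rg R by (simp_all add: dyadic_energy_partial_sums F_def G_def A_def)
    have S0: "S 0 = 0" using area_total[OF T fg] node_last[of T 0] by (simp add: S_def)
    have step: "S (Suc n) \<le> \<theta> * S n + b * (F (Suc n) + G (Suc n))" for n
    proof -
      have "S (Suc n) \<le> (A / 2) ^ Suc n * (2 * ((1 + e) powr (P / 2) * (1 / 2) powr (P / 2))
            * (\<Sum>k<2 ^ n. \<bar>area T f g (node T n k) (node T n (Suc k))\<bar> powr (P / 2))
          + b * ((\<Sum>k<2 ^ Suc n. \<bar>f (node T (Suc n) k) - f (node T (Suc n) (Suc k))\<bar> powr P)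
            + (\<Sum>k<2 ^ Suc n. \<bar>g (node T (Suc n) k) - g (node T (Suc n) (Suc k))\<bar> powr P)))"
        unfolding S_def b_def using A by (intro mult_left_mono area_energy_step[OF T fg e P]) auto
      also have "\<dots> = \<theta> * S n + b * (F (Suc n) + G (Suc n))"
        by (simp add: \<theta>_def S_def F_def G_def algebra_simps)
      finally show ?thesis .
    qed
    \<comment> \<open>Summing the recursion, which starts at \<open>S 0 = 0\<close>, bounds a
      partial sum by \<theta> times itself plus the increments; being finite, it can be absorbed on
      the left.\<close>
    have SR: "(\<Sum>n<N. S n) \<le> 2 * b * R / (1 - \<theta>)" for N
    proof -
      have "(\<Sum>n<Suc N. S n) = (\<Sum>n<N. S (Suc n))" by (simp only: sum.lessThan_Suc_shift S0 add_0)
      also have "\<dots> \<le> (\<Sum>n<N. \<theta> * S n + b * (F (Suc n) + G (Suc n)))" by (intro sum_mono step)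
      also have "\<dots> = \<theta> * (\<Sum>n<N. S n) + b * ((\<Sum>n<N. F (Suc n)) + (\<Sum>n<N. G (Suc n)))"
        by (simp add: sum.distrib sum_distrib_left distrib_left)
      also have "\<dots> \<le> \<theta> * (\<Sum>n<N. S n) + b * (R + R)"
      proof -
        have "(\<Sum>n<N. F (Suc n)) \<le> (\<Sum>n<Suc N. F n)" "(\<Sum>n<N. G (Suc n)) \<le> (\<Sum>n<Suc N. G n)"
          using nn(1)[of 0] nn(2)[of 0] by (simp_all only: sum.lessThan_Suc_shift)
        then show ?thesis using FR[of "Suc N"] GR[of "Suc N"] b by (intro add_left_mono mult_left_mono add_mono) linarith+
      qed
      finally have "(\<Sum>n<Suc N. S n) \<le> \<theta> * (\<Sum>n<N. S n) + 2 * b * R" by simp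
      moreover have "(\<Sum>n<N. S n) \<le> (\<Sum>n<Suc N. S n)" using nn(3) by simp
      ultimately have "(\<Sum>n<N. S n) * (1 - \<theta>) \<le> 2 * b * R" by (simp add: algebra_simps)
      then show ?thesis using \<theta> by (simp add: pos_le_divide_eq)
    qed
    show "dyadic_energy \<alpha> P T (area_dist T f g) \<le> ennreal (C * R)"
    proof (subst dyadic_energy_partial_sums)
      show "\<forall>N. (\<Sum>n<N. (2 powr (\<alpha> * P) / 2) ^ n *
          (\<Sum>k<2 ^ n. area_dist T f g (node T n k) (node T n (Suc k)) powr P)) \<le> C * R"
      proof
        fix N
        have pw: "area_dist T f g s t powr P \<le> \<bar>f s - f t\<bar> powr P + \<bar>g s - g t\<bar> powr P + \<bar>area T f g s t\<bar> powr (P / 2)" for s t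
        proof -
          have "sqrt \<bar>area T f g s t\<bar> powr P = \<bar>area T f g s t\<bar> powr (P / 2)"
            by (simp add: powr_half_sqrt[symmetric] powr_powr)
          then show ?thesis by (auto simp: area_dist_def max_def intro: add_increasing add_increasing2)
        qed
        have "(\<Sum>n<N. (2 powr (\<alpha> * P) / 2) ^ n * (\<Sum>k<2 ^ n. area_dist T f g (node T n k) (node T n (Suc k)) powr P))
          \<le> (\<Sum>n<N. (A / 2) ^ n * (\<Sum>k<2 ^ n. incr f (node T n k) (node T n (Suc k)) powr P
              + incr g (node T n k) (node T n (Suc k)) powr P + \<bar>area T f g (node T n k) (node T n (Suc k))\<bar> powr (P / 2)))"
          unfolding A_def by (intro sum_mono mult_left_mono pw) auto
        also have "\<dots> = (\<Sum>n<N. F n) + (\<Sum>n<N. G n) + (\<Sum>n<N. S n)"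
          by (simp add: F_def G_def S_def sum.distrib distrib_left)
        also have "\<dots> \<le> R + R + 2 * b * R / (1 - \<theta>)" by (intro add_mono FR GR SR)
        also have "\<dots> = C * R" by (simp add: C_def algebra_simps)
        finally show "(\<Sum>n<N. (2 powr (\<alpha> * P) / 2) ^ n *
          (\<Sum>k<2 ^ n. area_dist T f g (node T n k) (node T n (Suc k)) powr P)) \<le> C * R" .
      qed
    qed (use C R area_dist_ge(4) in auto)
  qed
qed

text \<open>A single increment is one term of the energy, and its weight \<open>a ^ n\<close> grows
  geometrically because \<open>\<alpha> * P > 1\<close>.\<close>

lemma dyadic_regular_of_energy:
  assumes f: "continuous_on {0..T} f" and \<alpha>P: "1 < \<alpha> * P" and P: "0 < P" and R: "0 \<le> R"
    and energy: "dyadic_energy \<alpha> P T (incr f) \<le> ennreal R"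
  shows "dyadic_regular T f"
proof -
  define a where "a = 2 powr (\<alpha> * P) / 2"
  have a: "1 < a" using powr_less_mono[of 1 "\<alpha> * P" 2] \<alpha>P by (simp add: a_def)
  define r where "r = (1 / a) powr (1 / P)"
  have r: "0 \<le> r" "r < 1" using a P powr_less_mono2[of "1 / P" "1 / a" 1] by (auto simp: r_def)
  have "incr f (node T n k) (node T n (Suc k)) \<le> R powr (1 / P) * r ^ n" if k: "k < 2 ^ n" for n k
  proof -
    let ?x = "\<lambda>n k. incr f (node T n k) (node T n (Suc k))"
    have "?x n k powr P \<le> (\<Sum>k<2 ^ n. ?x n k powr P)"
      using k by (intro member_le_sum) auto
    then have "a ^ n * ?x n k powr P \<le> a ^ n * (\<Sum>k<2 ^ n. ?x n k powr P)"
      using a by (intro mult_left_mono) auto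
    also have "\<dots> \<le> (\<Sum>n<Suc n. a ^ n * (\<Sum>k<2 ^ n. ?x n k powr P))"
      using a by (intro member_le_sum mult_nonneg_nonneg sum_nonneg) auto
    also have "\<dots> \<le> R"
      using energy R by (simp add: dyadic_energy_partial_sums a_def del: sum.lessThan_Suc)
    finally have "?x n k powr P \<le> R * (1 / a) ^ n" using a by (simp add: field_simps)
    then have "(?x n k powr P) powr (1 / P) \<le> (R * (1 / a) ^ n) powr (1 / P)"
      using P by (intro powr_mono2) auto
    also have "\<dots> = R powr (1 / P) * r ^ n"
      using R a by (simp add: powr_mult r_def powr_power powr_realpow[symmetric] powr_powr mult.commute)
    finally show ?thesis using P by (simp add: powr_powr)
  qed
  then show ?thesis unfolding dyadic_regular_def using f r by (intro conjI exI[of _ "R powr (1 / P)"] exI[of _ r]) auto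
qed

section \<open>Gagliardo seminorms\<close>

lemma ennreal_powr_le_iff:
  assumes "0 < r" "0 \<le> R"
  shows "ennreal_powr I r \<le> ennreal R \<longleftrightarrow> I \<le> ennreal (R powr (1 / r))"
proof (cases "I = \<infinity>")
  case True then show ?thesis by (simp add: ennreal_powr_def top_unique)
next
  case False
  then obtain x where x: "I = ennreal x" "0 \<le> x" by (cases I) auto
  have "x powr r \<le> R \<longleftrightarrow> x \<le> R powr (1 / r)"
  proof
    assume "x powr r \<le> R"
    then have "(x powr r) powr (1 / r) \<le> R powr (1 / r)" using assms by (intro powr_mono2) auto
    then show "x \<le> R powr (1 / r)" using x assms by (simp add: powr_powr)
  next
    assume "x \<le> R powr (1 / r)"
    then have "x powr r \<le> (R powr (1 / r)) powr r" using assms x by (intro powr_mono2) auto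
    then show "x powr r \<le> R" using assms by (simp add: powr_powr)
  qed
  then show ?thesis using x assms by (simp add: ennreal_powr_def ennreal_le_iff)
qed

lemma gagliardo_infinity_le_iff:
  assumes "0 \<le> R"
  shows "gagliardo k \<alpha> \<infinity> T D \<le> ennreal R \<longleftrightarrow>
    (\<forall>s\<in>{0..T}. \<forall>t\<in>{0..T}. s \<noteq> t \<longrightarrow> D s t \<le> R * \<bar>t - s\<bar> powr (real k * \<alpha>))"
proof -
  have "D s t / \<bar>t - s\<bar> powr (real k * \<alpha>) \<le> R \<longleftrightarrow> D s t \<le> R * \<bar>t - s\<bar> powr (real k * \<alpha>)" if "s \<noteq> t" for s t
    using that by (intro pos_divide_le_eq) simp
  then show ?thesis
    using assms by (auto simp: gagliardo_def SUP_le_iff ennreal_le_iff)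
qed

lemma gagliardo_finite_le_iff:
  assumes "0 < P" "0 < k" "0 \<le> R"
  shows "gagliardo k \<alpha> (ereal P) T D \<le> ennreal R \<longleftrightarrow>
    (\<integral>\<^sup>+ t\<in>{0..T}. (\<integral>\<^sup>+ s\<in>{0..T}. ennreal (D s t powr (P / real k) / \<bar>t - s\<bar> powr (\<alpha> * P + 1)) \<partial>lborel) \<partial>lborel)
      \<le> ennreal (R powr (P / real k))"
  using assms by (simp add: gagliardo_def Let_def ennreal_powr_le_iff)

lemma gagliardo_1_le_iff:
  assumes "0 < P" "0 \<le> R"
  shows "gagliardo 1 \<alpha> (ereal P) T D \<le> ennreal R \<longleftrightarrow> gagliardo_energy \<alpha> P T D \<le> ennreal (R powr P)"
  using gagliardo_finite_le_iff[of P 1 R \<alpha> T D] assms by (simp add: gagliardo_energy_def)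

section \<open>Comparison and addition of seminorms\<close>

abbreviation continuous2 :: "real \<Rightarrow> (real \<Rightarrow> real \<Rightarrow> real) \<Rightarrow> bool" where
  "continuous2 T D \<equiv> continuous_on ({0..T} \<times> {0..T}) (\<lambda>(s, t). D s t)"

abbreviation nincr :: "(real \<Rightarrow> 'a::real_normed_vector) \<Rightarrow> real \<Rightarrow> real \<Rightarrow> real" where
  "nincr X \<equiv> \<lambda>s t. norm (X s - X t)"

text \<open>Clamping both arguments to \<open>[0,T]\<close> yields a Borel function on the plane, so
  that constants can be pulled out of the iterated integrals and integrals added.\<close>

lemma measurable_extension:
  fixes D :: "real \<Rightarrow> real \<Rightarrow> real"
  assumes T: "0 < T" and D: "continuous2 T D"
  obtains D' where "(\<lambda>(s, t). D' s t) \<in> borel_measurable (borel \<Otimes>\<^sub>M borel)"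
    "\<And>s t. s \<in> {0..T} \<Longrightarrow> t \<in> {0..T} \<Longrightarrow> D' s t = D s t"
proof -
  let ?c = "\<lambda>t. max 0 (min T t)"
  have "continuous_on UNIV (\<lambda>q. (\<lambda>(s, t). D s t) (?c (fst q), ?c (snd q)))"
    using T by (intro continuous_on_compose2[OF D] continuous_intros) auto
  then have "(\<lambda>q. (\<lambda>(s, t). D s t) (?c (fst q), ?c (snd q))) \<in> borel_measurable borel"
    by (intro borel_measurable_continuous_onI) auto
  then show ?thesis
    using that[of "\<lambda>s t. D (?c s) (?c t)"] by (simp add: borel_prod split_def min_absorb2 max_absorb2)
qed

text \<open>The functional of order \<open>k\<close> matches k-th powers:
  \<open>D powr (P / k)\<close> is at most a multiple of \<open>H powr P\<close>. \<open>D\<close>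
  enters only through monotonicity of the integral, so that it may be a distance such as
  \<open>d_cc\<close>.\<close>

lemma gagliardo_power_le:
  fixes H D :: "real \<Rightarrow> real \<Rightarrow> real"
  assumes T: "0 < T" and p: "0 < p" and k: "0 < k" and c: "0 \<le> c" and R: "0 \<le> R"
    and H: "continuous2 T H" "gagliardo 1 \<alpha> p T H \<le> ennreal R"
    and H0: "\<And>s t. s \<in> {0..T} \<Longrightarrow> t \<in> {0..T} \<Longrightarrow> 0 \<le> H s t"
    and D: "\<And>s t. s \<in> {0..T} \<Longrightarrow> t \<in> {0..T} \<Longrightarrow> 0 \<le> D s t \<and> D s t \<le> c * H s t ^ k"
  shows "gagliardo k \<alpha> p T D \<le> ennreal (c * R ^ k)"
proof (cases "p = \<infinity>")
  case True
  have "D s t \<le> c * R ^ k * \<bar>t - s\<bar> powr (real k * \<alpha>)" if st: "s \<in> {0..T}" "t \<in> {0..T}" "s \<noteq> t" for s t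
  proof -
    have "H s t \<le> R * \<bar>t - s\<bar> powr \<alpha>"
      using H(2) R st unfolding True by (simp add: gagliardo_infinity_le_iff)
    then have "H s t ^ k \<le> (R * \<bar>t - s\<bar> powr \<alpha>) ^ k" using H0 st by (intro power_mono) auto
    also have "\<dots> = R ^ k * \<bar>t - s\<bar> powr (real k * \<alpha>)"
      using st by (simp add: power_mult_distrib powr_power mult.commute)
    finally have "c * H s t ^ k \<le> c * (R ^ k * \<bar>t - s\<bar> powr (real k * \<alpha>))" using c by (rule mult_left_mono)
    then show ?thesis using D[OF st(1,2)] by (simp add: mult.assoc)
  qed
  then show ?thesis unfolding True using c R by (subst gagliardo_infinity_le_iff) auto
next
  case False
  then obtain P where P: "p = ereal P" "0 < P" using p by (cases p) auto
  obtain H' where H'm [measurable]: "(\<lambda>(s, t). H' s t) \<in> borel_measurable (borel \<Otimes>\<^sub>M borel)"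
    and H': "\<And>s t. s \<in> {0..T} \<Longrightarrow> t \<in> {0..T} \<Longrightarrow> H' s t = H s t"
    using measurable_extension[OF T H(1)] by blast
  let ?w = "\<lambda>s t. \<bar>t - s\<bar> powr (\<alpha> * P + 1)" and ?q = "P / real k"
  have "gagliardo_energy \<alpha> P T H \<le> ennreal (R powr P)"
    using gagliardo_1_le_iff[of P R \<alpha> T H] H(2) P R by simp
  then have E: "gagliardo_energy \<alpha> P T H' \<le> ennreal (R powr P)"
    using gagliardo_energy_cong[of T H' H] H' by simp
  have pt: "D s t powr ?q / ?w s t \<le> c powr ?q * (H' s t powr P / ?w s t)" if st: "s \<in> {0..T}" "t \<in> {0..T}" for s t
  proof -
    have "D s t powr ?q \<le> (c * H s t ^ k) powr ?q" using D[OF st] P k by (intro powr_mono2) auto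
    also have "\<dots> = c powr ?q * H s t powr P"
      using c H0[OF st] k P by (cases "H s t = 0") (auto simp: powr_mult powr_powr simp flip: powr_realpow)
    finally show ?thesis using H'[OF st] by (simp add: divide_right_mono)
  qed
  have "(\<integral>\<^sup>+ t\<in>{0..T}. (\<integral>\<^sup>+ s\<in>{0..T}. ennreal (D s t powr ?q / ?w s t) \<partial>lborel) \<partial>lborel)
    \<le> (\<integral>\<^sup>+ t\<in>{0..T}. (\<integral>\<^sup>+ s\<in>{0..T}. ennreal (c powr ?q) * ennreal (H' s t powr P / ?w s t) \<partial>lborel) \<partial>lborel)"
    using pt by (intro set_nn_integral_mono2) (simp flip: ennreal_mult add: ennreal_leI)
  also have "\<dots> = ennreal (c powr ?q) * gagliardo_energy \<alpha> P T H'"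
    unfolding gagliardo_energy_def by (simp add: nn_integral_cmult mult.assoc)
  also have "\<dots> \<le> ennreal (c powr ?q) * ennreal (R powr P)" by (intro mult_left_mono E) simp
  also have "\<dots> = ennreal ((c * R ^ k) powr ?q)"
    using c R k P by (cases "R = 0") (auto simp: powr_mult powr_powr simp flip: powr_realpow ennreal_mult)
  finally show ?thesis
    unfolding P(1) using P c R k by (subst gagliardo_finite_le_iff) auto
qed

text \<open>A triangle inequality up to a constant. One factor 2 comes from
  \<open>powr_add_le\<close>, the other from bounding \<open>R powr P + S powr P\<close> by
  \<open>(2 * (R + S)) powr P\<close>.\<close>

lemma gagliardo_add_le:
  fixes D E :: "real \<Rightarrow> real \<Rightarrow> real"
  assumes T: "0 < T" and p: "1 < p" and R: "0 \<le> R" "0 \<le> S"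
    and D: "continuous2 T D" "gagliardo 1 \<alpha> p T D \<le> ennreal R"
    and E: "continuous2 T E" "gagliardo 1 \<alpha> p T E \<le> ennreal S"
    and D0: "\<And>s t. s \<in> {0..T} \<Longrightarrow> t \<in> {0..T} \<Longrightarrow> 0 \<le> D s t"
    and E0: "\<And>s t. s \<in> {0..T} \<Longrightarrow> t \<in> {0..T} \<Longrightarrow> 0 \<le> E s t"
  shows "gagliardo 1 \<alpha> p T (\<lambda>s t. D s t + E s t) \<le> ennreal (4 * (R + S))"
proof (cases "p = \<infinity>")
  case True
  have "D s t + E s t \<le> 4 * (R + S) * \<bar>t - s\<bar> powr (real 1 * \<alpha>)" if st: "s \<in> {0..T}" "t \<in> {0..T}" "s \<noteq> t" for s t
  proof -
    have "D s t \<le> R * \<bar>t - s\<bar> powr \<alpha>" "E s t \<le> S * \<bar>t - s\<bar> powr \<alpha>"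
      using D(2) E(2) R st unfolding True by (simp_all add: gagliardo_infinity_le_iff)
    then have "D s t + E s t \<le> 1 * ((R + S) * \<bar>t - s\<bar> powr \<alpha>)" by (simp add: distrib_right)
    also have "\<dots> \<le> 4 * ((R + S) * \<bar>t - s\<bar> powr \<alpha>)" using R by (intro mult_right_mono) auto
    finally show ?thesis by (simp only: mult.assoc of_nat_1 mult_1)
  qed
  then show ?thesis unfolding True using R by (subst gagliardo_infinity_le_iff) auto
next
  case False
  then obtain P where P: "p = ereal P" "1 < P" using p by (cases p) auto
  obtain D' where D'm [measurable]: "(\<lambda>(s, t). D' s t) \<in> borel_measurable (borel \<Otimes>\<^sub>M borel)"
    and D': "\<And>s t. s \<in> {0..T} \<Longrightarrow> t \<in> {0..T} \<Longrightarrow> D' s t = D s t"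
    using measurable_extension[OF T D(1)] by blast
  obtain E' where E'm [measurable]: "(\<lambda>(s, t). E' s t) \<in> borel_measurable (borel \<Otimes>\<^sub>M borel)"
    and E': "\<And>s t. s \<in> {0..T} \<Longrightarrow> t \<in> {0..T} \<Longrightarrow> E' s t = E s t"
    using measurable_extension[OF T E(1)] by blast
  let ?w = "\<lambda>s t. \<bar>t - s\<bar> powr (\<alpha> * P + 1)"
  have "gagliardo_energy \<alpha> P T D \<le> ennreal (R powr P)" "gagliardo_energy \<alpha> P T E \<le> ennreal (S powr P)"
    using gagliardo_1_le_iff[of P R \<alpha> T D] gagliardo_1_le_iff[of P S \<alpha> T E] D(2) E(2) P R by simp_all
  then have en: "gagliardo_energy \<alpha> P T D' \<le> ennreal (R powr P)" "gagliardo_energy \<alpha> P T E' \<le> ennreal (S powr P)"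
    using gagliardo_energy_cong[of T D' D] D' gagliardo_energy_cong[of T E' E] E' by simp_all
  have pt: "ennreal ((D s t + E s t) powr P / ?w s t)
      \<le> ennreal (2 powr P) * (ennreal (D' s t powr P / ?w s t) + ennreal (E' s t powr P / ?w s t))"
    if st: "s \<in> {0..T}" "t \<in> {0..T}" for s t
  proof -
    have "(D s t + E s t) powr P / ?w s t \<le> 2 powr P * (D s t powr P + E s t powr P) / ?w s t"
      using D0[OF st] E0[OF st] P by (intro divide_right_mono powr_add_le) auto
    then show ?thesis
      using D'[OF st] E'[OF st] by (simp add: ennreal_leI add_divide_distrib[symmetric] flip: ennreal_plus ennreal_mult)
  qed
  have "gagliardo_energy \<alpha> P T (\<lambda>s t. D s t + E s t) \<le> (\<integral>\<^sup>+ t\<in>{0..T}. (\<integral>\<^sup>+ s\<in>{0..T}.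
      ennreal (2 powr P) * (ennreal (D' s t powr P / ?w s t) + ennreal (E' s t powr P / ?w s t)) \<partial>lborel) \<partial>lborel)"
    unfolding gagliardo_energy_def by (intro set_nn_integral_mono2 pt)
  also have "\<dots> = ennreal (2 powr P) * (gagliardo_energy \<alpha> P T D' + gagliardo_energy \<alpha> P T E')"
    unfolding gagliardo_energy_def by (simp add: nn_integral_cmult nn_integral_add mult.assoc distrib_right)
  also have "\<dots> \<le> ennreal (2 powr P) * (ennreal (R powr P) + ennreal (S powr P))"
    by (intro mult_left_mono add_mono en) simp
  also have "\<dots> = ennreal (2 powr P * (R powr P + S powr P))"
    by (simp flip: ennreal_plus ennreal_mult)
  also have "\<dots> \<le> ennreal ((4 * (R + S)) powr P)"
  proof (rule ennreal_leI)
    have "R powr P + S powr P \<le> (R + S) powr P + (R + S) powr P"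
      using R P by (intro add_mono powr_mono2) auto
    also have "\<dots> \<le> 2 powr P * (R + S) powr P"
      using powr_mono[of 1 P 2] P mult_right_mono[of 2 "2 powr P" "(R + S) powr P"] by simp
    finally have "2 powr P * (R powr P + S powr P) \<le> 2 powr P * (2 powr P * (R + S) powr P)"
      by (rule mult_left_mono) simp
    also have "\<dots> = (4 * (R + S)) powr P"
      using R powr_mult[of 2 2 P] powr_mult[of 4 "R + S" P] by (simp add: mult.assoc[symmetric])
    finally show "2 powr P * (R powr P + S powr P) \<le> (4 * (R + S)) powr P" .
  qed
  finally show ?thesis unfolding P(1) using P R by (subst gagliardo_1_le_iff) auto
qed

text \<open>Iterates \<open>gagliardo_add_le\<close>; the constant is generous but depends only on
  \<open>R\<close> and the number of summands.\<close>

lemma gagliardo_sum_le: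
  fixes D :: "'i \<Rightarrow> real \<Rightarrow> real \<Rightarrow> real"
  assumes T: "0 < T" and p: "1 < p" and R: "0 \<le> R" and "finite I"
    and D: "\<And>i. i \<in> I \<Longrightarrow> continuous2 T (D i)"
      "\<And>i. i \<in> I \<Longrightarrow> gagliardo 1 \<alpha> p T (D i) \<le> ennreal R"
    and D0: "\<And>i s t. i \<in> I \<Longrightarrow> s \<in> {0..T} \<Longrightarrow> t \<in> {0..T} \<Longrightarrow> 0 \<le> D i s t"
  shows "gagliardo 1 \<alpha> p T (\<lambda>s t. \<Sum>i\<in>I. D i s t) \<le> ennreal (((\<lambda>x. 4 * (R + x)) ^^ card I) 0)"
  using assms(4) D D0
proof (induction I)
  case empty
  have "gagliardo 1 \<alpha> p T (\<lambda>s t. 0) \<le> ennreal 0"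
  proof (cases "p = \<infinity>")
    case True then show ?thesis using gagliardo_infinity_le_iff[of 0 1 \<alpha> T "\<lambda>_ _. 0"] by simp
  next
    case False
    then obtain P where "p = ereal P" "1 < P" using p by (cases p) auto
    then show ?thesis using gagliardo_1_le_iff[of P 0 \<alpha> T "\<lambda>_ _. 0"] by (simp add: gagliardo_energy_def)
  qed
  then show ?case by simp
next
  case (insert i I)
  have pos: "0 \<le> ((\<lambda>x. 4 * (R + x)) ^^ n) 0" for n by (induction n) (use R in auto)
  have "gagliardo 1 \<alpha> p T (\<lambda>s t. D i s t + (\<Sum>i\<in>I. D i s t)) \<le> ennreal (4 * (R + ((\<lambda>x. 4 * (R + x)) ^^ card I) 0))"
  proof (rule gagliardo_add_le[OF T p R pos])
    show "continuous_on ({0..T} \<times> {0..T}) (\<lambda>(s, t). \<Sum>i\<in>I. D i s t)"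
      using insert.prems(1) unfolding split_def by (intro continuous_on_sum) auto
  qed (use insert in \<open>auto intro!: sum_nonneg\<close>)
  then show ?case using insert.hyps by simp
qed

section \<open>Uniform bounds for the area pseudometric\<close>

lemma sobolev_exponent_cases:
  assumes "0 < \<alpha>" "1 < p" "ereal \<alpha> > 1 / p"
  obtains "p = \<infinity>" | P where "p = ereal P" "1 < P" "1 < \<alpha> * P"
proof (cases p)
  case (real P)
  then have "1 < P" using assms(2) by simp
  moreover have "1 / P < \<alpha>" using assms(3) real \<open>1 < P\<close> by (simp add: one_ereal_def)
  ultimately show ?thesis using that(2)[of P] real by (simp add: field_simps)
qed (use assms that in auto)

lemma hoelder_node_incr:
  assumes T: "0 < T" and R: "0 \<le> R" and u: "gagliardo 1 \<alpha> \<infinity> T (incr u) \<le> ennreal R" and k: "k < 2 ^ n"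
  shows "incr u (node T n k) (node T n (Suc k)) \<le> R * T powr \<alpha> * (1 / 2 powr \<alpha>) ^ n"
proof -
  have "node T n k \<noteq> node T n (Suc k)" "\<bar>node T n (Suc k) - node T n k\<bar> = T / 2 ^ n"
    using T by (auto simp: node_Suc)
  then have "incr u (node T n k) (node T n (Suc k)) \<le> R * (T / 2 ^ n) powr \<alpha>"
    using u[unfolded gagliardo_infinity_le_iff[OF R], rule_format, of "node T n k" "node T n (Suc k)"]
      node_in[OF T, of k n] node_in[OF T, of "Suc k" n] k by simp
  also have "(T / 2 ^ n) powr \<alpha> = T powr \<alpha> * (1 / 2 powr \<alpha>) ^ n"
    using T by (simp add: powr_divide power_one_over powr_power powr_powr mult.commute flip: powr_realpow)
  finally show ?thesis by simp
qed

lemma dyadic_regular_of_gagliardo: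
  assumes T: "0 < T" and \<alpha>: "0 < \<alpha>" and p: "1 < p" "ereal \<alpha> > 1 / p"
    and f: "continuous_on {0..T} f" and fin: "gagliardo 1 \<alpha> p T (incr f) \<le> ennreal R" and R: "0 \<le> R"
  shows "dyadic_regular T f"
  using \<alpha> p
proof (cases rule: sobolev_exponent_cases)
  case 1
  have "incr f (node T n k) (node T n (Suc k)) \<le> R * T powr \<alpha> * (1 / 2 powr \<alpha>) ^ n" if "k < 2 ^ n" for n k
    using hoelder_node_incr[OF T R fin[unfolded 1] that] .
  moreover have "1 / 2 powr \<alpha> < 1" using \<alpha> by simp
  ultimately show ?thesis
    unfolding dyadic_regular_def using f R T by (intro conjI exI[of _ "R * T powr \<alpha>"] exI[of _ "1 / 2 powr \<alpha>"]) auto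
next
  case (2 P)
  obtain C where C: "0 < C" "dyadic_energy \<alpha> P T (incr f) \<le> ennreal C * gagliardo_energy \<alpha> P T (incr f)"
    using dyadic_le_gagliardo[OF 2(3) _ T] 2(2) f by force
  note C(2)
  also have "ennreal C * gagliardo_energy \<alpha> P T (incr f) \<le> ennreal C * ennreal (R powr P)"
    using gagliardo_1_le_iff[of P R \<alpha> T "incr f"] fin 2 R by (intro mult_left_mono) simp_all
  also have "\<dots> = ennreal (C * R powr P)" using C by (simp add: ennreal_mult)
  finally show ?thesis
    using 2 C by (intro dyadic_regular_of_energy[OF f 2(3)]) auto
qed

text \<open>Areas on cells of level \<open>n\<close> are bounded by a multiple of
  \<open>(b\<^sup>2) ^ n\<close> by induction along the bisection; \<open>pointwise_bound\<close>
  carries the resulting estimate from dyadic neighbours to all pairs.\<close>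

lemma area_dist_hoelder:
  assumes T: "0 < T" and \<alpha>: "0 < \<alpha>" "\<alpha> < 1 / 2" and R: "0 \<le> R"
  shows "\<exists>C\<ge>0. \<forall>f g. dyadic_regular T f \<longrightarrow> dyadic_regular T g \<longrightarrow>
    gagliardo 1 \<alpha> \<infinity> T (incr f) \<le> ennreal R \<longrightarrow> gagliardo 1 \<alpha> \<infinity> T (incr g) \<le> ennreal R \<longrightarrow>
    gagliardo 1 \<alpha> \<infinity> T (area_dist T f g) \<le> ennreal C"
proof -
  define b where "b = 1 / 2 powr \<alpha>"
  have b: "0 < b" "b < 1" using \<alpha> by (auto simp: b_def)
  have "2 powr (2 * \<alpha>) < 2 powr 1" using \<alpha> by (intro powr_less_mono) auto
  moreover have "2 powr (2 * \<alpha>) = (2 powr \<alpha>)\<^sup>2" by (simp add: powr_power mult.commute)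
  \<comment> \<open>This is \<open>2 * \<alpha> < 1\<close>: the scaling \<open>b\<^sup>2\<close>
    per level exceeds the factor 1/2 by which bisection shrinks the area.\<close>
  ultimately have b2: "1 / 2 < b\<^sup>2" by (simp add: b_def power_divide field_simps)
  define M where "M = R * T powr \<alpha>"
  have M: "0 \<le> M" using R by (simp add: M_def)
  \<comment> \<open>The solution of the fixed point equation \<open>A_eq\<close>, for which the
    bound \<open>A * (b\<^sup>2) ^ n\<close> reproduces itself under
    \<open>area_child_bound\<close>.\<close>
  define A where "A = M\<^sup>2 * b\<^sup>2 / (2 * b\<^sup>2 - 1)"
  have A: "0 \<le> A" using b2 by (simp add: A_def)
  have A_eq: "A / 2 + M\<^sup>2 * b\<^sup>2 / 2 = A * b\<^sup>2" using b2 by (simp add: A_def field_simps)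
  define M' where "M' = M + sqrt A"
  have M': "0 \<le> M'" using M A by (simp add: M'_def)
  \<comment> \<open>The 8 collects the factor 2 of \<open>pointwise_bound\<close>, the two end
    points and the two steps in \<open>local_step\<close>; \<open>(2 / T) powr \<alpha>\<close>
    converts \<open>b ^ n\<close> into a power of the distance.\<close>
  define C where "C = 8 * M' / (1 - b) * (2 / T) powr \<alpha>"
  have C: "0 \<le> C" using M' b by (simp add: C_def)
  show ?thesis
  proof (intro exI[of _ C] conjI allI impI C)
    fix f g assume fg: "dyadic_regular T f" "dyadic_regular T g"
      and Rf: "gagliardo 1 \<alpha> \<infinity> T (incr f) \<le> ennreal R"
      and Rg: "gagliardo 1 \<alpha> \<infinity> T (incr g) \<le> ennreal R"
    interpret path_pseudometric T "area_dist T f g" by (rule area_dist_pseudometric[OF T fg])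
    have inc: "incr u (node T n k) (node T n (Suc k)) \<le> M * b ^ n"
      if "k < 2 ^ n" and "gagliardo 1 \<alpha> \<infinity> T (incr u) \<le> ennreal R" for n k and u :: "real \<Rightarrow> real"
      using hoelder_node_incr[OF T R that(2,1)] by (simp add: M_def b_def)
    have area: "\<bar>area T f g (node T n k) (node T n (Suc k))\<bar> \<le> A * (b\<^sup>2) ^ n" if "k < 2 ^ n" for n k
      using that
    proof (induction n arbitrary: k)
      case 0
      then show ?case using area_total[OF T fg] node_last[of T 0] A by simp
    next
      case (Suc n)
      obtain j where j: "k = 2 * j \<or> k = Suc (2 * j)" by (metis oddE evenE Suc_eq_plus1)
      then have jn: "j < 2 ^ n" using Suc.prems by auto
      let ?df = "\<lambda>k. \<bar>f (node T (Suc n) k) - f (node T (Suc n) (Suc k))\<bar>"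
      let ?dg = "\<lambda>k. \<bar>g (node T (Suc n) k) - g (node T (Suc n) (Suc k))\<bar>"
      have "\<bar>area T f g (node T (Suc n) k) (node T (Suc n) (Suc k))\<bar> \<le>
        \<bar>area T f g (node T n j) (node T n (Suc j))\<bar> / 2 + (?df (2 * j) * ?dg (Suc (2 * j)) + ?dg (2 * j) * ?df (Suc (2 * j))) / 4"
        by (rule area_child_bound[OF T fg jn j])
      also have "\<dots> \<le> A * (b\<^sup>2) ^ n / 2 + ((M * b ^ Suc n) * (M * b ^ Suc n) + (M * b ^ Suc n) * (M * b ^ Suc n)) / 4"
        using jn M b by (intro add_mono divide_right_mono Suc.IH mult_mono inc Rf Rg) auto
      also have "\<dots> = (A / 2 + M\<^sup>2 * b\<^sup>2 / 2) * (b\<^sup>2) ^ n"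
        by (simp add: power2_eq_square power_mult_distrib algebra_simps)
      also have "\<dots> = A * (b\<^sup>2) ^ Suc n" unfolding A_eq by simp
      finally show ?case .
    qed
    have st: "step n k \<le> M' * b ^ n" if k: "k < 2 ^ n" for n k
    proof -
      have "sqrt \<bar>area T f g (node T n k) (node T n (Suc k))\<bar> \<le> sqrt A * b ^ n"
      proof (rule real_le_lsqrt)
        show "\<bar>area T f g (node T n k) (node T n (Suc k))\<bar> \<le> (sqrt A * b ^ n)\<^sup>2"
          using area[OF k] A by (simp add: power_mult_distrib power_mult[symmetric] mult.commute)
      qed (use A b in auto)
      moreover have "M * b ^ n \<le> M' * b ^ n" "sqrt A * b ^ n \<le> M' * b ^ n"
        using A M b by (auto simp: M'_def intro!: mult_right_mono)
      ultimately show ?thesis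
        unfolding step_def area_dist_def using inc[OF k Rf] inc[OF k Rg] by simp
    qed
    have loc: "local_step n k \<le> 2 * M' * b ^ n" if k: "k < 2 ^ n" for n k
    proof -
      have "step (Suc n) (2 * k) \<le> M' * b ^ Suc n" using k by (intro st) auto
      also have "\<dots> \<le> M' * b ^ n" using M' b by (intro mult_left_mono power_decreasing) auto
      finally show ?thesis using st[OF k] by (simp add: local_step_def)
    qed
    have scale: "area_dist T f g s t \<le> 8 * M' / (1 - b) * b ^ n"
      if st: "s \<in> {0..T}" "t \<in> {0..T}" "\<bar>t - s\<bar> \<le> T / 2 ^ n" for s t n
    proof (rule field_le_epsilon)
      fix e :: real assume e: "0 < e"
      obtain N where "area_dist T f g s t \<le> (\<Sum>j<N. 2 * (local_step (n + j) (cell T (n + j) s) + local_step (n + j) (cell T (n + j) t))) + e"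
        using pointwise_bound[OF st e] by blast
      also have "(\<Sum>j<N. 2 * (local_step (n + j) (cell T (n + j) s) + local_step (n + j) (cell T (n + j) t)))
        \<le> (\<Sum>j<N. 2 * (2 * M' * b ^ (n + j) + 2 * M' * b ^ (n + j)))"
        by (intro sum_mono mult_left_mono add_mono loc cell_less) auto
      also have "\<dots> = 8 * M' * b ^ n * (\<Sum>j<N. b ^ j)" 
          unfolding sum_distrib_left by (intro sum.cong refl) (simp add: power_add)
      also have "\<dots> \<le> 8 * M' * b ^ n * (1 / (1 - b))"
        using b M' by (intro mult_left_mono) (auto simp: sum_gp_strict divide_right_mono)
      finally show "area_dist T f g s t \<le> 8 * M' / (1 - b) * b ^ n + e" by simp
    qed
    show "gagliardo 1 \<alpha> \<infinity> T (area_dist T f g) \<le> ennreal C"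
    proof (subst gagliardo_infinity_le_iff[OF C], intro ballI impI)
      fix s t assume st: "s \<in> {0..T}" "t \<in> {0..T}" "s \<noteq> t"
      then have "0 < \<bar>t - s\<bar>" "\<bar>t - s\<bar> \<le> T" by auto
      with T obtain n where n: "T / 2 ^ Suc n < \<bar>t - s\<bar>" "\<bar>t - s\<bar> \<le> T / 2 ^ n"
        using dyadic_scale by blast
      have "b ^ n = (1 / 2 ^ n) powr \<alpha>"
        by (simp add: b_def powr_divide power_one_over powr_power powr_powr mult.commute flip: powr_realpow)
      also have "\<dots> \<le> (2 / T * \<bar>t - s\<bar>) powr \<alpha>"
        using n(1) T \<alpha> by (intro powr_mono2) (auto simp: field_simps)
      also have "\<dots> = (2 / T) powr \<alpha> * \<bar>t - s\<bar> powr \<alpha>" by (intro powr_mult)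
      finally have bn: "b ^ n \<le> (2 / T) powr \<alpha> * \<bar>t - s\<bar> powr \<alpha>" .
      have "area_dist T f g s t \<le> 8 * M' / (1 - b) * b ^ n" by (rule scale[OF st(1,2) n(2)])
      also have "\<dots> \<le> 8 * M' / (1 - b) * ((2 / T) powr \<alpha> * \<bar>t - s\<bar> powr \<alpha>)"
        using bn b M' by (intro mult_left_mono) auto
      finally show "area_dist T f g s t \<le> C * \<bar>t - s\<bar> powr (real 1 * \<alpha>)" by (simp add: C_def mult.assoc)
    qed
  qed
qed

text \<open>For finite p: double integrals of \<open>f\<close> and \<open>g\<close> to dyadic
  energies, the area recursion, and back. The constant depends on the radius \<open>R\<close> but
  not on the pair, as the rescaling in the Lipschitz estimate demands.\<close>

theorem area_dist_gagliardo:
  assumes T: "0 < T" and \<alpha>: "0 < \<alpha>" "\<alpha> < 1 / 2" and p: "1 < p" "ereal \<alpha> > 1 / p" and R: "0 \<le> R"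
  shows "\<exists>C\<ge>0. \<forall>f g. continuous_on {0..T} f \<longrightarrow> continuous_on {0..T} g \<longrightarrow>
    gagliardo 1 \<alpha> p T (incr f) \<le> ennreal R \<longrightarrow> gagliardo 1 \<alpha> p T (incr g) \<le> ennreal R \<longrightarrow>
    gagliardo 1 \<alpha> p T (area_dist T f g) \<le> ennreal C"
  using \<alpha>(1) p
proof (cases rule: sobolev_exponent_cases)
  case 1
  show ?thesis
    using area_dist_hoelder[OF T \<alpha> R] dyadic_regular_of_gagliardo[OF T \<alpha>(1) p _ _ R] unfolding 1 by metis
next
  case (2 P)
  obtain C1 where C1: "0 < C1" "\<And>f. continuous_on {0..T} f \<Longrightarrow>
    dyadic_energy \<alpha> P T (incr f) \<le> ennreal C1 * gagliardo_energy \<alpha> P T (incr f)"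
    using dyadic_le_gagliardo[OF 2(3) _ T] 2(2) by (metis less_imp_le)
  obtain C2 where C2: "0 \<le> C2" "\<And>R f g. 0 \<le> R \<Longrightarrow> dyadic_regular T f \<Longrightarrow> dyadic_regular T g \<Longrightarrow>
    dyadic_energy \<alpha> P T (incr f) \<le> ennreal R \<Longrightarrow> dyadic_energy \<alpha> P T (incr g) \<le> ennreal R \<Longrightarrow>
    dyadic_energy \<alpha> P T (area_dist T f g) \<le> ennreal (C2 * R)"
    using area_dist_energy[OF T \<alpha>(2), of P] 2(2) by force
  obtain C3 where C3: "0 < C3" "\<And>d. path_pseudometric T d \<Longrightarrow> gagliardo_energy \<alpha> P T d \<le> ennreal C3 * dyadic_energy \<alpha> P T d"
    using gagliardo_le_dyadic[OF \<alpha>(1) _ T, of P] 2(2) by force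
  define C where "C = (C3 * (C2 * (C1 * R powr P))) powr (1 / P)"
  have C: "0 \<le> C" "C powr P = C3 * (C2 * (C1 * R powr P))"
    using C1 C2 C3 2 by (auto simp: C_def powr_powr)
  show ?thesis
  proof (intro exI[of _ C] conjI allI impI C(1))
    fix f g assume fg: "continuous_on {0..T} f" "continuous_on {0..T} g"
      and Rf: "gagliardo 1 \<alpha> p T (incr f) \<le> ennreal R"
      and Rg: "gagliardo 1 \<alpha> p T (incr g) \<le> ennreal R"
    have reg: "dyadic_regular T f" "dyadic_regular T g"
      using dyadic_regular_of_gagliardo[OF T \<alpha>(1) p _ _ R] fg Rf Rg by auto
    have en: "dyadic_energy \<alpha> P T (incr u) \<le> ennreal (C1 * R powr P)"
      if "continuous_on {0..T} u" "gagliardo 1 \<alpha> p T (incr u) \<le> ennreal R" for u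
    proof -
      have "ennreal C1 * gagliardo_energy \<alpha> P T (incr u) \<le> ennreal C1 * ennreal (R powr P)"
        using gagliardo_1_le_iff[of P R \<alpha> T "incr u"] that(2) 2 R by (intro mult_left_mono) simp_all
      then show ?thesis using C1(2)[OF that(1)] C1(1) by (simp add: ennreal_mult)
    qed
    have "gagliardo_energy \<alpha> P T (area_dist T f g) \<le> ennreal C3 * dyadic_energy \<alpha> P T (area_dist T f g)"
      by (rule C3(2)[OF area_dist_pseudometric[OF T reg]])
    also have "\<dots> \<le> ennreal C3 * ennreal (C2 * (C1 * R powr P))"
      using C1 by (intro mult_left_mono C2(2) reg en fg Rf Rg) auto
    also have "\<dots> = ennreal (C powr P)" using C1 C2 C3 by (simp add: C(2) ennreal_mult)
    finally show "gagliardo 1 \<alpha> p T (area_dist T f g) \<le> ennreal C"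
      unfolding 2(1) using gagliardo_1_le_iff[of P C \<alpha> T "area_dist T f g"] 2 C(1) by simp
  qed
qed

section \<open>The rough path lift\<close>

definition area_matrix :: "real \<Rightarrow> (real \<Rightarrow> real ^ 'd::finite) \<Rightarrow> real \<Rightarrow> real ^ 'd ^ 'd" where
  "area_matrix T X t = (\<chi> i j. area_primitive T (\<lambda>u. X u $ i) (\<lambda>u. X u $ j) t)"

text \<open>The symmetric part of the second level is forced by membership in \<open>G2\<close>. The
  first level is \<open>X\<close> itself and not its increment from 0, so the path need not start at
  the unit.\<close>

definition rough_lift :: "real \<Rightarrow> (real \<Rightarrow> real ^ 'd::finite) \<Rightarrow> real \<Rightarrow> 'd tensor2" where
  "rough_lift T X = (\<lambda>t\<in>{0..T}. (1, X t, (1/2) *\<^sub>R tensor_vec (X t) (X t) + area_matrix T X t))"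

abbreviation lift_diff :: "real \<Rightarrow> (real \<Rightarrow> real ^ 'd::finite) \<Rightarrow> (real \<Rightarrow> real ^ 'd) \<Rightarrow> real \<Rightarrow> real \<Rightarrow> 'd tensor2" where
  "lift_diff T X Y s t \<equiv> path_increment (rough_lift T X) s t - path_increment (rough_lift T Y) s t"

lemma rough_lift_increment:
  assumes "s \<in> {0..T}" "t \<in> {0..T}"
  shows "path_increment (rough_lift T X) s t = (1, X t - X s,
    (1/2) *\<^sub>R tensor_vec (X t - X s) (X t - X s) + (\<chi> i j. area T (\<lambda>u. X u $ i) (\<lambda>u. X u $ j) s t))"
  using assms
  by (simp add: path_increment_def rough_lift_def area_matrix_def tensor_vec_def vec_eq_iff area_def field_simps)

lemma norm_matrix_le_sum:
  fixes A :: "real ^ 'n::finite ^ 'm::finite"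
  shows "norm A \<le> (\<Sum>i\<in>UNIV. \<Sum>j\<in>UNIV. \<bar>A $ i $ j\<bar>)"
proof -
  have "norm A \<le> (\<Sum>i\<in>UNIV. norm (A $ i))"
    unfolding norm_vec_def by (intro L2_set_le_sum) simp
  also have "\<dots> \<le> (\<Sum>i\<in>UNIV. \<Sum>j\<in>UNIV. \<bar>A $ i $ j\<bar>)"
    by (intro sum_mono norm_le_l1_cart)
  finally show ?thesis .
qed

context
  fixes \<alpha> T :: real and p :: ereal
  assumes T: "0 < T" and \<alpha>: "0 < \<alpha>" "\<alpha> < 1 / 2" and p: "1 < p" "ereal \<alpha> > 1 / p"
begin

lemma p_pos: "0 < p"
  using p(1) by (cases p) (auto simp: one_ereal_def zero_ereal_def)

lemma continuous_increment_norm: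
  fixes X :: "real \<Rightarrow> 'a::real_normed_vector"
  assumes "continuous_on {0..T} X"
  shows "continuous_on ({0..T} \<times> {0..T}) (\<lambda>(s, t). norm (X s - X t))"
  unfolding split_def by (intro continuous_intros continuous_on_compose2[OF assms]) auto

abbreviation (input) seminorm :: "(real \<Rightarrow> real \<Rightarrow> real) \<Rightarrow> ennreal" where
  "seminorm \<equiv> gagliardo 1 \<alpha> p T"

text \<open>The factor \<open>c\<close> is 1 for the paths themselves and
  \<open>1 / \<delta>\<close> for their difference.\<close>

lemma component_scaled:
  fixes X :: "real \<Rightarrow> real ^ 'd::finite"
  assumes X: "continuous_on {0..T} X" "seminorm (nincr X) \<le> ennreal R"
    and R: "0 \<le> R" and c: "0 \<le> c"
  shows "continuous_on {0..T} (\<lambda>u. c * X u $ i)"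
    and "seminorm (\<lambda>u v. \<bar>c * X u $ i - c * X v $ i\<bar>) \<le> ennreal (c * R)"
proof -
  show "continuous_on {0..T} (\<lambda>u. c * X u $ i)" by (intro continuous_intros X)
  have "seminorm (\<lambda>u v. \<bar>c * X u $ i - c * X v $ i\<bar>) \<le> ennreal (c * R ^ 1)"
  proof (rule gagliardo_power_le[OF T p_pos _ c R continuous_increment_norm[OF X(1)] X(2)])
    fix s t
    have "\<bar>(X s - X t) $ i\<bar> \<le> norm (X s - X t)" by (rule component_le_norm_cart)
    then have "c * \<bar>X s $ i - X t $ i\<bar> \<le> c * norm (X s - X t)" using c by (intro mult_left_mono) simp_all
    then show "0 \<le> \<bar>c * X s $ i - c * X t $ i\<bar> \<and> \<bar>c * X s $ i - c * X t $ i\<bar> \<le> c * norm (X s - X t) ^ 1"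
      using c by (simp add: abs_mult flip: right_diff_distrib)
  qed auto
  then show "seminorm (\<lambda>u v. \<bar>c * X u $ i - c * X v $ i\<bar>) \<le> ennreal (c * R)" by simp
qed

lemma component_regular:
  fixes X :: "real \<Rightarrow> real ^ 'd::finite"
  assumes X: "continuous_on {0..T} X" "seminorm (nincr X) \<le> ennreal R"
    and R: "0 \<le> R" and c: "0 \<le> c"
  shows "dyadic_regular T (\<lambda>u. c * X u $ i)"
  by (rule dyadic_regular_of_gagliardo[OF T \<alpha>(1) p component_scaled[OF assms]]) (use R c in simp)

lemma sobolev_spaceD:
  fixes X :: "real \<Rightarrow> real ^ 'd::finite"
  assumes "X \<in> sobolev_space \<alpha> p T"
  obtains R where "continuous_on {0..T} X" "seminorm (nincr X) \<le> ennreal R" "0 \<le> R"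
proof -
  have X: "continuous_on {0..T} X" "sobolev_norm \<alpha> p T X < \<infinity>" using assms by (auto simp: sobolev_space_def)
  then obtain R where R: "sobolev_norm \<alpha> p T X = ennreal R" "0 \<le> R" by (cases "sobolev_norm \<alpha> p T X") auto
  have "seminorm (nincr X) \<le> sobolev_norm \<alpha> p T X"
    unfolding sobolev_norm_def by simp
  with that X R show ?thesis by simp
qed

text \<open>One function \<open>H\<close>, the sum of the area distances over all pairs of
  components, dominates every increment and the square root of every area;
  \<open>lipschitz_signature_exp\<close> then bounds \<open>d_cc\<close> by a multiple of
  \<open>H\<close>.\<close>

lemma rough_lift_is_lift:
  fixes X :: "real \<Rightarrow> real ^ 'd::finite"
  assumes "X \<in> sobolev_space \<alpha> p T"
  shows "sobolev_rough_lift \<alpha> p T X (rough_lift T X)"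
proof -
  obtain R where X: "continuous_on {0..T} X" "seminorm (nincr X) \<le> ennreal R" and R: "0 \<le> R"
    using sobolev_spaceD[OF assms] .
  let ?X = "\<lambda>i u. X u $ i"
  have reg: "dyadic_regular T (?X i)" for i
    using component_regular[OF X R, of 1 i] by simp
  have cont: "continuous_on {0..T} (?X i)" and gag: "seminorm (incr (?X i)) \<le> ennreal R" for i
    using component_scaled[OF X R, of 1 i] by simp_all
  have prim: "continuous_on {0..T} (area_primitive T (?X i) (?X j))" for i j
    using continuous_on_subset[OF faber_layers(2)[OF T reg reg]] by auto
  have swap: "area_primitive T (?X j) (?X i) t = - area_primitive T (?X i) (?X j) t"
    "area T (?X j) (?X i) s t = - area T (?X i) (?X j) s t" for i j s t
    by (rule area_primitive_swap[OF T reg reg] area_swap[OF T reg reg])+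
  have G2: "rough_lift T X t \<in> G2" if t: "t \<in> {0..T}" for t
  proof -
    define a b where "a = (\<Sum>i\<in>UNIV. \<bar>X t $ i\<bar>)" and "b = (\<Sum>(i, j)\<in>UNIV. \<bar>area_matrix T X t $ i $ j\<bar>)"
    \<comment> \<open>The summand 1 gives \<open>l \<le> l\<^sup>2\<close>, so one number bounds
      both levels. Only membership in \<open>G2\<close> is at stake here, not the size of the
      bound.\<close>
    define l where "l = 1 + a + b"
    have xa: "\<bar>X t $ i\<bar> \<le> a" for i unfolding a_def by (intro member_le_sum) auto
    have kb: "\<bar>area_matrix T X t $ i $ j\<bar> \<le> b" for i j
      unfolding b_def using member_le_sum[of "(i, j)" UNIV "\<lambda>(i, j). \<bar>area_matrix T X t $ i $ j\<bar>"] by auto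
    have "0 \<le> a" "0 \<le> b" by (auto simp: a_def b_def intro!: sum_nonneg)
    then have l: "1 \<le> l" "\<bar>X t $ i\<bar> \<le> l" "\<bar>area_matrix T X t $ i $ j\<bar> \<le> l" for i j
      using xa[of i] kb[of i j] unfolding l_def by linarith+
    then have "l \<le> l\<^sup>2" by (simp add: self_le_power)
    then have K: "\<bar>area_matrix T X t $ i $ j\<bar> \<le> l\<^sup>2" for i j using l(3) order_trans by blast
    have "lipschitz_signature (2 ^ (CARD('d)\<^sup>2 + 3) * l) (1, X t, (1/2) *\<^sub>R tensor_vec (X t) (X t) + area_matrix T X t)"
    proof (rule lipschitz_signature_exp[OF _ K l(2)])
      show "area_matrix T X t $ j $ i = - area_matrix T X t $ i $ j" for i j
        unfolding area_matrix_def vec_lambda_beta by (rule swap(1))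
    qed
    then show ?thesis using t by (auto simp: rough_lift_def intro: lipschitz_signature_G2)
  qed
  have lift_cont: "continuous_on {0..T} (rough_lift T X)"
  proof -
    have "continuous_on {0..T} (\<lambda>t. (1 :: real, X t, (1/2) *\<^sub>R tensor_vec (X t) (X t) + area_matrix T X t))"
      unfolding tensor_vec_def area_matrix_def
      by (intro continuous_intros X continuous_on_vec_lambda prim)
    then show ?thesis by (rule continuous_on_eq) (simp add: rough_lift_def)
  qed
  let ?h = "\<lambda>q. area_dist T (?X (fst q)) (?X (snd q))"
  obtain C where C: "0 \<le> C" "\<And>i j. seminorm (area_dist T (?X i) (?X j)) \<le> ennreal C"
    using area_dist_gagliardo[OF T \<alpha> p R] cont gag by metis
  have h_cont: "continuous2 T (?h q)" for q
    by (rule area_dist_continuous[OF T reg reg])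
  define H where "H = (\<lambda>s t. \<Sum>q\<in>UNIV. ?h q s t)"
  have H_cont: "continuous2 T H"
    using h_cont unfolding H_def split_beta by (auto intro!: continuous_on_sum)
  define C' where "C' = ((\<lambda>x. 4 * (C + x)) ^^ CARD('d \<times> 'd)) 0"
  have "0 \<le> ((\<lambda>x. 4 * (C + x)) ^^ n) 0" for n by (induction n) (use C in auto)
  then have C': "0 \<le> C'" by (simp add: C'_def)
  have H_gag: "seminorm H \<le> ennreal C'"
    unfolding H_def C'_def
    by (rule gagliardo_sum_le[OF T p(1) C(1) finite]; rule C(2) h_cont area_dist_ge(4))
  \<comment> \<open>\<open>CARD('d)\<close> comes from \<open>lipschitz_signature_cc_norm\<close>,
    the power of 2 from \<open>lipschitz_signature_exp\<close>.\<close>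
  define B where "B = real CARD('d) * 2 ^ (CARD('d)\<^sup>2 + 3)"
  have d_cc: "0 \<le> d_cc (rough_lift T X s) (rough_lift T X t) \<and> d_cc (rough_lift T X s) (rough_lift T X t) \<le> B * H s t ^ 1"
    if st: "s \<in> {0..T}" "t \<in> {0..T}" for s t
  proof -
    have le: "area_dist T (?X i) (?X j) s t \<le> H s t" for i j
      unfolding H_def using member_le_sum[of "(i, j)" UNIV "\<lambda>q. ?h q s t"] by (simp add: area_dist_ge(4))
    have sig: "lipschitz_signature (2 ^ (CARD('d)\<^sup>2 + 3) * H s t) (path_increment (rough_lift T X) s t)"
      unfolding rough_lift_increment[OF st]
    proof (rule lipschitz_signature_exp)
      fix i j
      show "(\<chi> i j. area T (?X i) (?X j) s t) $ j $ i = - (\<chi> i j. area T (?X i) (?X j) s t) $ i $ j"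
        using swap(2)[of j i] by simp
      show "\<bar>(\<chi> i j. area T (?X i) (?X j) s t) $ i $ j\<bar> \<le> (H s t)\<^sup>2"
        using order_trans[OF area_le_dist power_mono[OF le area_dist_ge(4)]] by simp
      show "\<bar>(X t - X s) $ i\<bar> \<le> H s t"
        using order_trans[OF area_dist_ge(1)[of "?X i" s t T "?X i"] le[of i i]] by (simp add: abs_minus_commute)
    qed
    then show ?thesis
      using lipschitz_signature_cc_norm[OF sig] cc_norm_nonneg[OF lipschitz_signature_G2[OF sig]]
      by (simp add: d_cc_def path_increment_def B_def mult.assoc)
  qed
  have "seminorm (\<lambda>s t. d_cc (rough_lift T X s) (rough_lift T X t)) \<le> ennreal (B * C' ^ 1)"
    by (rule gagliardo_power_le[OF T p_pos _ _ C' H_cont H_gag _ d_cc])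
      (auto simp: B_def H_def intro!: sum_nonneg area_dist_ge(4))
  then have "seminorm (\<lambda>s t. d_cc (rough_lift T X s) (rough_lift T X t)) < \<infinity>"
    by (rule le_less_trans) simp
  moreover have "rough_lift T X \<in> {0..T} \<rightarrow>\<^sub>E G2" using G2 by (auto simp: rough_lift_def)
  ultimately show ?thesis
    unfolding sobolev_rough_lift_def sobolev_rough_paths_def
    using lift_cont by (auto simp: rough_lift_increment simp del: atLeastAtMost_iff)
qed

text \<open>Replaces one argument after the other, as for a difference of products; linearity in the
  second argument is obtained by swapping, which produces the minus sign.\<close>

lemma area_difference:
  assumes reg: "dyadic_regular T f" "dyadic_regular T f'" "dyadic_regular T g" "dyadic_regular T g'"
    "dyadic_regular T a" "dyadic_regular T b"
    and f: "\<And>t. f t = c * a t + f' t" and g: "\<And>t. g t = c * b t + g' t"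
  shows "area T f g s t - area T f' g' s t = c * area T a g s t - c * area T b f' s t"
proof -
  have f_eq: "f = (\<lambda>t. c * a t + 1 * f' t)" and g_eq: "g = (\<lambda>t. c * b t + 1 * g' t)"
    by (simp_all add: fun_eq_iff f g)
  have "area T f g s t = c * area T a g s t + 1 * area T f' g s t"
    by (subst f_eq) (rule area_linear[OF T reg(5,2,3)])
  moreover have "area T g f' s t = c * area T b f' s t + 1 * area T g' f' s t"
    by (subst g_eq) (rule area_linear[OF T reg(6,4,2)])
  moreover have "area T g f' s t = - area T f' g s t" "area T g' f' s t = - area T f' g' s t"
    by (rule area_swap[OF T]; rule reg)+
  ultimately show ?thesis by linarith
qed

text \<open>The lift is quadratic, so its difference is bilinear in \<open>X\<^sub>1 - X\<^sub>2\<close> and the pair; dividing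
  \<open>X\<^sub>1 - X\<^sub>2\<close> by the size \<open>\<delta>\<close> of its norm reduces the estimate to paths in a fixed ball.\<close>

lemma level2_lipschitz:
  assumes R: "1 \<le> R"
  shows "\<exists>C\<ge>0. \<forall>(X1 :: real \<Rightarrow> real ^ 'd::finite) X2 \<delta>. continuous_on {0..T} X1 \<longrightarrow> continuous_on {0..T} X2 \<longrightarrow>
    seminorm (nincr X1) \<le> ennreal R \<longrightarrow>
    seminorm (nincr X2) \<le> ennreal R \<longrightarrow> 0 < \<delta> \<longrightarrow>
    seminorm (\<lambda>u v. norm ((X1 u - X2 u) - (X1 v - X2 v))) \<le> ennreal \<delta> \<longrightarrow>
    gagliardo 2 \<alpha> p T (\<lambda>s t. norm (\<pi>\<^sub>2 (lift_diff T X1 X2 s t)))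
      \<le> ennreal (C * \<delta>)"
proof -
  have R0: "0 \<le> R" using R by simp
  obtain C where C: "0 \<le> C" "\<And>f g. continuous_on {0..T} f \<Longrightarrow> continuous_on {0..T} g \<Longrightarrow>
    seminorm (incr f) \<le> ennreal R \<Longrightarrow> seminorm (incr g) \<le> ennreal R \<Longrightarrow>
    seminorm (area_dist T f g) \<le> ennreal C"
    using area_dist_gagliardo[OF T \<alpha> p R0] by metis
  define C' where "C' = ((\<lambda>x. 4 * (C + x)) ^^ CARD('d \<times> 'd)) 0"
  have "0 \<le> ((\<lambda>x. 4 * (C + x)) ^^ n) 0" for n by (induction n) (use C in auto)
  then have C': "0 \<le> C'" by (simp add: C'_def)
  \<comment> \<open>Each of the \<open>(CARD('d))\<^sup>2\<close> entries is at most
    \<open>3 * \<delta>\<close> times a squared distance: one unit from the symmetric part and one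
    from each of two areas.\<close>
  define N where "N = 3 * (real CARD('d))\<^sup>2"
  show ?thesis
  proof (intro exI[of _ "N * (4 * (C' + C'))\<^sup>2"] conjI allI impI)
    show "0 \<le> N * (4 * (C' + C'))\<^sup>2" by (simp add: N_def)
    fix X1 X2 :: "real \<Rightarrow> real ^ 'd" and \<delta> :: real
    assume X1: "continuous_on {0..T} X1" "seminorm (nincr X1) \<le> ennreal R"
      and X2: "continuous_on {0..T} X2" "seminorm (nincr X2) \<le> ennreal R"
      and \<delta>: "0 < \<delta>" and D: "seminorm (\<lambda>u v. norm ((X1 u - X2 u) - (X1 v - X2 v))) \<le> ennreal \<delta>"
    let ?f = "\<lambda>i u. X1 u $ i" and ?g = "\<lambda>i u. X2 u $ i" and ?d = "\<lambda>i u. (1 / \<delta>) * (X1 u - X2 u) $ i"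
    have Dc: "continuous_on {0..T} (\<lambda>u. X1 u - X2 u)" by (intro continuous_intros X1 X2)
    have \<delta>0: "0 \<le> \<delta>" "0 \<le> 1 / \<delta>" using \<delta> by auto
    have reg: "dyadic_regular T (?f i)" "dyadic_regular T (?g i)" "dyadic_regular T (?d i)" for i
      using component_regular[OF X1 R0, of 1 i] component_regular[OF X2 R0, of 1 i] component_regular[OF Dc D \<delta>0, of i] by simp_all
    have cont: "continuous_on {0..T} (?f i)" "continuous_on {0..T} (?g i)" "continuous_on {0..T} (?d i)" for i
      using component_scaled(1)[OF X1 R0, of 1 i] component_scaled(1)[OF X2 R0, of 1 i] component_scaled(1)[OF Dc D \<delta>0, of i] by simp_all
    have gag: "seminorm (incr (?f i)) \<le> ennreal R" "seminorm (incr (?g i)) \<le> ennreal R" for i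
      using component_scaled(2)[OF X1 R0, of 1 i] component_scaled(2)[OF X2 R0, of 1 i] by simp_all
    \<comment> \<open>The components of the normalised difference have seminorm at most 1, and
      \<open>1 \<le> R\<close> puts them into the same ball as those of \<open>X1\<close> and
      \<open>X2\<close>, so one constant \<open>C\<close> serves all pairs.\<close>
    have gag_d: "seminorm (incr (?d i)) \<le> ennreal R" for i
    proof -
      have "seminorm (incr (?d i)) \<le> ennreal (1 / \<delta> * \<delta>)"
        by (rule component_scaled(2)[OF Dc D \<delta>0])
      also have "\<dots> \<le> ennreal R" using \<delta> R by (intro ennreal_leI) simp
      finally show ?thesis .
    qed
    \<comment> \<open>\<open>area_difference\<close> pairs the normalised difference with
      \<open>X1\<close> in one term and with \<open>X2\<close> in the other, where the indices are
      exchanged.\<close>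
    let ?h = "\<lambda>q. area_dist T (?d (fst q)) (?f (snd q))" and ?k = "\<lambda>q. area_dist T (?d (snd q)) (?g (fst q))"
    have hk: "seminorm (?h q) \<le> ennreal C" "seminorm (?k q) \<le> ennreal C"
      "continuous2 T (?h q)" "continuous2 T (?k q)" for q
      by (rule C(2)[OF cont(3) cont(1) gag_d gag(1)] C(2)[OF cont(3) cont(2) gag_d gag(2)]
          area_dist_continuous[OF T reg(3) reg(1)] area_dist_continuous[OF T reg(3) reg(2)])+
    define H1 where "H1 = (\<lambda>s t. \<Sum>q\<in>UNIV. ?h q s t)"
    define H2 where "H2 = (\<lambda>s t. \<Sum>q\<in>UNIV. ?k q s t)"
    have H0: "0 \<le> H1 s t" "0 \<le> H2 s t" for s t
      unfolding H1_def H2_def by (intro sum_nonneg area_dist_ge(4))+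
    have H_cont: "continuous2 T H1" "continuous2 T H2"
      using hk(3,4) unfolding H1_def H2_def split_beta by (auto intro!: continuous_on_sum)
    have H_gag: "seminorm H1 \<le> ennreal C'" "seminorm H2 \<le> ennreal C'"
      unfolding H1_def H2_def C'_def
      by (rule gagliardo_sum_le[OF T p(1) C(1) finite]; (rule hk area_dist_ge(4)))+
    have sum_gag: "seminorm (\<lambda>s t. H1 s t + H2 s t) \<le> ennreal (4 * (C' + C'))"
      using H_cont H_gag H0 by (intro gagliardo_add_le[OF T p(1) C' C']) auto
    have sum_cont: "continuous_on ({0..T} \<times> {0..T}) (\<lambda>(s, t). H1 s t + H2 s t)"
      using H_cont unfolding split_beta by (intro continuous_on_add)
    have bound: "norm (\<pi>\<^sub>2 (lift_diff T X1 X2 s t))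
        \<le> (N * \<delta>) * (H1 s t + H2 s t)\<^sup>2" if st: "s \<in> {0..T}" "t \<in> {0..T}" for s t
    proof -
      let ?H = "H1 s t + H2 s t"
      have hle: "?h (i, j) s t \<le> ?H" "?k (i, j) s t \<le> ?H" for i j
      proof -
        have "?h (i, j) s t \<le> H1 s t" "?k (i, j) s t \<le> H2 s t"
          unfolding H1_def H2_def by (rule member_le_sum[of "(i, j)"]; simp add: area_dist_ge(4))+
        then show "?h (i, j) s t \<le> ?H" "?k (i, j) s t \<le> ?H" using H0[of s t] by linarith+
      qed
      have sq: "(area_dist T (?d i) (?f j) s t)\<^sup>2 \<le> ?H\<^sup>2" "(area_dist T (?d j) (?g i) s t)\<^sup>2 \<le> ?H\<^sup>2" for i j
        using hle[of i j] by (auto intro!: power_mono area_dist_ge(4))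
      have entry: "\<bar>\<pi>\<^sub>2 (lift_diff T X1 X2 s t) $ i $ j\<bar> \<le> 3 * \<delta> * ?H\<^sup>2" for i j
      proof -
        let ?a1 = "area T (?d i) (?f j) s t" and ?a2 = "area T (?d j) (?g i) s t"
        let ?di = "?d i t - ?d i s" and ?dj = "?d j t - ?d j s"
        let ?x = "?f j t - ?f j s" and ?y = "?g i t - ?g i s"
        have f: "?f i u = \<delta> * ?d i u + ?g i u" for i u using \<delta> by simp
        have A: "area T (?f i) (?f j) s t - area T (?g i) (?g j) s t = \<delta> * ?a1 - \<delta> * ?a2"
          by (rule area_difference[OF reg(1) reg(2) reg(1) reg(2) reg(3) reg(3) f f])
        have fi: "?f i t - ?f i s = \<delta> * ?di + ?y" and fj: "?x = \<delta> * ?dj + (?g j t - ?g j s)"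
          using \<delta> by (simp_all add: field_simps)
        \<comment> \<open>The counterpart of \<open>area_difference\<close> for the symmetric part:
          one factor \<delta> is extracted from a difference of products.\<close>
        have "(?f i t - ?f i s) * ?x - ?y * (?g j t - ?g j s) = \<delta> * (?di * ?x + ?y * ?dj)"
        proof -
          have "(\<delta> * a + y) * (\<delta> * b + z) - y * z = \<delta> * (a * (\<delta> * b + z) + y * b)" for a b y z
            by (simp add: algebra_simps)
          then show ?thesis by (simp only: fi fj)
        qed
        moreover have "\<pi>\<^sub>2 (lift_diff T X1 X2 s t) $ i $ j
          = (1/2) * ((?f i t - ?f i s) * ?x - ?y * (?g j t - ?g j s)) + (area T (?f i) (?f j) s t - area T (?g i) (?g j) s t)"
          unfolding rough_lift_increment[OF st] by (simp add: tensor_vec_def right_diff_distrib)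
        moreover have "(1/2) * (\<delta> * r) + (\<delta> * u - \<delta> * v) = \<delta> * (r / 2 + (u - v))" for r u v
          by (simp add: algebra_simps)
        ultimately have eq: "\<pi>\<^sub>2 (lift_diff T X1 X2 s t) $ i $ j
          = \<delta> * ((?di * ?x + ?y * ?dj) / 2 + (?a1 - ?a2))"
          by (simp only: A)
        have di: "\<bar>?di\<bar> \<le> ?H" "\<bar>?x\<bar> \<le> ?H" "\<bar>?dj\<bar> \<le> ?H" "\<bar>?y\<bar> \<le> ?H"
          using order_trans[OF area_dist_ge(1)[of "?d i" s t T "?f j"]] hle(1)[of i j]
            order_trans[OF area_dist_ge(2)[of "?f j" s t T "?d i"]]
            order_trans[OF area_dist_ge(1)[of "?d j" s t T "?g i"]] hle(2)[of i j]
            order_trans[OF area_dist_ge(2)[of "?g i" s t T "?d j"]]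
          by (simp_all only: fst_conv snd_conv abs_minus_commute)
        have "\<bar>(?di * ?x + ?y * ?dj) / 2 + (?a1 - ?a2)\<bar> \<le> (\<bar>?di\<bar> * \<bar>?x\<bar> + \<bar>?y\<bar> * \<bar>?dj\<bar>) / 2 + (\<bar>?a1\<bar> + \<bar>?a2\<bar>)"
        proof -
          have "\<bar>(?di * ?x + ?y * ?dj) / 2\<bar> \<le> (\<bar>?di\<bar> * \<bar>?x\<bar> + \<bar>?y\<bar> * \<bar>?dj\<bar>) / 2"
            unfolding abs_mult[symmetric] by (simp only: abs_divide abs_numeral) (intro divide_right_mono abs_triangle_ineq, simp)
          then show ?thesis by (intro order_trans[OF abs_triangle_ineq] add_mono abs_triangle_ineq4)
        qed
        also have "\<dots> \<le> (?H * ?H + ?H * ?H) / 2 + (?H\<^sup>2 + ?H\<^sup>2)"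
          using di H0[of s t] sq order_trans[OF area_le_dist]
          by (intro add_mono divide_right_mono mult_mono) auto
        also have "\<dots> = 3 * ?H\<^sup>2" by (simp add: power2_eq_square)
        finally have "\<delta> * \<bar>(?di * ?x + ?y * ?dj) / 2 + (?a1 - ?a2)\<bar> \<le> \<delta> * (3 * ?H\<^sup>2)"
          using \<delta> by (intro mult_left_mono) auto
        then show ?thesis unfolding eq using \<delta> by (simp add: abs_mult mult_ac)
      qed
      have "norm (\<pi>\<^sub>2 (lift_diff T X1 X2 s t))
        \<le> (\<Sum>i\<in>(UNIV :: 'd set). \<Sum>j\<in>(UNIV :: 'd set). 3 * \<delta> * ?H\<^sup>2)"
        by (rule order_trans[OF norm_matrix_le_sum]) (intro sum_mono entry)
      also have "\<dots> = (N * \<delta>) * ?H\<^sup>2" by (simp add: N_def power2_eq_square)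
      finally show ?thesis .
    qed
    have "gagliardo 2 \<alpha> p T (\<lambda>s t. norm (\<pi>\<^sub>2 (lift_diff T X1 X2 s t)))
      \<le> ennreal ((N * \<delta>) * (4 * (C' + C')) ^ 2)"
      using bound H0 C' \<delta> by (intro gagliardo_power_le[OF T p_pos _ _ _ sum_cont sum_gag]) (auto simp: N_def)
    then show "gagliardo 2 \<alpha> p T (\<lambda>s t. norm (\<pi>\<^sub>2 (lift_diff T X1 X2 s t)))
      \<le> ennreal (N * (4 * (C' + C'))\<^sup>2 * \<delta>)" by (simp add: mult_ac)
  qed
qed

text \<open>On the unit ball around \<open>X\<close> all seminorms are bounded by one
  \<open>R\<close>, so \<open>level2_lipschitz\<close> applies with a single constant; the first
  level contributes the 1 in \<open>1 + C\<close>.\<close>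

lemma rough_lift_locally_lipschitz:
  "locally_lipschitz_sobolev \<alpha> p T (rough_lift T :: (real \<Rightarrow> real ^ 'd::finite) \<Rightarrow> real \<Rightarrow> 'd tensor2)"
  unfolding locally_lipschitz_sobolev_def
proof
  fix X :: "real \<Rightarrow> real ^ 'd" assume X: "X \<in> sobolev_space \<alpha> p T"
  obtain R0 where X0: "continuous_on {0..T} X" "seminorm (nincr X) \<le> ennreal R0" "0 \<le> R0"
    using sobolev_spaceD[OF X] .
  define U where "U = {Y \<in> sobolev_space \<alpha> p T. sobolev_norm \<alpha> p T (\<lambda>t. Y t - X t) < ennreal 1}"
  \<comment> \<open>The factor 4 is that of \<open>gagliardo_add_le\<close>, applied to
    \<open>Y - X\<close> and \<open>X\<close>.\<close>
  define R where "R = 4 * (1 + R0)"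
  have R: "1 \<le> R" using X0(3) by (simp add: R_def)
  have U: "continuous_on {0..T} Y" "seminorm (nincr Y) \<le> ennreal R" if Y: "Y \<in> U" for Y
  proof -
    show Yc: "continuous_on {0..T} Y" using Y by (simp add: U_def sobolev_space_def)
    then have Dc: "continuous_on {0..T} (\<lambda>t. Y t - X t)" using X0(1) by (intro continuous_intros)
    have "seminorm (\<lambda>u v. norm ((Y u - X u) - (Y v - X v))) \<le> sobolev_norm \<alpha> p T (\<lambda>t. Y t - X t)"
      unfolding sobolev_norm_def by simp
    also have "\<dots> \<le> ennreal 1" using Y by (simp add: U_def less_imp_le)
    finally have D: "seminorm (\<lambda>u v. norm ((Y u - X u) - (Y v - X v))) \<le> ennreal 1" .
    note cD = continuous_increment_norm[OF Dc] and cX = continuous_increment_norm[OF X0(1)]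
    have sum: "seminorm (\<lambda>u v. norm ((Y u - X u) - (Y v - X v)) + norm (X u - X v)) \<le> ennreal R"
      unfolding R_def using X0 by (intro gagliardo_add_le[OF T p(1) _ _ cD D cX]) auto
    have "seminorm (nincr Y) \<le> ennreal (1 * R ^ 1)"
    proof (rule gagliardo_power_le[OF T p_pos _ _ _ _ sum])
      show "continuous_on ({0..T} \<times> {0..T}) (\<lambda>(s, t). norm ((Y s - X s) - (Y t - X t)) + norm (X s - X t))"
        using cD cX unfolding split_beta by (intro continuous_on_add)
      fix s t
      show "0 \<le> norm (Y s - Y t) \<and> norm (Y s - Y t) \<le> 1 * (norm ((Y s - X s) - (Y t - X t)) + norm (X s - X t)) ^ 1"
        using norm_triangle_ineq[of "(Y s - X s) - (Y t - X t)" "X s - X t"] by (simp add: algebra_simps)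
    qed (use R in auto)
    then show "seminorm (nincr Y) \<le> ennreal R" by simp
  qed
  obtain C where C: "0 \<le> C" "\<And>(X1 :: real \<Rightarrow> real ^ 'd) X2 \<delta>. continuous_on {0..T} X1 \<Longrightarrow> continuous_on {0..T} X2 \<Longrightarrow>
    seminorm (nincr X1) \<le> ennreal R \<Longrightarrow>
    seminorm (nincr X2) \<le> ennreal R \<Longrightarrow> 0 < \<delta> \<Longrightarrow>
    seminorm (\<lambda>u v. norm ((X1 u - X2 u) - (X1 v - X2 v))) \<le> ennreal \<delta> \<Longrightarrow>
    gagliardo 2 \<alpha> p T (\<lambda>s t. norm (\<pi>\<^sub>2 (lift_diff T X1 X2 s t)))
      \<le> ennreal (C * \<delta>)"
    using level2_lipschitz[OF R, where 'd = 'd] by blast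
  show "\<exists>U C. sobolev_neighbourhood \<alpha> p T X U \<and> (\<forall>X1\<in>U. \<forall>X2\<in>U.
      rho_sobolev \<alpha> p T (rough_lift T X1) (rough_lift T X2) \<le> ennreal C * sobolev_norm \<alpha> p T (\<lambda>t. X1 t - X2 t))"
  proof (intro exI[of _ U] exI[of _ "1 + C"] conjI ballI)
    show "sobolev_neighbourhood \<alpha> p T X U"
      unfolding sobolev_neighbourhood_def U_def by (auto intro!: exI[of _ 1])
    fix X1 X2 assume X12: "X1 \<in> U" "X2 \<in> U"
    note c1 = U[OF X12(1)] and c2 = U[OF X12(2)]
    show "rho_sobolev \<alpha> p T (rough_lift T X1) (rough_lift T X2) \<le> ennreal (1 + C) * sobolev_norm \<alpha> p T (\<lambda>t. X1 t - X2 t)"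
    \<comment> \<open>Strictly positive upper bounds \<delta> of the norm permit the division by
      \<delta> in \<open>level2_lipschitz\<close>, also when the norm of the difference is
      0.\<close>
    proof (rule ennreal_le_mult_of_upper)
      show "0 < 1 + C" using C by simp
      fix \<delta> :: real assume \<delta>: "0 < \<delta>" "sobolev_norm \<alpha> p T (\<lambda>t. X1 t - X2 t) \<le> ennreal \<delta>"
      have "seminorm (\<lambda>u v. norm ((X1 u - X2 u) - (X1 v - X2 v))) \<le> sobolev_norm \<alpha> p T (\<lambda>t. X1 t - X2 t)"
        unfolding sobolev_norm_def by simp
      with \<delta>(2) have D: "seminorm (\<lambda>u v. norm ((X1 u - X2 u) - (X1 v - X2 v))) \<le> ennreal \<delta>"
        by (rule order_trans[rotated])
      have Dc: "continuous_on {0..T} (\<lambda>t. X1 t - X2 t)" using c1(1) c2(1) by (intro continuous_intros)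
      have "seminorm (\<lambda>s t. norm (\<pi>\<^sub>1 (lift_diff T X1 X2 s t)))
        \<le> ennreal (1 * \<delta> ^ 1)"
      proof (rule gagliardo_power_le[OF T p_pos _ _ _ continuous_increment_norm[OF Dc] D])
        fix s t assume st: "s \<in> {0..T}" "t \<in> {0..T}"
        have "norm (\<pi>\<^sub>1 (lift_diff T X1 X2 s t))
          = norm ((X1 s - X2 s) - (X1 t - X2 t))"
          unfolding rough_lift_increment[OF st]
          using norm_minus_commute[of "X1 t - X1 s" "X2 t - X2 s"] by (simp add: algebra_simps)
        then show "0 \<le> norm (\<pi>\<^sub>1 (lift_diff T X1 X2 s t))
          \<and> norm (\<pi>\<^sub>1 (lift_diff T X1 X2 s t))
            \<le> 1 * norm ((X1 s - X2 s) - (X1 t - X2 t)) ^ 1" by simp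
      qed (use \<delta> in auto)
      moreover have "gagliardo 2 \<alpha> p T (\<lambda>s t. norm (\<pi>\<^sub>2 (lift_diff T X1 X2 s t)))
        \<le> ennreal (C * \<delta>)"
        by (rule C(2)[OF c1(1) c2(1) c1(2) c2(2) \<delta>(1) D])
      ultimately have "rho_sobolev \<alpha> p T (rough_lift T X1) (rough_lift T X2) \<le> ennreal (1 * \<delta> ^ 1) + ennreal (C * \<delta>)"
        unfolding rho_sobolev_def by (rule add_mono)
      also have "\<dots> = ennreal ((1 + C) * \<delta>)"
        using \<delta> C by (simp add: distrib_right flip: ennreal_plus)
      finally show "rho_sobolev \<alpha> p T (rough_lift T X1) (rough_lift T X2) \<le> ennreal ((1 + C) * \<delta>)" .
    qed
  qed
qed

end

theorem theorem3p13:
  fixes \<alpha> T :: real and p :: ereal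
  assumes "T > 0" and "1/3 < \<alpha>" and "\<alpha> < 1/2" and "1 < p" and "ereal \<alpha> > 1 / p"
  shows "\<exists>L :: (real \<Rightarrow> real ^ 'd) \<Rightarrow> (real \<Rightarrow> 'd::finite tensor2).
           L \<in> sobolev_space \<alpha> p T \<rightarrow> sobolev_rough_paths \<alpha> p T \<and>
           (\<forall>X\<in>sobolev_space \<alpha> p T. sobolev_rough_lift \<alpha> p T X (L X)) \<and>
           locally_lipschitz_sobolev \<alpha> p T L"
proof (intro exI[of _ "rough_lift T"] conjI)
  have \<alpha>: "0 < \<alpha>" using assms(2) by simp
  show lift: "\<forall>X\<in>sobolev_space \<alpha> p T. sobolev_rough_lift \<alpha> p T X (rough_lift T X)"
    using rough_lift_is_lift[OF assms(1) \<alpha> assms(3-5)] by blast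
  then show "rough_lift T \<in> sobolev_space \<alpha> p T \<rightarrow> sobolev_rough_paths \<alpha> p T"
    by (auto simp: sobolev_rough_lift_def)
  show "locally_lipschitz_sobolev \<alpha> p T (rough_lift T)"
    by (rule rough_lift_locally_lipschitz[OF assms(1) \<alpha> assms(3-5)])
qed

end
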